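(* Let $n\geq2$ and let $\mathcal R$ be a potential class of resolvent type, with associated function $[\,\cdot\,]_{\mathcal R}$. Assume that $u\in\mathcal H^1_t(\mathcal L_2)\cap\mathcal H^2_x(\mathcal L_2)$ is a solution of the Schrödinger inequality $$|(i\partial_t+\Delta)u(x,t)|\leq|V(x)u(x,t)|$$ with $V\in\mathcal R$, and that $u$ vanishes in a half space of $\mathbb R^{n+1}$ with a unit normal vector $\nu\in\mathbb R^{n+1}$. Then $u$ must be identically zero if $|V|\in A_2(\nu')$ and $[V]_{\mathcal R}<\varepsilon$ for a sufficiently small $\varepsilon>0$.
   Context: Here $u:\mathbb R^{n+1}\to\mathbb C$ is a function of $(x,t)\in\mathbb R^n\times\mathbb R$, $V:\mathbb R^n\to\mathbb C$ is a potential, and $\Delta$ is the Laplacian in $x$. $L^2(w)$ denotes the $L^2$ space with respect to the measure $w\,dx$. Resolvent type: a potential class $\mathcal R$ is of resolvent type if there exists a suitable function $[\,\cdot\,]_{\mathcal R}$, depending only on $\mathcal R$ itself, such that for $V\in\mathcal R$ the resolvent estimate $\|(-\Delta-z)^{-1}f\|_{L^2(|V|)}\leq C(V)\|f\|_{L^2(|V|^{-1})}$, $z\in\mathbb C\setminus\mathbb R$, with $C(V)$ independent of $z$, holds with bound $C(V)=[V]_{\mathcal R}$. If $|V_1|\leq|V_2|$ and the estimate holds for $V_2$, then it also holds for $V_1$ with $C(V_1)=C(V_2)$, and in this case $[V_1]_{\mathcal R}$ is taken to be at most $[V_2]_{\mathcal R}$. Solution space: $\mathcal L_2=L^2\cap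 L^2(|V|^{-1})$ (for functions on $\mathbb R^{n+1}$, with the weight depending on $x$ only); $\mathcal H^1_t(\mathcal L_2)$ is the space of functions whose derivatives up to order $1$ with respect to $t$ belong to $\mathcal L_2$, and $\mathcal H^2_x(\mathcal L_2)$ is the space of functions whose derivatives up to order $2$ with respect to $x$ belong to $\mathcal L_2$. For $\nu=(\nu_1,\dots,\nu_n,\nu_{n+1})$, $\nu'=(\nu_1,\dots,\nu_n)\in\mathbb R^n$. Directional $A_2$: a weight is a locally integrable function with values in $[0,\infty]$ which is allowed to be zero or infinite only on a set of Lebesgue measure zero. A weight $w$ on $\mathbb R$ is in $A_2(\mathbb R)$ if there is a constant $C_{A_2}$ with $\sup_I\big(\frac1{|I|}\int_Iw\big)\big(\frac1{|I|}\int_Iw^{-1}\big)<C_{A_2}$, the supremum being over intervals $I$. Given $v\in\mathbb R^n$, write $x=sv+\widetilde x$ with $s\in\mathbb R$ and $\widetilde x$ in a hyperplane $\mathcal P$ whose normal vector is $v$; then $w\in A_2(v)$ means that the function $w_{\widetilde x}(s):=w(x)$ is in $A_2(\mathbb R)$ with $C_{A_2}$ uniform in almost every $\widetilde x\in\mathcal P$. *)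

theory Defs
  imports "HOL-Analysis.Analysis"
begin

section \<open>Weak derivatives and Sobolev-type spaces\<close>

text \<open>Functions of class \<open>C\<^sup>k\<close>: for \<open>k > 0\<close>, differentiable everywhere, all
  first partial derivatives being of class \<open>C\<^sup>k\<^sup>-\<^sup>1\<close>.\<close>

primrec Ck :: "nat \<Rightarrow> ('a::euclidean_space \<Rightarrow> real) \<Rightarrow> bool" where
  "Ck 0 \<phi> \<longleftrightarrow> continuous_on UNIV \<phi>"
| "Ck (Suc k) \<phi> \<longleftrightarrow> (\<forall>x. \<phi> differentiable (at x)) \<and>
     (\<forall>b\<in>Basis. Ck k (\<lambda>x. frechet_derivative \<phi> (at x) b))"

definition test_function :: "('a::euclidean_space \<Rightarrow> real) \<Rightarrow> bool" where
  "test_function \<phi> \<longleftrightarrow> (\<forall>k. Ck k \<phi>) \<and> compact (closure {x. \<phi> x \<noteq> 0})"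

definition locally_integrable :: "('a::euclidean_space \<Rightarrow> complex) \<Rightarrow> bool" where
  "locally_integrable f \<longleftrightarrow> (\<forall>K. compact K \<longrightarrow> f absolutely_integrable_on K)"

definition has_weak_deriv ::
  "('a::euclidean_space \<Rightarrow> complex) \<Rightarrow> 'a \<Rightarrow> ('a \<Rightarrow> complex) \<Rightarrow> bool" where
  "has_weak_deriv f b g \<longleftrightarrow> locally_integrable f \<and> locally_integrable g \<and>
     (\<forall>\<phi>. test_function \<phi> \<longrightarrow>
        (LINT x|lebesgue. frechet_derivative \<phi> (at x) b *\<^sub>R f x) =
        - (LINT x|lebesgue. \<phi> x *\<^sub>R g x))"

text \<open>A representative of the weak derivative in direction \<open>b\<close>; it is unique up to null sets,
  and meaningful only where a weak derivative exists.\<close>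

definition weak_deriv :: "'a::euclidean_space \<Rightarrow> ('a \<Rightarrow> complex) \<Rightarrow> 'a \<Rightarrow> complex" where
  "weak_deriv b f = (SOME g. has_weak_deriv f b g)"

text \<open>\<open>sobolev k B X\<close>: the functions all of whose weak derivatives up to order \<open>k\<close>, taken in
  directions from \<open>B\<close>, belong to the function space \<open>X\<close>.\<close>

primrec sobolev ::
  "nat \<Rightarrow> 'a::euclidean_space set \<Rightarrow> ('a \<Rightarrow> complex) set \<Rightarrow> ('a \<Rightarrow> complex) set" where
  "sobolev 0 B X = X"
| "sobolev (Suc k) B X = {f \<in> X. \<forall>b\<in>B. \<exists>g \<in> sobolev k B X. has_weak_deriv f b g}"

definition laplacian_dirs ::
  "'a::euclidean_space set \<Rightarrow> ('a \<Rightarrow> complex) \<Rightarrow> 'a \<Rightarrow> complex" where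
  "laplacian_dirs B f x = (\<Sum>b\<in>B. weak_deriv b (weak_deriv b f) x)"

section \<open>Weighted \<open>L\<^sup>2\<close> spaces\<close>

text \<open>Weights take values in \<open>[0,\<infinity>]\<close>. In \<open>ennreal\<close> one has \<open>inverse 0 = \<infinity>\<close> and
  \<open>0 * \<infinity> = 0\<close>, so membership in \<open>L\<^sup>2(|V|\<^sup>-\<^sup>1)\<close> forces a function to vanish almost everywhere on
  the zero set of \<open>V\<close>.\<close>

definition L2_mass :: "('a::euclidean_space \<Rightarrow> ennreal) \<Rightarrow> ('a \<Rightarrow> complex) \<Rightarrow> ennreal" where
  "L2_mass w f = (\<integral>\<^sup>+x. ennreal ((cmod (f x))\<^sup>2) * w x \<partial>lebesgue)"

definition L2 :: "('a::euclidean_space \<Rightarrow> ennreal) \<Rightarrow> ('a \<Rightarrow> complex) set" where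
  "L2 w = {f \<in> borel_measurable lebesgue. L2_mass w f < \<infinity>}"

definition L2_norm :: "('a::euclidean_space \<Rightarrow> ennreal) \<Rightarrow> ('a \<Rightarrow> complex) \<Rightarrow> real" where
  "L2_norm w f = sqrt (enn2real (L2_mass w f))"

definition absw :: "('a \<Rightarrow> complex) \<Rightarrow> 'a \<Rightarrow> ennreal" where
  "absw V x = ennreal (cmod (V x))"

section \<open>Potential classes of resolvent type\<close>

text \<open>The graph of the operator \<open>(-\<Delta> - z)\<^sup>-\<^sup>1\<close> on \<open>L\<^sup>2\<close>, where \<open>\<Delta>\<close> has domain \<open>H\<^sup>2\<close>:
  \<open>is_resolvent z f g\<close> says \<open>g = (-\<Delta> - z)\<^sup>-\<^sup>1 f\<close>.\<close>

definition is_resolvent ::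
  "complex \<Rightarrow> ('a::euclidean_space \<Rightarrow> complex) \<Rightarrow> ('a \<Rightarrow> complex) \<Rightarrow> bool" where
  "is_resolvent z f g \<longleftrightarrow> g \<in> sobolev 2 Basis (L2 (\<lambda>_. 1)) \<and>
     (AE x in lebesgue. - laplacian_dirs Basis g x - z * g x = f x)"

text \<open>The resolvent is an operator on \<open>L\<^sup>2\<close>, so the estimate is stated for the \<open>f\<close> in
  \<open>L\<^sup>2 \<inter> L\<^sup>2(|V|\<^sup>-\<^sup>1)\<close>, which is dense in \<open>L\<^sup>2(|V|\<^sup>-\<^sup>1)\<close>.\<close>

definition resolvent_estimate :: "('a::euclidean_space \<Rightarrow> complex) \<Rightarrow> real \<Rightarrow> bool" where
  "resolvent_estimate V C \<longleftrightarrow>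
     (\<forall>z f g. z \<notin> \<real> \<longrightarrow> f \<in> L2 (\<lambda>_. 1) \<inter> L2 (\<lambda>x. inverse (absw V x)) \<longrightarrow> is_resolvent z f g \<longrightarrow>
        g \<in> L2 (absw V) \<and> L2_norm (absw V) g \<le> C * L2_norm (\<lambda>x. inverse (absw V x)) f)"

definition resolvent_type ::
  "('a::euclidean_space \<Rightarrow> complex) set \<Rightarrow> (('a \<Rightarrow> complex) \<Rightarrow> real) \<Rightarrow> bool" where
  "resolvent_type R br \<longleftrightarrow>
     (\<forall>V\<in>R. V \<in> borel_measurable lebesgue \<and> 0 \<le> br V \<and> resolvent_estimate V (br V)) \<and>
     (\<forall>V\<^sub>1\<in>R. \<forall>V\<^sub>2\<in>R. (\<forall>x. cmod (V\<^sub>1 x) \<le> cmod (V\<^sub>2 x)) \<longrightarrow> br V\<^sub>1 \<le> br V\<^sub>2)"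

section \<open>Directional \<open>A\<^sub>2\<close> weights\<close>

definition weight :: "('a::euclidean_space \<Rightarrow> ennreal) \<Rightarrow> bool" where
  "weight w \<longleftrightarrow> w \<in> borel_measurable lebesgue \<and>
     (\<forall>K. compact K \<longrightarrow> (\<integral>\<^sup>+x\<in>K. w x \<partial>lebesgue) < \<infinity>) \<and>
     (AE x in lebesgue. w x \<noteq> 0 \<and> w x \<noteq> \<infinity>)"

text \<open>\<open>w \<in> A\<^sub>2(\<real>)\<close> with constant \<open>C\<close>.\<close>

definition A2_real :: "real \<Rightarrow> (real \<Rightarrow> ennreal) \<Rightarrow> bool" where
  "A2_real C w \<longleftrightarrow> weight w \<and>
     (SUP (a, b) \<in> {(a, b). a < b}.
        ((\<integral>\<^sup>+s\<in>{a..b}. w s \<partial>lebesgue) / ennreal (b - a)) *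
        ((\<integral>\<^sup>+s\<in>{a..b}. inverse (w s) \<partial>lebesgue) / ennreal (b - a))) < ennreal C"

text \<open>The component of \<open>x\<close> in the hyperplane \<open>P\<close> through the origin with normal vector \<open>v\<close>.\<close>

definition perp_part :: "'a::euclidean_space \<Rightarrow> 'a \<Rightarrow> 'a" where
  "perp_part v x = x - ((x \<bullet> v) / (v \<bullet> v)) *\<^sub>R v"

text \<open>\<open>w \<in> A\<^sub>2(v)\<close> with constant \<open>C\<close>. By Fubini, a subset \<open>N\<close> of the hyperplane \<open>P\<close> is null in \<open>P\<close>
  if and only if the cylinder \<open>{x. perp_part v x \<in> N}\<close> is null in the whole space, so that
  ``almost every \<open>x\<close>'' below amounts to ``almost every \<open>perp_part v x\<close> in \<open>P\<close>''.
  For \<open>v = 0\<close> one has \<open>perp_part v x = x\<close> and the slices are the constant functions with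
  value \<open>w x\<close>.\<close>

definition A2_dir :: "real \<Rightarrow> 'a::euclidean_space \<Rightarrow> ('a \<Rightarrow> ennreal) \<Rightarrow> bool" where
  "A2_dir C v w \<longleftrightarrow> weight w \<and>
     (AE x in lebesgue. A2_real C (\<lambda>s. w (s *\<^sub>R v + perp_part v x)))"

section \<open>The Schroedinger inequality\<close>

text \<open>Functions of \<open>(x, t)\<close>; the weight depends on \<open>x\<close> only.\<close>

definition cal_L2 ::
  "('a::euclidean_space \<Rightarrow> complex) \<Rightarrow> ('a \<times> real \<Rightarrow> complex) set" where
  "cal_L2 V = L2 (\<lambda>_. 1) \<inter> L2 (\<lambda>(x, t). inverse (absw V x))"

definition t_dirs :: "('a::euclidean_space \<times> real) set" where
  "t_dirs = {(0, 1)}"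

definition x_dirs :: "('a::euclidean_space \<times> real) set" where
  "x_dirs = (\<lambda>b. (b, 0)) ` Basis"

definition solution_space ::
  "('a::euclidean_space \<Rightarrow> complex) \<Rightarrow> ('a \<times> real \<Rightarrow> complex) set" where
  "solution_space V = sobolev 1 t_dirs (cal_L2 V) \<inter> sobolev 2 x_dirs (cal_L2 V)"

definition schroedinger_op ::
  "('a::euclidean_space \<times> real \<Rightarrow> complex) \<Rightarrow> 'a \<times> real \<Rightarrow> complex" where
  "schroedinger_op u y = \<i> * weak_deriv (0, 1) u y + laplacian_dirs x_dirs u y"

definition schroedinger_inequality ::
  "('a::euclidean_space \<Rightarrow> complex) \<Rightarrow> ('a \<times> real \<Rightarrow> complex) \<Rightarrow> bool" where
  "schroedinger_inequality V u \<longleftrightarrow>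
     (AE (x, t) in lebesgue. cmod (schroedinger_op u (x, t)) \<le> cmod (V x * u (x, t)))"

definition half_space :: "'a::euclidean_space \<Rightarrow> real \<Rightarrow> 'a set" where
  "half_space \<nu> c = {y. y \<bullet> \<nu> > c}"

end

theory Submission
  imports Defs "HOL-Probability.Probability"
begin

text \<open>Since \<open>u\<close> lies globally in \<open>L\<^sup>2(|V|\<^sup>-\<^sup>1)\<close>, the partial Fourier transform of \<open>u\<close> in \<open>t\<close> is an
  admissible input of the resolvent estimate, and no Carleman weight is needed: \<open>\<epsilon> = 1\<close> works.
  Let \<open>\<eta>\<close> be a cutoff in \<open>t\<close>, \<open>F = (i\<partial>\<^sub>t + \<Delta>) u\<close> and \<open>H = \<eta> F + i \<eta>' u = (i\<partial>\<^sub>t + \<Delta>)(\<eta> u)\<close>. The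
  Fourier transform \<open>g\<close> of \<open>\<eta> u\<close> at frequency \<open>\<tau>\<close> satisfies \<open>(-\<Delta> - z) g = - H\<^sub>\<tau> - i \<delta> g\<close> with
  \<open>z = -\<tau> + i \<delta>\<close>, \<open>H\<^sub>\<tau>\<close> being the transform of \<open>H\<close>. The resolvent estimate and
  \<open>\<delta> \<rightarrow> 0\<close> give \<open>\<parallel>g\<parallel> \<le> [V] \<parallel>H\<^sub>\<tau>\<parallel>\<close> in the norms of \<open>L\<^sup>2(|V|)\<close> and \<open>L\<^sup>2(|V|\<^sup>-\<^sup>1)\<close>, and Plancherel in \<open>t\<close> gives
  \<open>\<parallel>\<eta> u\<parallel> \<le> [V] \<parallel>\<eta> F + i \<eta>' u\<parallel>\<close>. Here \<open>|\<eta> F| \<le> |V \<eta> u|\<close>, so the first term is absorbed when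
  \<open>[V] < 1\<close>; dilating \<open>\<eta>\<close> makes the second one vanish.\<close>

section \<open>Test functions\<close>

text \<open>The resolvent bound acts at one frequency at a time, so the work lies in passing between
  a fixed frequency and space-time masses. The transform of \<eta> u at \<tau> is the pairing of u
  in time with the complex test function \<eta>(t) exp(-i \<tau> t). Weak derivatives of such
  pairings are read off from product test functions, which puts the pairings into the domain H^2 of
  the Laplacian. Of Plancherel only an inequality and a limit are needed, and Gaussian averages over
  frequency give both: they never exceed the L^2 mass and converge to it. Fatou for u and the bound
  for the source then suffice in the presence of a weight in x. That u lies in L^2(1/|V|) enters
  twice: it makes \<delta> g negligible in the resolvent equation, and it makes the mass of \<eta>'
  u finite, hence O(m^-2) after dilation. Finiteness of the mass of \<eta> u in L^2(|V|), without
  which nothing can be absorbed, comes out of the estimate itself, because F lies in L^2(1/|V|).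
  Squares of sums are split with a parameter \<theta>, so that the leading constant stays close to
  [V]^2 and the threshold is 1.\<close>

lemma Ck_SucI:
  assumes "\<And>x. (f has_derivative f' x) (at x)" "\<And>b. b \<in> Basis \<Longrightarrow> Ck k (\<lambda>x. f' x b)"
  shows "Ck (Suc k) f"
proof -
  have "frechet_derivative f (at x) = f' x" for x
    using frechet_derivative_at[OF assms(1)] by simp
  then show ?thesis
    using assms by (auto intro: differentiableI)
qed

lemma Ck_has_derivative:
  assumes "Ck (Suc k) f"
  shows "(f has_derivative frechet_derivative f (at x)) (at x)"
  using assms frechet_derivative_works by auto

lemma Ck_Suc_imp_Ck: "Ck (Suc k) f \<Longrightarrow> Ck k f"
proof (induction k arbitrary: f)
  case 0
  then show ?case
    by (auto simp: continuous_on_eq_continuous_at intro!: differentiable_imp_continuous_within)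
next
  case (Suc k)
  then show ?case
    using Suc.IH by auto
qed

lemma Ck_imp_continuous: "Ck k f \<Longrightarrow> continuous_on S f"
proof (induction k)
  case 0
  then show ?case by (auto intro: continuous_on_subset)
next
  case (Suc k)
  then show ?case using Ck_Suc_imp_Ck by blast
qed

lemma Ck_const: "Ck k (\<lambda>_. c)"
proof (induction k arbitrary: c)
  case (Suc k)
  show ?case by (rule Ck_SucI[where f' = "\<lambda>_ _. 0"]) (use Suc in auto)
qed simp

lemma Ck_add:
  assumes "Ck k f" "Ck k g"
  shows "Ck k (\<lambda>x. f x + g x)"
  using assms
proof (induction k arbitrary: f g)
  case 0
  then show ?case by (auto intro: continuous_intros)
next
  case (Suc k)
  show ?case
  proof (rule Ck_SucI)
    show "((\<lambda>x. f x + g x) has_derivative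
        (\<lambda>h. frechet_derivative f (at x) h + frechet_derivative g (at x) h)) (at x)" for x
      by (intro has_derivative_add Ck_has_derivative[OF Suc.prems(1)] Ck_has_derivative[OF Suc.prems(2)])
  qed (use Suc in auto)
qed

lemma Ck_mult:
  assumes "Ck k f" "Ck k g"
  shows "Ck k (\<lambda>x. f x * g x)"
  using assms
proof (induction k arbitrary: f g)
  case 0
  then show ?case by (auto intro: continuous_intros)
next
  case (Suc k)
  show ?case
  proof (rule Ck_SucI)
    show "((\<lambda>x. f x * g x) has_derivative
        (\<lambda>h. f x * frechet_derivative g (at x) h + frechet_derivative f (at x) h * g x)) (at x)" for x
      by (intro has_derivative_mult Ck_has_derivative[OF Suc.prems(1)] Ck_has_derivative[OF Suc.prems(2)])
    show "Ck k (\<lambda>x. f x * frechet_derivative g (at x) b + frechet_derivative f (at x) b * g x)"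
      if "b \<in> Basis" for b
      using Suc.prems that by (intro Ck_add Suc.IH) (auto intro: Ck_Suc_imp_Ck)
  qed
qed

lemma Ck_sum:
  "(\<And>i. i \<in> I \<Longrightarrow> Ck k (f i)) \<Longrightarrow> Ck k (\<lambda>x. \<Sum>i\<in>I. f i x)"
  by (induction I rule: infinite_finite_induct) (auto intro: Ck_const Ck_add)

lemma Ck_prod:
  "(\<And>i. i \<in> I \<Longrightarrow> Ck k (f i)) \<Longrightarrow> Ck k (\<lambda>x. \<Prod>i\<in>I. f i x)"
  by (induction I rule: infinite_finite_induct) (auto intro: Ck_const Ck_mult)

text \<open>\<open>Ck\<close> speaks of derivatives along basis vectors only, whereas the chain rule
  produces the derivative of \<open>f\<close> along \<open>L b\<close>. Expanding \<open>L b\<close>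
  in the basis gives a combination of partial derivatives with constant coefficients, to which the
  induction hypothesis applies.\<close>

lemma Ck_affine:
  fixes f :: "'a::euclidean_space \<Rightarrow> real" and L :: "'b::euclidean_space \<Rightarrow> 'a"
  assumes "Ck k f" and L: "bounded_linear L"
  shows "Ck k (\<lambda>x. f (L x + c))"
  using assms(1)
proof (induction k arbitrary: f)
  case 0
  then show ?case
    by (auto intro!: continuous_intros continuous_on_compose2[of UNIV f]
        bounded_linear.continuous_on[OF L])
next
  case (Suc k)
  let ?D = "\<lambda>x. frechet_derivative f (at x)"
  show ?case
  proof (rule Ck_SucI)
    fix x
    show "((\<lambda>x. f (L x + c)) has_derivative (\<lambda>h. ?D (L x + c) (L h))) (at x)"
    proof (rule has_derivative_compose[of "\<lambda>x. L x + c" L x UNIV f])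
      show "((\<lambda>x. L x + c) has_derivative L) (at x)"
        using bounded_linear_imp_has_derivative[OF L, of "at x"] by (auto intro!: derivative_eq_intros)
    qed (rule Ck_has_derivative[OF Suc.prems])
  next
    fix b :: 'b assume "b \<in> Basis"
    have "?D y (L b) = (\<Sum>i\<in>Basis. (L b \<bullet> i) * ?D y i)" for y
    proof -
      have lin: "linear (?D y)"
        using Ck_has_derivative[OF Suc.prems] has_derivative_linear by blast
      have "?D y (L b) = ?D y (\<Sum>i\<in>Basis. (L b \<bullet> i) *\<^sub>R i)"
        by (simp add: euclidean_representation)
      also have "\<dots> = (\<Sum>i\<in>Basis. (L b \<bullet> i) * ?D y i)"
        by (simp add: linear_sum[OF lin] linear_cmul[OF lin])
      finally show ?thesis .
    qed
    then show "Ck k (\<lambda>x. ?D (L x + c) (L b))"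
      using Suc by (auto intro!: Ck_sum Ck_mult Ck_const)
  qed
qed

text \<open>Replaces formulas for the k-th derivative: it is enough to exhibit a set closed under
  differentiation. The sets used below are the span of cos(a x) and sin(a x), and the functions
  p(1/x) exp(-1/x) with polynomial p.\<close>

lemma Ck_real_family:
  fixes F :: "(real \<Rightarrow> real) set"
  assumes "\<And>f. f \<in> F \<Longrightarrow> \<exists>g\<in>F. \<forall>x. (f has_real_derivative g x) (at x)" "f \<in> F"
  shows "Ck k f"
  using assms(2)
proof (induction k arbitrary: f)
  case 0
  then obtain g where g: "\<And>x. (f has_real_derivative g x) (at x)" using assms(1) by blast
  show ?case
    using g by (auto simp: continuous_on_eq_continuous_at intro: DERIV_isCont)
next
  case (Suc k)
  then obtain g where "g \<in> F" and g: "\<And>x. (f has_real_derivative g x) (at x)"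
    using assms(1) by blast
  show ?case
  proof (rule Ck_SucI)
    show "(f has_derivative (\<lambda>h. g x * h)) (at x)" for x
      using g[of x] by (simp add: has_field_derivative_def)
  qed (use Suc.IH[OF \<open>g \<in> F\<close>] in auto)
qed

lemma Ck_cos: "Ck k (\<lambda>x::real. cos (a * x))"
  and Ck_sin: "Ck k (\<lambda>x::real. sin (a * x))"
proof -
  let ?F = "range (\<lambda>(c, d) x::real. c * cos (a * x) + d * sin (a * x))"
  have D: "\<exists>g\<in>?F. \<forall>x. (f has_real_derivative g x) (at x)" if f: "f \<in> ?F" for f
  proof -
    obtain c d where f: "f = (\<lambda>x. c * cos (a * x) + d * sin (a * x))" using f by auto
    have "(f has_real_derivative (a * d) * cos (a * x) + (- a * c) * sin (a * x)) (at x)" for x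
      unfolding f by (auto intro!: derivative_eq_intros)
    then show ?thesis
      by (intro bexI[of _ "\<lambda>x. (a * d) * cos (a * x) + (- a * c) * sin (a * x)"])
        (auto intro!: image_eqI[of _ _ "(a * d, - a * c)"])
  qed
  have "(\<lambda>x. cos (a * x)) \<in> ?F" by (rule image_eqI[of _ _ "(1, 0)"]) auto
  then show "Ck k (\<lambda>x. cos (a * x))" using Ck_real_family[OF D] by blast
  have "(\<lambda>x. sin (a * x)) \<in> ?F" by (rule image_eqI[of _ _ "(0, 1)"]) auto
  then show "Ck k (\<lambda>x. sin (a * x))" using Ck_real_family[OF D] by blast
qed

section \<open>Smooth steps and bumps built from exp(-1/x)\<close>

definition smooth_step :: "real \<Rightarrow> real" where
  "smooth_step x = (if x > 0 then exp (- (1 / x)) else 0)"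

lemma poly_exp_neg_tendsto:
  "((\<lambda>y::real. poly p y * exp (- y)) \<longlongrightarrow> 0) at_top"
proof (induction p)
  case (pCons a p)
  have mono: "((\<lambda>y::real. y ^ n * exp (- y)) \<longlongrightarrow> 0) at_top" for n
    using tendsto_power_div_exp_0[of n] by (simp add: exp_minus divide_inverse)
  \<comment> \<open>The additional factor \<open>y ^ n\<close> carries the induction: passing from
    \<open>q\<close> to \<open>pCons b q\<close> raises \<open>n\<close> by one.\<close>
  have "((\<lambda>y::real. y ^ n * poly q y * exp (- y)) \<longlongrightarrow> 0) at_top" for n q
  proof (induction q arbitrary: n)
    case (pCons b q)
    have "((\<lambda>y. b * (y ^ n * exp (- y)) + y ^ Suc n * poly q y * exp (- y)) \<longlongrightarrow> b * 0 + 0) at_top"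
      by (intro tendsto_intros mono pCons.IH)
    then show ?case by (simp add: algebra_simps)
  qed simp
  from this[of 0 "pCons a p"] show ?case by simp
qed simp

text \<open>Every derivative of exp(-1/x) has the form p(1/x) exp(-1/x) with a polynomial p, and
  exponential decay lets all of these extend by 0 across the origin. Hence the family
  \<open>G\<close> is closed under differentiation.\<close>

lemma Ck_smooth_step: "Ck k smooth_step"
proof -
  define G where "G p x = (if x > 0 then poly p (1 / x) * exp (- (1 / x)) else (0::real))" for p x
  have lim: "(G p \<longlongrightarrow> 0) (at 0)" for p
  proof -
    have "((\<lambda>x. poly p (inverse x) * exp (- inverse x)) \<longlongrightarrow> 0) (at_right 0)"
      by (rule filterlim_compose[OF poly_exp_neg_tendsto filterlim_inverse_at_top_right])
    then have "(G p \<longlongrightarrow> 0) (at_right 0)"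
      by (rule Lim_transform_eventually)
        (auto simp: G_def eventually_at inverse_eq_divide intro!: exI[of _ 1])
    moreover have "(G p \<longlongrightarrow> 0) (at_left 0)"
      by (rule Lim_transform_eventually[OF tendsto_const])
        (auto simp: G_def eventually_at intro!: exI[of _ 1])
    ultimately show ?thesis by (simp add: filterlim_split_at)
  qed
  have "\<exists>g\<in>range G. \<forall>x. (f has_real_derivative g x) (at x)" if f: "f \<in> range G" for f
  proof -
    obtain p where f: "f = G p" using f by auto
    \<comment> \<open>With y = 1/x, the derivative of p(y) exp(-y) in x is (p(y) - p'(y)) y^2
      exp(-y).\<close>
    define q where "q = (p - pderiv p) * [:0, 0, 1:]"
    have "(G p has_real_derivative G q x) (at x)" for x
    proof -
      consider "x > 0" | "x < 0" | "x = 0" by linarith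
      then show ?thesis
      proof cases
        case 1
        have inv: "((\<lambda>x. 1 / x) has_real_derivative - (1 / x ^ 2)) (at x)"
          using 1 by (auto intro!: derivative_eq_intros simp: power2_eq_square)
        have "((\<lambda>x. poly p (1 / x) * exp (- (1 / x))) has_real_derivative
            (poly (pderiv p) (1 / x) * - (1 / x ^ 2)) * exp (- (1 / x)) +
            (exp (- (1 / x)) * - (- (1 / x ^ 2))) * poly p (1 / x)) (at x)"
          by (intro DERIV_mult DERIV_chain2[OF poly_DERIV inv] DERIV_chain2[OF DERIV_exp]
              DERIV_minus inv)
        also have "(poly (pderiv p) (1 / x) * - (1 / x ^ 2)) * exp (- (1 / x)) +
            (exp (- (1 / x)) * - (- (1 / x ^ 2))) * poly p (1 / x) = G q x"
          using 1 by (simp add: G_def q_def power2_eq_square algebra_simps)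
        finally have "((\<lambda>x. poly p (1 / x) * exp (- (1 / x))) has_real_derivative G q x) (at x)" .
        then show ?thesis
          by (rule has_field_derivative_transform_within_open[of _ _ _ "{0<..}"])
            (use 1 in \<open>auto simp: G_def\<close>)
      next
        case 2
        have "((\<lambda>x. 0) has_real_derivative G q x) (at x)"
          using 2 by (auto simp: G_def)
        then show ?thesis
          by (rule has_field_derivative_transform_within_open[of _ _ _ "{..<0}"])
            (use 2 in \<open>auto simp: G_def\<close>)
      next
        case 3
        \<comment> \<open>Dividing \<open>G p h\<close> by h multiplies the polynomial in 1/h by its
          variable, so the difference quotient at 0 is again a member of the family and
          \<open>lim\<close> applies.\<close>
        have "((\<lambda>h. G (p * [:0, 1:]) h) \<longlongrightarrow> 0) (at 0)" by (rule lim)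
        then have "((\<lambda>h. (G p (0 + h) - G p 0) / h) \<longlongrightarrow> 0) (at 0)"
          by (rule Lim_transform_eventually) (auto simp: G_def eventually_at field_simps intro!: exI[of _ 1])
        then show ?thesis using 3 by (simp add: DERIV_def G_def)
      qed
    qed
    then show ?thesis using f by blast
  qed
  moreover have "smooth_step = G 1" by (auto simp: smooth_step_def G_def)
  ultimately show ?thesis using Ck_real_family[of "range G"] by blast
qed

lemma smooth_step_bounds: "0 \<le> smooth_step x" "smooth_step x \<le> 1"
  by (auto simp: smooth_step_def)

text \<open>The factor \<open>Suc j\<close> steepens both flanks: exp(-1/((j+1) r)) tends to 1 for r
  > 0. The bumps are positive exactly on the open interval from a to b and tend pointwise to its
  indicator.\<close>

definition bump :: "nat \<Rightarrow> real \<Rightarrow> real \<Rightarrow> real \<Rightarrow> real" where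
  "bump j a b s = smooth_step (real (Suc j) * (s - a)) * smooth_step (real (Suc j) * (b - s))"

lemma Ck_bump: "Ck k (bump j a b)"
proof -
  have "Ck k (\<lambda>s. smooth_step (real (Suc j) * s + - (real (Suc j) * a)))"
    by (rule Ck_affine[OF Ck_smooth_step]) (auto intro: bounded_linear_intros bounded_linear_mult_right)
  moreover have "Ck k (\<lambda>s. smooth_step ((- real (Suc j)) * s + real (Suc j) * b))"
    by (rule Ck_affine[OF Ck_smooth_step]) (rule bounded_linear_mult_right)
  ultimately have "Ck k (\<lambda>s. smooth_step (real (Suc j) * s + - (real (Suc j) * a)) *
      smooth_step ((- real (Suc j)) * s + real (Suc j) * b))"
    by (rule Ck_mult)
  moreover have "bump j a b = (\<lambda>s. smooth_step (real (Suc j) * s + - (real (Suc j) * a)) *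
      smooth_step ((- real (Suc j)) * s + real (Suc j) * b))"
    by (simp add: bump_def fun_eq_iff algebra_simps)
  ultimately show ?thesis by simp
qed

lemma bump_bounds: "0 \<le> bump j a b s" "bump j a b s \<le> 1"
  using smooth_step_bounds by (auto simp: bump_def mult_le_one)

lemma bump_nonzero_iff: "bump j a b s \<noteq> 0 \<longleftrightarrow> a < s \<and> s < b"
  by (auto simp: bump_def smooth_step_def zero_less_mult_iff)

lemma bump_tendsto: "(\<lambda>j. bump j a b s) \<longlonglongrightarrow> indicator {a<..<b} s"
proof (cases "a < s \<and> s < b")
  case True
  have "(\<lambda>j. smooth_step (real (Suc j) * r)) \<longlonglongrightarrow> 1" if "r > 0" for r
  proof -
    have "(\<lambda>j. exp (- (inverse (real (Suc j)) * inverse r))) \<longlonglongrightarrow> exp (- (0 * inverse r))"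
      by (intro tendsto_intros LIMSEQ_inverse_real_of_nat)
    moreover have "smooth_step (real (Suc j) * r) = exp (- (inverse (real (Suc j)) * inverse r))" for j
      using that by (simp add: smooth_step_def zero_less_mult_iff inverse_eq_divide del: of_nat_Suc)
    ultimately show ?thesis by simp
  qed
  from tendsto_mult[OF this[of "s - a"] this[of "b - s"]] True show ?thesis
    by (simp add: bump_def)
next
  case False
  then show ?thesis using bump_nonzero_iff[of _ a b s] by (auto simp: indicator_def)
qed

section \<open>Products, derivatives and tensor products of test functions\<close>

lemma test_functionD:
  assumes "test_function \<phi>"
  shows "Ck k \<phi>" "compact (closure {x. \<phi> x \<noteq> 0})" "continuous_on S \<phi>"
    "(\<phi> has_derivative frechet_derivative \<phi> (at x)) (at x)"
proof -
  show k: "Ck k \<phi>" for k using assms by (simp add: test_function_def)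
  show "compact (closure {x. \<phi> x \<noteq> 0})" using assms by (simp add: test_function_def)
  show "continuous_on S \<phi>" by (rule Ck_imp_continuous[OF k])
  show "(\<phi> has_derivative frechet_derivative \<phi> (at x)) (at x)"
    by (rule Ck_has_derivative[OF k])
qed

lemma test_functionI:
  assumes "\<And>k. Ck k \<phi>" "\<And>x. \<phi> x \<noteq> 0 \<Longrightarrow> x \<in> K" "compact K"
  shows "test_function \<phi>"
  unfolding test_function_def
proof
  have "closure {x. \<phi> x \<noteq> 0} \<subseteq> K"
    using assms by (intro closure_minimal) (auto intro: compact_imp_closed)
  then have "closure {x. \<phi> x \<noteq> 0} = K \<inter> closure {x. \<phi> x \<noteq> 0}" by blast
  then show "compact (closure {x. \<phi> x \<noteq> 0})"
    using compact_Int_closed[OF assms(3) closed_closure] by metis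
qed (use assms in auto)

lemma test_function_mult:
  assumes "test_function \<phi>" "\<And>k. Ck k f"
  shows "test_function (\<lambda>x. f x * \<phi> x)"
proof (rule test_functionI)
  show "x \<in> closure {x. \<phi> x \<noteq> 0}" if "f x * \<phi> x \<noteq> 0" for x
    using that closure_subset[of "{x. \<phi> x \<noteq> 0}"] by auto
qed (intro Ck_mult assms test_functionD)+

lemma test_function_deriv:
  assumes "test_function \<phi>" "b \<in> Basis"
  shows "test_function (\<lambda>x. frechet_derivative \<phi> (at x) b)"
proof (rule test_functionI)
  show "Ck k (\<lambda>x. frechet_derivative \<phi> (at x) b)" for k
    using test_functionD(1)[OF assms(1), of "Suc k"] assms(2) by simp
  show "compact (closure {x. \<phi> x \<noteq> 0})" by (rule test_functionD[OF assms(1)])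
  show "x \<in> closure {x. \<phi> x \<noteq> 0}" if "frechet_derivative \<phi> (at x) b \<noteq> 0" for x
  proof (rule ccontr)
    assume x: "x \<notin> closure {x. \<phi> x \<noteq> 0}"
    have "(\<phi> has_derivative (\<lambda>_. 0)) (at x)"
    proof (rule has_derivative_transform_within_open)
      show "((\<lambda>_. 0) has_derivative (\<lambda>_. 0)) (at x)" by simp
      show "open (- closure {x. \<phi> x \<noteq> 0})" by auto
      show "0 = \<phi> y" if "y \<in> - closure {x. \<phi> x \<noteq> 0}" for y
        using that closure_subset by force
    qed (use x in auto)
    then have "frechet_derivative \<phi> (at x) = (\<lambda>_. 0)"
      by (rule frechet_derivative_at[symmetric])
    then show False using that by simp
  qed
qed

lemma test_function_bounded:
  assumes "test_function \<phi>"
  obtains B where "B > 0" "\<And>x. \<bar>\<phi> x\<bar> \<le> B"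
proof -
  let ?K = "closure {x. \<phi> x \<noteq> 0}"
  have "bounded (\<phi> ` ?K)"
    using test_functionD(2,3)[OF assms] by (intro compact_imp_bounded compact_continuous_image)
  then obtain B where B: "B > 0" "\<And>y. y \<in> \<phi> ` ?K \<Longrightarrow> norm y \<le> B"
    unfolding bounded_pos by metis
  have "\<bar>\<phi> x\<bar> \<le> B" for x
    using B closure_subset[of "{x. \<phi> x \<noteq> 0}"] by (cases "\<phi> x = 0") auto
  with B(1) show ?thesis using that by blast
qed

text \<open>Products of a function of x and a function of t are the only test functions on
  space-time that the proof uses; they reduce weak derivatives on space-time to weak derivatives in
  x.\<close>

lemma test_function_tensor:
  assumes "test_function \<phi>" "test_function \<psi>"
  shows "test_function (\<lambda>(x, t). \<phi> x * \<psi> t)"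
proof (rule test_functionI)
  have "Ck k (\<lambda>y. \<phi> (fst y + 0) * \<psi> (snd y + 0))" for k
    using test_functionD(1)[OF assms(1)] test_functionD(1)[OF assms(2)]
    by (intro Ck_mult Ck_affine bounded_linear_fst bounded_linear_snd)
  then show "Ck k (\<lambda>(x, t). \<phi> x * \<psi> t)" for k by (simp add: case_prod_beta')
  show "compact (closure {x. \<phi> x \<noteq> 0} \<times> closure {x. \<psi> x \<noteq> 0})"
    using test_functionD(2)[OF assms(1)] test_functionD(2)[OF assms(2)] by (rule compact_Times)
  show "y \<in> closure {x. \<phi> x \<noteq> 0} \<times> closure {x. \<psi> x \<noteq> 0}"
    if "(case y of (x, t) \<Rightarrow> \<phi> x * \<psi> t) \<noteq> 0" for y
    using that closure_subset[of "{x. \<phi> x \<noteq> 0}"] closure_subset[of "{x. \<psi> x \<noteq> 0}"]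
    by (auto simp: case_prod_beta' mem_Times_iff)
qed

lemma test_function_tensor_deriv:
  assumes "test_function \<phi>" "test_function \<psi>"
  shows "frechet_derivative (\<lambda>(x, t). \<phi> x * \<psi> t) (at (x, t)) (b, c) =
    \<phi> x * frechet_derivative \<psi> (at t) c + frechet_derivative \<phi> (at x) b * \<psi> t"
proof -
  have "((\<lambda>y. \<phi> (fst y) * \<psi> (snd y)) has_derivative
      (\<lambda>h. \<phi> (fst (x, t)) * frechet_derivative \<psi> (at t) (snd h) +
        frechet_derivative \<phi> (at x) (fst h) * \<psi> (snd (x, t)))) (at (x, t))"
  proof (rule has_derivative_mult)
    show "((\<lambda>y. \<phi> (fst y)) has_derivative (\<lambda>h. frechet_derivative \<phi> (at x) (fst h))) (at (x, t))"
      by (rule has_derivative_compose[of fst fst _ UNIV \<phi>])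
        (auto intro: derivative_eq_intros test_functionD[OF assms(1)])
    show "((\<lambda>y. \<psi> (snd y)) has_derivative (\<lambda>h. frechet_derivative \<psi> (at t) (snd h))) (at (x, t))"
      by (rule has_derivative_compose[of snd snd _ UNIV \<psi>])
        (auto intro: derivative_eq_intros test_functionD[OF assms(2)])
  qed
  from frechet_derivative_at[OF this, symmetric] show ?thesis by (simp add: case_prod_beta')
qed

lemma test_function_bump: "test_function (bump j a b)"
  by (rule test_functionI[of _ "{a..b}"]) (auto simp: Ck_bump bump_nonzero_iff)

definition box_bump :: "nat \<Rightarrow> 'a \<Rightarrow> 'a \<Rightarrow> 'a::euclidean_space \<Rightarrow> real" where
  "box_bump j a b x = (\<Prod>i\<in>Basis. bump j (a \<bullet> i) (b \<bullet> i) (x \<bullet> i))"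

lemma test_function_box_bump: "test_function (box_bump j a b)"
proof (rule test_functionI)
  have "Ck k (\<lambda>x. \<Prod>i\<in>Basis. bump j (a \<bullet> i) (b \<bullet> i) (x \<bullet> i + 0))" for k
    by (intro Ck_prod Ck_affine Ck_bump bounded_linear_inner_left)
  then show "Ck k (box_bump j a b)" for k by (simp add: box_bump_def[abs_def])
  show "x \<in> cbox a b" if "box_bump j a b x \<noteq> 0" for x
    using that by (force simp: box_bump_def bump_nonzero_iff mem_box)
qed (rule compact_cbox)

lemma box_bump_bounds: "0 \<le> box_bump j a b x" "box_bump j a b x \<le> 1"
  by (auto simp: box_bump_def bump_bounds intro!: prod_nonneg prod_le_1)

lemma box_bump_tendsto: "(\<lambda>j. box_bump j a b x) \<longlonglongrightarrow> indicator (box a b) x"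
proof -
  have "(\<lambda>j. box_bump j a b x) \<longlonglongrightarrow> (\<Prod>i\<in>Basis. indicator {a \<bullet> i<..<b \<bullet> i} (x \<bullet> i))"
    unfolding box_bump_def by (intro tendsto_prod bump_tendsto)
  also have "(\<Prod>i\<in>Basis. indicator {a \<bullet> i<..<b \<bullet> i} (x \<bullet> i)) = (indicator (box a b) x :: real)"
    by (auto simp: indicator_def mem_box)
  finally show ?thesis .
qed

section \<open>Translations in \<open>L\<^sup>2(\<real>)\<close>\<close>

lemma borel_measurable_cnj [measurable (raw)]:
  "f \<in> borel_measurable M \<Longrightarrow> (\<lambda>x. cnj (f x)) \<in> borel_measurable M"
  by (rule borel_measurable_continuous_on[where f = cnj]) (auto intro: continuous_intros)

lemma integrable_translate:
  fixes f :: "real \<Rightarrow> 'a::{banach, second_countable_topology}"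
  shows "integrable lborel f \<Longrightarrow> integrable lborel (\<lambda>t. f (t + h))"
  using lborel_integrable_real_affine[of f 1 h] by (simp add: add.commute)

lemma integral_translate:
  fixes f :: "real \<Rightarrow> 'a::{banach, second_countable_topology}"
  shows "(LINT t|lborel. f (t + h)) = (LINT t|lborel. f t)"
  using lborel_integral_real_affine[of 1 f h] by (simp add: add.commute)

text \<open>A three-epsilon argument: the set of functions whose translates converge is closed in
  L^1, because translation invariance makes the error of the shifted approximation equal to that of
  the unshifted one.\<close>

lemma L1_translation_continuous_limit:
  fixes f :: "real \<Rightarrow> real"
  assumes f: "integrable lborel f"
    and approx: "\<And>e. e > 0 \<Longrightarrow> \<exists>g. integrable lborel g \<and> (LINT t|lborel. \<bar>f t - g t\<bar>) < e \<and>
      (\<lambda>n. LINT t|lborel. \<bar>g (t + h n) - g t\<bar>) \<longlonglongrightarrow> 0"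
  shows "(\<lambda>n. LINT t|lborel. \<bar>f (t + h n) - f t\<bar>) \<longlonglongrightarrow> 0"
proof (rule LIMSEQ_I)
  fix e :: real assume "e > 0"
  then obtain g where g: "integrable lborel g" "(LINT t|lborel. \<bar>f t - g t\<bar>) < e / 3"
      "(\<lambda>n. LINT t|lborel. \<bar>g (t + h n) - g t\<bar>) \<longlonglongrightarrow> 0"
    using approx[of "e / 3"] by auto
  from LIMSEQ_D[OF g(3), of "e / 3"] \<open>e > 0\<close> obtain n0
    where n0: "\<And>n. n \<ge> n0 \<Longrightarrow> (LINT t|lborel. \<bar>g (t + h n) - g t\<bar>) < e / 3" by auto
  have "(LINT t|lborel. \<bar>f (t + h n) - f t\<bar>) < e" if "n \<ge> n0" for n
  proof -
    have "(LINT t|lborel. \<bar>f (t + h n) - f t\<bar>) \<le>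
        (LINT t|lborel. \<bar>f (t + h n) - g (t + h n)\<bar> + \<bar>g (t + h n) - g t\<bar> + \<bar>f t - g t\<bar>)"
      by (intro integral_mono Bochner_Integration.integrable_add integrable_abs
          Bochner_Integration.integrable_diff integrable_translate f g) auto
    also have "\<dots> = (LINT t|lborel. \<bar>f (t + h n) - g (t + h n)\<bar>) +
        (LINT t|lborel. \<bar>g (t + h n) - g t\<bar>) + (LINT t|lborel. \<bar>f t - g t\<bar>)"
    proof -
      have "integrable lborel (\<lambda>t. \<bar>f (t + h n) - g (t + h n)\<bar>)"
        "integrable lborel (\<lambda>t. \<bar>g (t + h n) - g t\<bar>)" "integrable lborel (\<lambda>t. \<bar>f t - g t\<bar>)"
        by (intro integrable_abs Bochner_Integration.integrable_diff integrable_translate f g)+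
      then show ?thesis by simp
    qed
    also have "(LINT t|lborel. \<bar>f (t + h n) - g (t + h n)\<bar>) = (LINT t|lborel. \<bar>f t - g t\<bar>)"
      by (rule integral_translate)
    finally show ?thesis using g(2) n0[OF that] by linarith
  qed
  then show "\<exists>n0. \<forall>n\<ge>n0. norm ((LINT t|lborel. \<bar>f (t + h n) - f t\<bar>) - 0) < e" by auto
qed

lemma L1_translation_continuous_open:
  fixes U :: "real set"
  assumes "open U" "emeasure lborel U < \<infinity>" and h: "h \<longlonglongrightarrow> 0"
  shows "(\<lambda>n. LINT t|lborel. \<bar>indicator U (t + h n) - indicator U t :: real\<bar>) \<longlonglongrightarrow> 0"
proof -
  let ?I = "indicator U :: real \<Rightarrow> real"
  have [measurable]: "U \<in> sets borel" using assms(1) by simp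
  have int: "integrable lborel ?I" using assms(2) by simp
  \<comment> \<open>The two indicators have equal integrals, so it suffices to treat the part where the shifted one
    is smaller; there \<open>U\<close> being open gives pointwise convergence.\<close>
  have "(LINT t|lborel. \<bar>?I (t + h n) - ?I t\<bar>) = 2 * (LINT t|lborel. max 0 (?I t - ?I (t + h n)))" for n
  proof -
    have "(LINT t|lborel. \<bar>?I (t + h n) - ?I t\<bar>) =
        (LINT t|lborel. 2 * max 0 (?I t - ?I (t + h n)) - (?I t - ?I (t + h n)))"
      by (intro Bochner_Integration.integral_cong) (auto simp: indicator_def)
    also have "\<dots> = (LINT t|lborel. 2 * max 0 (?I t - ?I (t + h n))) -
        ((LINT t|lborel. ?I t) - (LINT t|lborel. ?I (t + h n)))"
    proof -
      have I: "integrable lborel (\<lambda>t. ?I (t + h n))" by (rule integrable_translate[OF int])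
      then have "integrable lborel (\<lambda>t. 2 * max 0 (?I t - ?I (t + h n)))"
        by (intro integrable_mult_right integrable_max Bochner_Integration.integrable_diff int integrable_zero)
      then show ?thesis using int I by simp
    qed
    finally show ?thesis by (simp only: integral_translate) simp
  qed
  moreover have "(\<lambda>n. LINT t|lborel. max 0 (?I t - ?I (t + h n))) \<longlonglongrightarrow> (LINT t::real|lborel. 0)"
  proof (rule integral_dominated_convergence[where w = ?I])
    show "AE t in lborel. (\<lambda>n. max 0 (?I t - ?I (t + h n))) \<longlonglongrightarrow> 0"
    proof (rule AE_I2)
      fix t :: real
      show "(\<lambda>n. max 0 (?I t - ?I (t + h n))) \<longlonglongrightarrow> 0"
      proof (cases "t \<in> U")
        case True
        have "(\<lambda>n. t + h n) \<longlonglongrightarrow> t" using tendsto_add[OF tendsto_const h, of t] by simp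
        then have "\<forall>\<^sub>F n in sequentially. t + h n \<in> U"
          using assms(1) True topological_tendstoD by blast
        then show ?thesis using True by (intro tendsto_eventually) (auto elim: eventually_mono)
      qed (auto simp: indicator_def)
    qed
  qed (use int in \<open>auto simp: indicator_def\<close>)
  ultimately show ?thesis by (auto intro: tendsto_mult_right_zero)
qed

lemma L1_translation_continuous:
  fixes f :: "real \<Rightarrow> real"
  assumes "integrable lborel f" and h: "h \<longlonglongrightarrow> 0"
  shows "(\<lambda>n. LINT t|lborel. \<bar>f (t + h n) - f t\<bar>) \<longlonglongrightarrow> 0"
  using assms(1)
proof (induction rule: integrable_induct)
  case (base A c)
  note [measurable] = base(1)
  have "(\<lambda>n. LINT t|lborel. \<bar>indicator A (t + h n) - indicator A t :: real\<bar>) \<longlonglongrightarrow> 0"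
  proof (rule L1_translation_continuous_limit)
    fix e :: real assume "e > 0"
    \<comment> \<open>Outer regularity reduces a measurable set of finite measure to an open one, up
      to an error smaller than e in L^1.\<close>
    obtain U where U: "open U" "A \<subseteq> U" "emeasure lborel (U - A) < ennreal e"
      using outer_regular_lborel[of A e] base \<open>e > 0\<close> by auto
    have [measurable]: "U \<in> sets borel" using U(1) by simp
    have "emeasure lborel U = emeasure lborel A + emeasure lborel (U - A)"
      using U(2) base(1) by (subst plus_emeasure) (auto simp: Un_absorb1)
    also have "\<dots> < \<infinity>" using base(2) U(3) by (auto simp: less_top[symmetric])
    finally have fin: "emeasure lborel U < \<infinity>" .
    have "(LINT t|lborel. \<bar>indicator A t - indicator U t :: real\<bar>) = (LINT t|lborel. indicator (U - A) t)"
      using U(2) by (intro Bochner_Integration.integral_cong) (auto simp: indicator_def)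
    also have "\<dots> < e" using U(3) \<open>e > 0\<close> by (cases "emeasure lborel (U - A)") (auto simp: measure_def ennreal_less_iff)
    finally show "\<exists>g. integrable lborel g \<and> (LINT t|lborel. \<bar>indicator A t - g t\<bar>) < e \<and>
        (\<lambda>n. LINT t|lborel. \<bar>g (t + h n) - g t\<bar>) \<longlonglongrightarrow> 0"
      using L1_translation_continuous_open[OF U(1) fin h] fin U(1)
      by (intro exI[of _ "indicator U"]) auto
  qed (use base in auto)
  from tendsto_mult_right_zero[OF this, of "\<bar>c\<bar>"]
  have "(\<lambda>n. LINT t|lborel. \<bar>c\<bar> * \<bar>indicator A (t + h n) - indicator A t\<bar>) \<longlonglongrightarrow> 0"
    by (simp only: integral_mult_right_zero)
  moreover have "\<bar>indicator A (t + s) *\<^sub>R c - indicator A t *\<^sub>R c\<bar> =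
      \<bar>c\<bar> * \<bar>indicator A (t + s) - indicator A t\<bar>" for t s
    by (simp add: indicator_def)
  ultimately show ?case by (simp only:)
next
  case (add f g)
  show ?case
  proof (rule tendsto_sandwich[OF _ _ tendsto_const])
    show "(\<lambda>n. (LINT t|lborel. \<bar>f (t + h n) - f t\<bar>) + (LINT t|lborel. \<bar>g (t + h n) - g t\<bar>)) \<longlonglongrightarrow> 0"
      using tendsto_add[OF add.IH] by simp
    show "\<forall>\<^sub>F n in sequentially. (LINT t|lborel. \<bar>f (t + h n) + g (t + h n) - (f t + g t)\<bar>) \<le>
        (LINT t|lborel. \<bar>f (t + h n) - f t\<bar>) + (LINT t|lborel. \<bar>g (t + h n) - g t\<bar>)"
    proof (intro always_eventually allI)
      fix n
      have I: "integrable lborel (\<lambda>t. \<bar>f (t + h n) - f t\<bar>)" "integrable lborel (\<lambda>t. \<bar>g (t + h n) - g t\<bar>)"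
        by (intro integrable_abs Bochner_Integration.integrable_diff integrable_translate add.hyps)+
      show "(LINT t|lborel. \<bar>f (t + h n) + g (t + h n) - (f t + g t)\<bar>) \<le>
          (LINT t|lborel. \<bar>f (t + h n) - f t\<bar>) + (LINT t|lborel. \<bar>g (t + h n) - g t\<bar>)"
        unfolding Bochner_Integration.integral_add[OF I, symmetric]
        by (intro integral_mono Bochner_Integration.integrable_add I integrable_abs
            Bochner_Integration.integrable_diff integrable_translate add.hyps) auto
    qed
  qed auto
next
  case (lim f s)
  show ?case
  proof (rule L1_translation_continuous_limit[OF lim.hyps(4)])
    fix e :: real assume "e > 0"
    have "(\<lambda>i. LINT t|lborel. \<bar>f t - s i t\<bar>) \<longlonglongrightarrow> (LINT t::real|lborel. 0)"
    \<comment> \<open>The approximants satisfy |s i| \<le> 2 |f|, hence the majorant 3 |f| for the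
      difference.\<close>
    proof (rule integral_dominated_convergence[where w = "\<lambda>t. 3 * \<bar>f t\<bar>"])
      show "AE t in lborel. (\<lambda>i. \<bar>f t - s i t\<bar>) \<longlonglongrightarrow> 0"
      proof (rule AE_I2)
        fix t :: real
        show "(\<lambda>i. \<bar>f t - s i t\<bar>) \<longlonglongrightarrow> 0"
          using tendsto_rabs[OF tendsto_diff[OF tendsto_const[of "f t"] lim.hyps(2)[of t]]] by simp
      qed
      show "AE t in lborel. norm \<bar>f t - s i t\<bar> \<le> 3 * \<bar>f t\<bar>" for i
      proof (rule AE_I2)
        fix t :: real
        show "norm \<bar>f t - s i t\<bar> \<le> 3 * \<bar>f t\<bar>" using lim.hyps(3)[of t i] by auto
      qed
    qed (use lim.hyps(1,4) in auto)
    from LIMSEQ_D[OF this \<open>e > 0\<close>] obtain i where "(LINT t|lborel. \<bar>f t - s i t\<bar>) < e" by auto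
    then show "\<exists>g. integrable lborel g \<and> (LINT t|lborel. \<bar>f t - g t\<bar>) < e \<and>
        (\<lambda>n. LINT t|lborel. \<bar>g (t + h n) - g t\<bar>) \<longlonglongrightarrow> 0"
      using lim.hyps(1) lim.IH by blast
  qed
qed

section \<open>Continuity of translations in L^2 and the autocorrelation\<close>

definition L2_fun :: "(real \<Rightarrow> complex) \<Rightarrow> bool" where
  "L2_fun g \<longleftrightarrow> g \<in> borel_measurable borel \<and> integrable lborel (\<lambda>t. (cmod (g t))\<^sup>2)"

text \<open>For integrable g, |\<open>fourier g\<close>|^2 is the Fourier transform of this function
  up to the sign of the frequency. Its value at 0 is the squared L^2 norm, so Plancherel amounts to
  recovering that value.\<close>

definition autocorr :: "(real \<Rightarrow> complex) \<Rightarrow> real \<Rightarrow> complex" where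
  "autocorr g h = (LINT t|lborel. g t * cnj (g (t + h)))"

lemma norm_mult_le_squares:
  fixes a b :: real
  shows "a * b \<le> (a\<^sup>2 + b\<^sup>2) / 2" "a * b * 2 \<le> a\<^sup>2 + b\<^sup>2"
  using sum_squares_bound[of a b] by simp_all

lemma L2_fun_integrable_corr:
  assumes "L2_fun g"
  shows "integrable lborel (\<lambda>t. g t * cnj (g (t + h)))"
proof (rule Bochner_Integration.integrable_bound)
  show "integrable lborel (\<lambda>t. ((cmod (g t))\<^sup>2 + (cmod (g (t + h)))\<^sup>2) / 2)"
    using assms integrable_translate[of "\<lambda>t. (cmod (g t))\<^sup>2"] by (auto simp: L2_fun_def)
  have [measurable]: "g \<in> borel_measurable borel" using assms by (simp add: L2_fun_def)
  show "(\<lambda>t. g t * cnj (g (t + h))) \<in> borel_measurable lborel" by measurable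
qed (auto simp: norm_mult norm_mult_le_squares)

lemma autocorr_bound:
  assumes "L2_fun g"
  shows "cmod (autocorr g h) \<le> (LINT t|lborel. (cmod (g t))\<^sup>2)"
proof -
  have I: "integrable lborel (\<lambda>t. (cmod (g t))\<^sup>2)" using assms by (simp add: L2_fun_def)
  have "cmod (autocorr g h) \<le> (LINT t|lborel. cmod (g t * cnj (g (t + h))))"
    unfolding autocorr_def by (rule integral_norm_bound)
  also have "\<dots> \<le> (LINT t|lborel. ((cmod (g t))\<^sup>2 + (cmod (g (t + h)))\<^sup>2) / 2)"
    using L2_fun_integrable_corr[OF assms] I integrable_translate[OF I]
    by (intro integral_mono integrable_norm) (auto simp: norm_mult norm_mult_le_squares)
  also have "\<dots> = (LINT t|lborel. (cmod (g t))\<^sup>2)"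
    using I integrable_translate[OF I] integral_translate[of "\<lambda>t. (cmod (g t))\<^sup>2"] by simp
  finally show ?thesis .
qed

lemma Re_mult_cnj_polarization:
  "Re (a * cnj b) = ((cmod a)\<^sup>2 + (cmod b)\<^sup>2 - (cmod (b - a))\<^sup>2) / 2"
  unfolding cmod_power2 by (simp add: power2_eq_square algebra_simps)

lemma square_diff_le: "(x - y)\<^sup>2 \<le> 2 * x\<^sup>2 + 2 * (y::real)\<^sup>2"
  using zero_le_power2[of "x + y"] by (simp add: power2_eq_square algebra_simps)

text \<open>Reduces continuity of translations in \<open>L\<^sup>2\<close> to \<open>L\<^sup>1\<close>: squares of positive and negative parts
  are integrable, and \<open>(x - y)\<^sup>2 \<le> |x\<^sup>2 - y\<^sup>2|\<close> for nonnegative \<open>x\<close>, \<open>y\<close>.\<close>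

lemma cmod_diff_square_bound:
  fixes a b :: complex
  shows "(cmod (a - b))\<^sup>2 \<le>
    2 * \<bar>(max 0 (Re a))\<^sup>2 - (max 0 (Re b))\<^sup>2\<bar> + 2 * \<bar>(max 0 (- Re a))\<^sup>2 - (max 0 (- Re b))\<^sup>2\<bar> +
    2 * \<bar>(max 0 (Im a))\<^sup>2 - (max 0 (Im b))\<^sup>2\<bar> + 2 * \<bar>(max 0 (- Im a))\<^sup>2 - (max 0 (- Im b))\<^sup>2\<bar>"
proof -
  have sq: "(x - y)\<^sup>2 \<le> \<bar>x\<^sup>2 - y\<^sup>2\<bar>" if "x \<ge> 0" "y \<ge> 0" for x y :: real
  proof -
    have "(x - y)\<^sup>2 = \<bar>x - y\<bar> * \<bar>x - y\<bar>" by (simp add: power2_eq_square)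
    also have "\<dots> \<le> \<bar>x - y\<bar> * \<bar>x + y\<bar>" using that by (intro mult_left_mono) auto
    also have "\<dots> = \<bar>x\<^sup>2 - y\<^sup>2\<bar>" by (simp add: abs_mult[symmetric] power2_eq_square algebra_simps)
    finally show ?thesis .
  qed
  have "(x - y)\<^sup>2 \<le> 2 * \<bar>(max 0 x)\<^sup>2 - (max 0 y)\<^sup>2\<bar> + 2 * \<bar>(max 0 (- x))\<^sup>2 - (max 0 (- y))\<^sup>2\<bar>"
    for x y :: real
  proof -
    let ?p = "max 0 x - max 0 y" and ?q = "max 0 (- x) - max 0 (- y)"
    have "x - y = ?p - ?q" by auto
    then have "(x - y)\<^sup>2 = (?p - ?q)\<^sup>2" by simp
    also have "\<dots> \<le> 2 * ?p\<^sup>2 + 2 * ?q\<^sup>2" by (rule square_diff_le)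
    also have "\<dots> \<le> 2 * \<bar>(max 0 x)\<^sup>2 - (max 0 y)\<^sup>2\<bar> + 2 * \<bar>(max 0 (- x))\<^sup>2 - (max 0 (- y))\<^sup>2\<bar>"
      by (intro add_mono mult_left_mono sq) auto
    finally show ?thesis .
  qed
  from this[of "Re a" "Re b"] this[of "Im a" "Im b"] show ?thesis
    unfolding cmod_power2 minus_complex.sel by linarith
qed

lemma L2_translation_continuous:
  assumes g: "L2_fun g" and h: "h \<longlonglongrightarrow> 0"
  shows "(\<lambda>n. LINT t|lborel. (cmod (g (t + h n) - g t))\<^sup>2) \<longlonglongrightarrow> 0"
proof -
  have [measurable]: "g \<in> borel_measurable borel" using g by (simp add: L2_fun_def)
  have I: "integrable lborel (\<lambda>t. (cmod (g t))\<^sup>2)" using g by (simp add: L2_fun_def)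
  \<comment> \<open>The squares of the positive and negative parts of Re g and Im g. Each is bounded
    by |g|^2 and therefore integrable, so the L^1 result applies to all four.\<close>
  define p where "p = (\<lambda>k t. (max 0 ([Re (g t), - Re (g t), Im (g t), - Im (g t)] ! k))\<^sup>2)"
  have p: "integrable lborel (p k)" if "k < 4" for k
  proof (rule Bochner_Integration.integrable_bound[OF I])
    have "k = 0 \<or> k = 1 \<or> k = 2 \<or> k = 3" using that by linarith
    then consider "k = 0" | "k = 1" | "k = 2" | "k = 3" by blast
    then show "p k \<in> borel_measurable lborel"
      by cases (simp_all add: p_def)
    have "norm (p k t) \<le> norm ((cmod (g t))\<^sup>2)" for t
      using \<open>k = 0 \<or> k = 1 \<or> k = 2 \<or> k = 3\<close> by (auto simp: p_def cmod_power2 max_def)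
    then show "AE t in lborel. norm (p k t) \<le> norm ((cmod (g t))\<^sup>2)" by simp
  qed
  have P: "integrable lborel (\<lambda>t. \<bar>p k (t + s) - p k t\<bar>)" if "k < 4" for k s
    using p[OF that] by (intro integrable_abs Bochner_Integration.integrable_diff integrable_translate)
  have bd: "(cmod (g (t + s) - g t))\<^sup>2 \<le> (\<Sum>k<4. 2 * \<bar>p k (t + s) - p k t\<bar>)" for t s
    using cmod_diff_square_bound[of "g (t + s)" "g t"]
    by (simp add: p_def eval_nat_numeral)
  have "(\<lambda>n. \<Sum>k<4. 2 * (LINT t|lborel. \<bar>p k (t + h n) - p k t\<bar>)) \<longlonglongrightarrow> (\<Sum>k<4::nat. 2 * 0)"
    by (intro tendsto_sum tendsto_mult tendsto_const L1_translation_continuous h p) auto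
  then have "(\<lambda>n. \<Sum>k<4. 2 * (LINT t|lborel. \<bar>p k (t + h n) - p k t\<bar>)) \<longlonglongrightarrow> 0" by simp
  then show ?thesis
  proof (rule tendsto_sandwich[OF _ _ tendsto_const, rotated 2])
    show "\<forall>\<^sub>F n in sequentially. (LINT t|lborel. (cmod (g (t + h n) - g t))\<^sup>2) \<le>
        (\<Sum>k<4. 2 * (LINT t|lborel. \<bar>p k (t + h n) - p k t\<bar>))"
    proof (intro always_eventually allI)
      fix n
      have S: "integrable lborel (\<lambda>t. \<Sum>k<4. 2 * \<bar>p k (t + h n) - p k t\<bar>)"
        by (intro Bochner_Integration.integrable_sum integrable_mult_right P) auto
      have "(LINT t|lborel. (cmod (g (t + h n) - g t))\<^sup>2) \<le>
          (LINT t|lborel. (\<Sum>k<4. 2 * \<bar>p k (t + h n) - p k t\<bar>))"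
        by (intro integral_mono S Bochner_Integration.integrable_bound[OF S] bd)
          (auto intro!: bd order_trans[OF bd])
      also have "\<dots> = (\<Sum>k<4. 2 * (LINT t|lborel. \<bar>p k (t + h n) - p k t\<bar>))"
        using P by (subst Bochner_Integration.integral_sum) auto
      finally show "(LINT t|lborel. (cmod (g (t + h n) - g t))\<^sup>2) \<le>
          (\<Sum>k<4. 2 * (LINT t|lborel. \<bar>p k (t + h n) - p k t\<bar>))" .
    qed
  qed auto
qed

text \<open>By polarization and translation invariance, Re \<open>autocorr g s\<close> is the
  squared norm of g minus half the squared norm of g(. + s) - g; continuity at 0 is thus continuity
  of translations.\<close>

lemma autocorr_tendsto:
  assumes g: "L2_fun g" and h: "h \<longlonglongrightarrow> 0"
  shows "(\<lambda>n. Re (autocorr g (h n))) \<longlonglongrightarrow> (LINT t|lborel. (cmod (g t))\<^sup>2)"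
proof -
  have [measurable]: "g \<in> borel_measurable borel" using g by (simp add: L2_fun_def)
  have I: "integrable lborel (\<lambda>t. (cmod (g t))\<^sup>2)" using g by (simp add: L2_fun_def)
  have "Re (autocorr g s) =
      (LINT t|lborel. (cmod (g t))\<^sup>2) - (LINT t|lborel. (cmod (g (t + s) - g t))\<^sup>2) / 2" for s
  proof -
    have J: "integrable lborel (\<lambda>t. (cmod (g (t + s) - g t))\<^sup>2)"
    proof (rule Bochner_Integration.integrable_bound)
      show "integrable lborel (\<lambda>t. 2 * (cmod (g (t + s)))\<^sup>2 + 2 * (cmod (g t))\<^sup>2)"
        using I integrable_translate[OF I] by auto
      have "(cmod (a - b))\<^sup>2 \<le> 2 * (cmod a)\<^sup>2 + 2 * (cmod b)\<^sup>2" for a b :: complex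
      proof -
        have "(cmod (a - b))\<^sup>2 \<le> (cmod a + cmod b)\<^sup>2"
          by (intro power_mono norm_triangle_ineq4) auto
        also have "\<dots> \<le> 2 * (cmod a)\<^sup>2 + 2 * (cmod b)\<^sup>2"
          using square_diff_le[of "cmod a" "- cmod b"] by simp
        finally show ?thesis .
      qed
      then show "AE t in lborel. norm ((cmod (g (t + s) - g t))\<^sup>2) \<le>
          norm (2 * (cmod (g (t + s)))\<^sup>2 + 2 * (cmod (g t))\<^sup>2)" by auto
    qed measurable
    have "Re (autocorr g s) = (LINT t|lborel. Re (g t * cnj (g (t + s))))"
      unfolding autocorr_def by (rule integral_Re[symmetric, OF L2_fun_integrable_corr[OF g]])
    also have "\<dots> = ((LINT t|lborel. (cmod (g t))\<^sup>2) + (LINT t|lborel. (cmod (g (t + s)))\<^sup>2) -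
        (LINT t|lborel. (cmod (g (t + s) - g t))\<^sup>2)) / 2"
      unfolding Re_mult_cnj_polarization using I integrable_translate[OF I] J by simp
    also have "(LINT t|lborel. (cmod (g (t + s)))\<^sup>2) = (LINT t|lborel. (cmod (g t))\<^sup>2)"
      by (rule integral_translate)
    finally show ?thesis by (simp add: field_simps)
  qed
  then show ?thesis
    using tendsto_diff[OF tendsto_const tendsto_divide[OF L2_translation_continuous[OF g h] tendsto_const, of 2]]
    by simp
qed

section \<open>Gaussian-regularised Plancherel theorem\<close>

lemma borel_measurable_cis [measurable (raw)]:
  "f \<in> borel_measurable M \<Longrightarrow> (\<lambda>x. cis (f x)) \<in> borel_measurable M"
  by (rule borel_measurable_continuous_on[where f = cis]) (auto intro: continuous_intros)

definition fourier :: "(real \<Rightarrow> complex) \<Rightarrow> real \<Rightarrow> complex" where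
  "fourier g \<tau> = (LINT t|lborel. cis (- (\<tau> * t)) * g t)"

abbreviation gauss :: "real measure" where
  "gauss \<equiv> std_normal_distribution"

lemma prob_space_gauss: "prob_space gauss"
  by (rule prob_space_normal_density) simp

lemma sigma_finite_gauss: "sigma_finite_measure gauss"
  by (intro finite_measure.sigma_finite_measure prob_space.finite_measure prob_space_gauss)

lemma prob_gauss: "measure gauss UNIV = 1"
  using prob_space.prob_space[OF prob_space_gauss] by simp

lemma gauss_char: "(LINT \<theta>|gauss. cis (s * \<theta>)) = exp (- (s\<^sup>2 / 2))"
  using fun_cong[OF char_std_normal_distribution, of s]
  by (simp add: char_def cis_conv_exp)

text \<open>|\<open>fourier g\<close>|^2 is expanded into a double integral over (t, s) and the
  Gaussian integral is moved inside, where it is the characteristic function of the normal law at N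
  (s - t). Integrability of g justifies the exchange.\<close>

lemma gauss_fourier_eq_double_integral:
  assumes g: "L2_fun g" and g1: "integrable lborel g"
  shows "(LINT \<theta>|gauss. complex_of_real ((cmod (fourier g (N * \<theta>)))\<^sup>2)) =
    (LINT t|lborel. LINT s|lborel. g t * cnj (g s) * exp (- ((N * (s - t))\<^sup>2 / 2)))"
proof -
  have [measurable]: "g \<in> borel_measurable borel" using g by (simp add: L2_fun_def)
  interpret G: prob_space gauss by (rule prob_space_gauss)
  let ?P = "lborel \<Otimes>\<^sub>M lborel :: (real \<times> real) measure"
  interpret P: pair_sigma_finite gauss ?P
    by (intro pair_sigma_finite.intro sigma_finite_gauss) (simp add: lborel_prod sigma_finite_lborel)
  define F where "F = (\<lambda>\<theta> (t, s). g t * cnj (g s) * cis (N * (s - t) * \<theta>))"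
  have F_meas[measurable]: "case_prod F \<in> borel_measurable (gauss \<Otimes>\<^sub>M ?P)"
    unfolding F_def by measurable
  have corr: "integrable ?P (\<lambda>(t, s). g t * cnj (g s))"
    using g1 by (intro lborel_pair.Fubini_integrable) (auto simp: norm_mult)
  have F_int: "integrable ?P (F \<theta>)" for \<theta>
    using corr unfolding F_def
    by (rule Bochner_Integration.integrable_bound) (auto simp: norm_mult split_beta)
  have sq: "complex_of_real ((cmod (fourier g (N * \<theta>)))\<^sup>2) = (LINT y|?P. F \<theta> y)" for \<theta>
  proof -
    let ?e = "\<lambda>t. cis (- (N * \<theta> * t)) * g t"
    have "complex_of_real ((cmod (fourier g (N * \<theta>)))\<^sup>2) = (LINT t|lborel. ?e t) * cnj (LINT s|lborel. ?e s)"
      by (simp only: complex_norm_square fourier_def)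
    also have "\<dots> = (LINT t|lborel. ?e t * (LINT s|lborel. cnj (?e s)))"
      by (simp only: integral_mult_left_zero Bochner_Integration.integral_cnj)
    also have "\<dots> = (LINT t|lborel. LINT s|lborel. ?e t * cnj (?e s))"
      by simp
    also have "\<dots> = (LINT t|lborel. LINT s|lborel. F \<theta> (t, s))"
      by (intro Bochner_Integration.integral_cong)
        (simp_all add: F_def cis_cnj cis_mult algebra_simps)
    also have "\<dots> = (LINT y|?P. F \<theta> y)"
      by (rule lborel_pair.integral_fst'[OF F_int])
    finally show ?thesis .
  qed
  have "(LINT \<theta>|gauss. complex_of_real ((cmod (fourier g (N * \<theta>)))\<^sup>2)) = (LINT \<theta>|gauss. LINT y|?P. F \<theta> y)"
    unfolding sq ..
  also have "\<dots> = (LINT y|?P. LINT \<theta>|gauss. F \<theta> y)"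
  proof (rule P.Fubini_integral[symmetric])
    have "norm (F \<theta> y) = cmod (g (fst y)) * cmod (g (snd y))" for \<theta> y
      by (simp add: F_def split_beta norm_mult)
    then show "integrable (gauss \<Otimes>\<^sub>M ?P) (case_prod F)"
      using F_int by (intro P.Fubini_integrable) auto
  qed
  also have "\<dots> = (LINT y|?P. (case y of (t, s) \<Rightarrow> g t * cnj (g s) * exp (- ((N * (s - t))\<^sup>2 / 2))))"
    by (intro Bochner_Integration.integral_cong) (auto simp: F_def gauss_char)
  also have "\<dots> = (LINT t|lborel. LINT s|lborel. g t * cnj (g s) * exp (- ((N * (s - t))\<^sup>2 / 2)))"
  proof (rule lborel_pair.integral_fst[symmetric])
    show "integrable ?P (\<lambda>(t, s). g t * cnj (g s) * exp (- ((N * (s - t))\<^sup>2 / 2)))"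
      using corr by (rule Bochner_Integration.integrable_bound)
        (auto simp: norm_mult split_beta intro!: mult_right_le_one_le)
  qed
  finally show ?thesis .
qed

text \<open>The substitution s = t + r / N turns the kernel exp(-(N (s - t))^2 / 2) ds into sqrt(2
  pi) / N times the normal density in r. A second application of Fubini, dominated by the squared
  norm of g, leaves the autocorrelation at r / N.\<close>

lemma gauss_fourier_eq_autocorr:
  assumes g: "L2_fun g" and g1: "integrable lborel g" and N: "N > 0"
  shows "(LINT \<theta>|gauss. complex_of_real ((cmod (fourier g (N * \<theta>)))\<^sup>2)) =
    sqrt (2 * pi) / N * (LINT r|gauss. autocorr g (r / N))"
proof -
  have [measurable]: "g \<in> borel_measurable borel" using g by (simp add: L2_fun_def)
  have I: "integrable lborel (\<lambda>t. (cmod (g t))\<^sup>2)" using g by (simp add: L2_fun_def)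
  interpret G: prob_space gauss by (rule prob_space_gauss)
  interpret P: pair_sigma_finite gauss lborel
    by (intro pair_sigma_finite.intro sigma_finite_gauss sigma_finite_lborel)
  have inner: "(LINT s|lborel. g t * cnj (g s) * exp (- ((N * (s - t))\<^sup>2 / 2))) =
      sqrt (2 * pi) / N * (LINT r|gauss. g t * cnj (g (t + r / N)))" for t
  proof -
    have "(LINT s|lborel. g t * cnj (g s) * exp (- ((N * (s - t))\<^sup>2 / 2))) =
        \<bar>1 / N\<bar> *\<^sub>R (LINT r|lborel. g t * cnj (g (t + 1 / N * r)) *
          exp (- ((N * (t + 1 / N * r - t))\<^sup>2 / 2)))"
      using N by (subst lborel_integral_real_affine[where c = "1 / N" and t = t]) auto
    also have "\<dots> = (1 / N) *\<^sub>R (LINT r|lborel. sqrt (2 * pi) *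
        (std_normal_density r *\<^sub>R (g t * cnj (g (t + r / N)))))"
      using N by (intro arg_cong2[of _ _ _ _ scaleR] Bochner_Integration.integral_cong)
        (auto simp: normal_density_def scaleR_conv_of_real field_simps simp flip: of_real_mult)
    also have "\<dots> = (1 / N) *\<^sub>R (sqrt (2 * pi) * (LINT r|gauss. g t * cnj (g (t + r / N))))"
      by (subst integral_density) (auto simp del: mult_scaleR_right simp flip: mult_scaleR_right)
    finally show ?thesis by (simp add: scaleR_conv_of_real)
  qed
  have "(LINT t|lborel. LINT r|gauss. g t * cnj (g (t + r / N))) =
      (LINT r|gauss. LINT t|lborel. g t * cnj (g (t + r / N)))"
  proof (rule P.Fubini_integral[OF P.Fubini_integrable])
    show "AE r in gauss. integrable lborel (\<lambda>t. case (r, t) of (r, t) \<Rightarrow> g t * cnj (g (t + r / N)))"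
      using L2_fun_integrable_corr[OF g] by simp
    show "integrable gauss (\<lambda>r. LINT t|lborel. norm (case (r, t) of (r, t) \<Rightarrow> g t * cnj (g (t + r / N))))"
    proof (rule G.integrable_const_bound[where B = "LINT t|lborel. (cmod (g t))\<^sup>2"])
      show "AE r in gauss. norm (LINT t|lborel. norm (case (r, t) of (r, t) \<Rightarrow> g t * cnj (g (t + r / N)))) \<le>
          (LINT t|lborel. (cmod (g t))\<^sup>2)"
      proof (rule AE_I2)
        fix r
        have J: "integrable lborel (\<lambda>t. cmod (g t) * cmod (g (t + r / N)))"
          using integrable_norm[OF L2_fun_integrable_corr[OF g]] by (simp add: norm_mult)
        have "(LINT t|lborel. cmod (g t) * cmod (g (t + r / N))) \<le>
            (LINT t|lborel. ((cmod (g t))\<^sup>2 + (cmod (g (t + r / N)))\<^sup>2) / 2)"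
          using I integrable_translate[OF I] J by (intro integral_mono) (auto simp: norm_mult_le_squares)
        also have "\<dots> = (LINT t|lborel. (cmod (g t))\<^sup>2)"
          using I integrable_translate[OF I] integral_translate[of "\<lambda>t. (cmod (g t))\<^sup>2"] by simp
        finally show "norm (LINT t|lborel. norm (case (r, t) of (r, t) \<Rightarrow> g t * cnj (g (t + r / N)))) \<le>
          (LINT t|lborel. (cmod (g t))\<^sup>2)"
          by (simp add: norm_mult)
      qed
    qed measurable
  qed measurable
  then show ?thesis
    unfolding gauss_fourier_eq_double_integral[OF g g1] inner autocorr_def by simp
qed

lemma autocorr_measurable:
  assumes [measurable]: "g \<in> borel_measurable borel"
  shows "autocorr g \<in> borel_measurable borel"
  unfolding autocorr_def by measurable

text \<open>With N = n + 1 and \<tau> = N \<theta> this is (1 / (2 pi)) times the integral of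
  |\<open>fourier g\<close> \<tau>|^2 exp(-\<tau>^2 / (2 N^2)) over \<tau>: the energy in frequency,
  regularised by a Gaussian that flattens to 1 as n grows.\<close>

definition fourier_energy :: "nat \<Rightarrow> (real \<Rightarrow> complex) \<Rightarrow> ennreal" where
  "fourier_energy n g = ennreal (real (Suc n) / sqrt (2 * pi)) *
     (\<integral>\<^sup>+\<theta>. ennreal ((cmod (fourier g (real (Suc n) * \<theta>)))\<^sup>2) \<partial>gauss)"

lemma fourier_energy_eq:
  assumes g: "L2_fun g" and g1: "integrable lborel g"
  shows "fourier_energy n g = ennreal (LINT r|gauss. Re (autocorr g (r / real (Suc n))))"
proof -
  have [measurable]: "g \<in> borel_measurable borel" using g by (simp add: L2_fun_def)
  interpret G: prob_space gauss by (rule prob_space_gauss)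
  let ?N = "real (Suc n)"
  have [measurable]: "fourier g \<in> borel_measurable borel"
    unfolding fourier_def by measurable
  note [measurable] = autocorr_measurable
  have A: "integrable gauss (\<lambda>r. autocorr g (r / ?N))"
    using autocorr_bound[OF g] by (intro G.integrable_const_bound[OF AE_I2]) auto
  have fb: "cmod (fourier g \<tau>) \<le> (LINT t|lborel. cmod (g t))" for \<tau>
    unfolding fourier_def by (rule order_trans[OF integral_norm_bound]) (simp add: norm_mult)
  have B: "integrable gauss (\<lambda>\<theta>. (cmod (fourier g (?N * \<theta>)))\<^sup>2)"
    using power_mono[OF fb norm_ge_zero, of _ 2]
    by (intro G.integrable_const_bound[OF AE_I2, of _ "(LINT t|lborel. cmod (g t))\<^sup>2"]) auto
  have "complex_of_real (LINT \<theta>|gauss. (cmod (fourier g (?N * \<theta>)))\<^sup>2) =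
      sqrt (2 * pi) / ?N * (LINT r|gauss. autocorr g (r / ?N))"
    using gauss_fourier_eq_autocorr[OF g g1, of ?N] by (simp del: of_real_power)
  then have "(LINT \<theta>|gauss. (cmod (fourier g (?N * \<theta>)))\<^sup>2) =
      Re (complex_of_real (sqrt (2 * pi) / ?N) * (LINT r|gauss. autocorr g (r / ?N)))"
    by (metis Re_complex_of_real of_real_divide)
  also have "\<dots> = sqrt (2 * pi) / ?N * (LINT r|gauss. Re (autocorr g (r / ?N)))"
    using A by (simp del: of_real_divide)
  finally have E: "(LINT \<theta>|gauss. (cmod (fourier g (?N * \<theta>)))\<^sup>2) =
    sqrt (2 * pi) / ?N * (LINT r|gauss. Re (autocorr g (r / ?N)))" .
  show ?thesis
    unfolding fourier_energy_def nn_integral_eq_integral[OF B AE_I2[OF zero_le_power2]]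
  proof (subst ennreal_mult[symmetric])
    show "0 \<le> (LINT \<theta>|gauss. (cmod (fourier g (?N * \<theta>)))\<^sup>2)" by simp
    show "ennreal (?N / sqrt (2 * pi) * (LINT \<theta>|gauss. (cmod (fourier g (?N * \<theta>)))\<^sup>2)) =
        ennreal (LINT r|gauss. Re (autocorr g (r / ?N)))"
      unfolding E by simp
  qed simp
qed

text \<open>The energy is an average of autocorrelation values under a probability measure, and each
  of them is at most the squared norm. The bound holds for every n, not only in the limit.\<close>

lemma fourier_energy_le:
  assumes g: "L2_fun g" and g1: "integrable lborel g"
  shows "fourier_energy n g \<le> (\<integral>\<^sup>+t. ennreal ((cmod (g t))\<^sup>2) \<partial>lborel)"
proof -
  interpret G: prob_space gauss by (rule prob_space_gauss)
  have [measurable]: "g \<in> borel_measurable borel" using g by (simp add: L2_fun_def)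
  note [measurable] = autocorr_measurable
  have bd: "\<bar>Re (autocorr g h)\<bar> \<le> (LINT t|lborel. (cmod (g t))\<^sup>2)" for h
    using autocorr_bound[OF g, of h] abs_Re_le_cmod order_trans by blast
  have "(LINT r|gauss. Re (autocorr g (r / real (Suc n)))) \<le> (LINT r|gauss. (LINT t|lborel. (cmod (g t))\<^sup>2))"
    using bd by (intro integral_mono G.integrable_const_bound[OF AE_I2]) (auto intro: abs_le_D1)
  then show ?thesis
    using g unfolding fourier_energy_eq[OF g g1]
    by (subst nn_integral_eq_integral) (auto simp: L2_fun_def prob_gauss intro!: ennreal_leI)
qed

text \<open>Only the arguments r / (n + 1) of the autocorrelation occur, and they tend to 0; the
  constant majorant is supplied by \<open>autocorr_bound\<close>.\<close>

lemma fourier_energy_tendsto: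
  assumes g: "L2_fun g" and g1: "integrable lborel g"
  shows "(\<lambda>n. fourier_energy n g) \<longlonglongrightarrow> (\<integral>\<^sup>+t. ennreal ((cmod (g t))\<^sup>2) \<partial>lborel)"
proof -
  interpret G: prob_space gauss by (rule prob_space_gauss)
  have [measurable]: "g \<in> borel_measurable borel" using g by (simp add: L2_fun_def)
  note [measurable] = autocorr_measurable
  have bd: "\<bar>Re (autocorr g h)\<bar> \<le> (LINT t|lborel. (cmod (g t))\<^sup>2)" for h
    using autocorr_bound[OF g, of h] abs_Re_le_cmod order_trans by blast
  have "(\<lambda>n. LINT r|gauss. Re (autocorr g (r / real (Suc n)))) \<longlonglongrightarrow> (LINT r|gauss. (LINT t|lborel. (cmod (g t))\<^sup>2))"
  proof (rule integral_dominated_convergence[where w = "\<lambda>_. LINT t|lborel. (cmod (g t))\<^sup>2"])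
    show "AE r in gauss. (\<lambda>n. Re (autocorr g (r / real (Suc n)))) \<longlonglongrightarrow> (LINT t|lborel. (cmod (g t))\<^sup>2)"
    proof (rule AE_I2)
      fix r :: real
      have "(\<lambda>n. r * inverse (real (Suc n))) \<longlonglongrightarrow> r * 0"
        by (intro tendsto_intros LIMSEQ_inverse_real_of_nat)
      then show "(\<lambda>n. Re (autocorr g (r / real (Suc n)))) \<longlonglongrightarrow> (LINT t|lborel. (cmod (g t))\<^sup>2)"
        by (intro autocorr_tendsto[OF g]) (simp add: divide_inverse)
    qed
  qed (use bd in auto)
  then show ?thesis
    using g unfolding fourier_energy_eq[OF g g1]
    by (subst nn_integral_eq_integral) (auto simp: L2_fun_def prob_gauss intro!: tendsto_ennrealI)
qed

section \<open>Weak derivatives\<close>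

lemma locally_integrable_measurable:
  assumes "locally_integrable f"
  shows "f \<in> borel_measurable lebesgue"
proof (rule borel_measurable_LIMSEQ_metric)
  show "(\<lambda>x. indicator (cball 0 (real n)) x *\<^sub>R f x) \<in> borel_measurable lebesgue" for n
    using assms unfolding locally_integrable_def set_integrable_def
    by (intro borel_measurable_integrable) auto
  fix x :: 'a
  obtain n0 :: nat where "norm x \<le> real n0" using real_arch_simple by blast
  then show "(\<lambda>n. indicator (cball 0 (real n)) x *\<^sub>R f x) \<longlonglongrightarrow> f x"
    by (intro tendsto_eventually eventually_sequentiallyI[of n0]) auto
qed

lemma locally_integrable_bounded_mult:
  assumes f: "locally_integrable f" and K: "compact K"
    and c: "c \<in> borel_measurable lebesgue" "\<And>x. norm (c x) \<le> B * indicator K x"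
  shows "integrable lebesgue (\<lambda>x. c x * f x)"
proof (rule Bochner_Integration.integrable_bound)
  show "integrable lebesgue (\<lambda>x. B * norm (indicator K x *\<^sub>R f x))"
    using f K unfolding locally_integrable_def set_integrable_def
    by (intro integrable_mult_right integrable_norm) blast
  show "(\<lambda>x. c x * f x) \<in> borel_measurable lebesgue"
    using c(1) locally_integrable_measurable[OF f] by measurable
  have "norm (c x * f x) \<le> norm (B * norm (indicator K x *\<^sub>R f x))" for x
  proof -
    have "norm (c x * f x) \<le> (B * indicator K x) * norm (f x)"
      unfolding norm_mult by (intro mult_right_mono c) auto
    also have "\<dots> \<le> \<bar>B * norm (indicator K x *\<^sub>R f x)\<bar>" by (simp add: mult.assoc)
    finally show ?thesis by simp
  qed
  then show "AE x in lebesgue. norm (c x * f x) \<le> norm (B * norm (indicator K x *\<^sub>R f x))" by simp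
qed

lemma test_function_measurable:
  "test_function \<phi> \<Longrightarrow> \<phi> \<in> borel_measurable borel"
  by (intro borel_measurable_continuous_onI test_functionD)

lemma test_function_dominated:
  assumes "test_function \<phi>"
  obtains B where "\<And>x. norm (\<phi> x) \<le> B * indicator (closure {x. \<phi> x \<noteq> 0}) x"
proof -
  obtain B where B: "B > 0" "\<And>x. \<bar>\<phi> x\<bar> \<le> B" by (rule test_function_bounded[OF assms]) blast
  have "norm (\<phi> x) \<le> B * indicator (closure {x. \<phi> x \<noteq> 0}) x" for x
    using B closure_subset[of "{x. \<phi> x \<noteq> 0}"] by (cases "\<phi> x = 0") (auto simp: indicator_def)
  then show ?thesis by (rule that)
qed

lemma integrable_test_mult:
  assumes "test_function \<phi>" "locally_integrable f"
  shows "integrable lebesgue (\<lambda>x. \<phi> x *\<^sub>R f x)"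
proof -
  obtain B where "\<And>x. norm (\<phi> x) \<le> B * indicator (closure {x. \<phi> x \<noteq> 0}) x"
    by (rule test_function_dominated[OF assms(1)]) blast
  then have "integrable lebesgue (\<lambda>x. complex_of_real (\<phi> x) * f x)"
    using test_function_measurable[OF assms(1)] test_functionD[OF assms(1)] assms(2)
    by (intro locally_integrable_bounded_mult[where K = "closure {x. \<phi> x \<noteq> 0}" and B = B])
      (auto simp: measurable_completion)
  then show ?thesis by (simp add: scaleR_conv_of_real)
qed

text \<open>The measures with densities max 0 f and max 0 (-f) agree on open boxes, an
  intersection-stable generator of the Borel sets, so they are equal and their densities agree
  almost everywhere. Two numbers max 0 r and max 0 (-r) coincide only for r = 0.\<close>

lemma box_integrals_zero_imp_AE_zero:
  fixes f :: "'a::euclidean_space \<Rightarrow> real"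
  assumes f[measurable]: "f \<in> borel_measurable borel"
    and int: "\<And>a b. integrable lborel (\<lambda>x. indicator (box a b) x * f x)"
    and zero: "\<And>a b. (LINT x|lborel. indicator (box a b) x * f x) = 0"
  shows "AE x in lborel. f x = 0"
proof -
  define P where "P = density lborel (\<lambda>x. ennreal (max 0 (f x)))"
  define N where "N = density lborel (\<lambda>x. ennreal (max 0 (- f x)))"
  let ?E = "range (\<lambda>(a, b). box a b :: 'a set)"
  have ip: "integrable lborel (\<lambda>x. max 0 (indicator (box a b) x * f x))"
    and "integrable lborel (\<lambda>x. max 0 (- (indicator (box a b) x * f x)))" for a b
    using int[of a b] by (intro integrable_max integrable_zero; simp)+
  note ints = this
  have P_box: "emeasure P (box a b) = ennreal (LINT x|lborel. max 0 (indicator (box a b) x * f x))" for a b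
  proof -
    have "emeasure P (box a b) = (\<integral>\<^sup>+x. ennreal (max 0 (f x)) * indicator (box a b) x \<partial>lborel)"
      unfolding P_def by (subst emeasure_density) auto
    also have "\<dots> = (\<integral>\<^sup>+x. ennreal (max 0 (indicator (box a b) x * f x)) \<partial>lborel)"
      by (intro nn_integral_cong) (auto simp: indicator_def)
    also have "\<dots> = ennreal (LINT x|lborel. max 0 (indicator (box a b) x * f x))"
      by (rule nn_integral_eq_integral[OF ints(1)]) auto
    finally show ?thesis .
  qed
  have N_box: "emeasure N (box a b) = ennreal (LINT x|lborel. max 0 (- (indicator (box a b) x * f x)))" for a b
  proof -
    have "emeasure N (box a b) = (\<integral>\<^sup>+x. ennreal (max 0 (- f x)) * indicator (box a b) x \<partial>lborel)"
      unfolding N_def by (subst emeasure_density) auto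
    also have "\<dots> = (\<integral>\<^sup>+x. ennreal (max 0 (- (indicator (box a b) x * f x))) \<partial>lborel)"
      by (intro nn_integral_cong) (auto simp: indicator_def)
    also have "\<dots> = ennreal (LINT x|lborel. max 0 (- (indicator (box a b) x * f x)))"
      by (rule nn_integral_eq_integral[OF ints(2)]) auto
    finally show ?thesis .
  qed
  have eq: "(LINT x|lborel. max 0 (indicator (box a b) x * f x)) =
      (LINT x|lborel. max 0 (- (indicator (box a b) x * f x)))" for a b
  proof -
    have "(LINT x|lborel. max 0 (indicator (box a b) x * f x)) -
        (LINT x|lborel. max 0 (- (indicator (box a b) x * f x))) =
        (LINT x|lborel. indicator (box a b) x * f x)"
      by (subst Bochner_Integration.integral_diff[OF ints, symmetric])
        (auto intro!: Bochner_Integration.integral_cong)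
    with zero show ?thesis by simp
  qed
  have "P = N"
  proof (rule measure_eqI_generator_eq)
    let ?A = "\<lambda>n::nat. box (- (real n *\<^sub>R One)) (real n *\<^sub>R One) :: 'a set"
    show "Int_stable ?E" by (auto simp: Int_stable_def box_Int_box)
    show "sets P = sigma_sets UNIV ?E" "sets N = sigma_sets UNIV ?E"
      by (simp_all add: P_def N_def borel_eq_box)
    show "range ?A \<subseteq> ?E" "(\<Union>i. ?A i) = UNIV" unfolding UN_box_eq_UNIV by auto
    show "emeasure P (?A i) \<noteq> \<infinity>" for i by (simp add: P_box)
    show "emeasure P X = emeasure N X" if "X \<in> ?E" for X
      using that by (auto simp: P_box N_box eq)
  qed auto
  then have "AE x in lborel. ennreal (max 0 (f x)) = ennreal (max 0 (- f x))"
    unfolding P_def N_def by (intro sigma_finite_measure.density_unique[OF sigma_finite_lborel]) auto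
  then show ?thesis by eventually_elim (auto simp: max_def split: if_splits)
qed

lemma lebesgue_borel_representative:
  fixes f :: "'a::euclidean_space \<Rightarrow> complex"
  assumes "f \<in> borel_measurable lebesgue"
  obtains f' where "f' \<in> borel_measurable borel" "AE x in lborel. f x = f' x"
proof -
  have "(\<lambda>x. Re (f x)) \<in> borel_measurable lebesgue" "(\<lambda>x. Im (f x)) \<in> borel_measurable lebesgue"
    using assms by measurable
  then obtain r s where rs: "r \<in> borel_measurable lborel" "s \<in> borel_measurable lborel"
    "AE x in lborel. Re (f x) = r x" "AE x in lborel. Im (f x) = s x"
    using completion_ex_borel_measurable_real by metis
  have "(\<lambda>x. complex_of_real (r x) + \<i> * complex_of_real (s x)) \<in> borel_measurable borel"
    using rs(1,2) by measurable
  moreover have "AE x in lborel. f x = complex_of_real (r x) + \<i> * complex_of_real (s x)"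
    using rs(3,4) by eventually_elim (auto simp: complex_eq_iff)
  ultimately show ?thesis by (rule that)
qed

text \<open>The box bumps tend to the indicator of a box under a fixed integrable majorant, so all
  box integrals of f vanish; the real and imaginary parts are then treated by the preceding
  measure-theoretic criterion.\<close>

lemma fundamental_lemma:
  fixes f :: "'a::euclidean_space \<Rightarrow> complex"
  assumes f: "locally_integrable f"
    and zero: "\<And>\<phi>. test_function \<phi> \<Longrightarrow> (LINT x|lebesgue. \<phi> x *\<^sub>R f x) = 0"
  shows "AE x in lebesgue. f x = 0"
proof -
  note fm[measurable] = locally_integrable_measurable[OF f]
  have I: "integrable lebesgue (\<lambda>x. complex_of_real (indicator A x) * f x)"
    if "A \<in> sets lebesgue" "A \<subseteq> cbox a b" for A a b
    using that by (intro locally_integrable_bounded_mult[OF f compact_cbox[of a b], of _ 1])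
      (auto simp: indicator_def)
  have box0: "(LINT x|lebesgue. complex_of_real (indicator (box a b) x) * f x) = 0" for a b
  proof -
    have "(\<lambda>j. LINT x|lebesgue. box_bump j a b x *\<^sub>R f x) \<longlonglongrightarrow>
        (LINT x|lebesgue. complex_of_real (indicator (box a b) x) * f x)"
    proof (rule integral_dominated_convergence)
      show "integrable lebesgue (\<lambda>x. norm (complex_of_real (indicator (cbox a b) x) * f x))"
        by (intro integrable_norm I[where a = a and b = b]) auto
      show "(\<lambda>x. box_bump j a b x *\<^sub>R f x) \<in> borel_measurable lebesgue" for j
        by (rule borel_measurable_integrable[OF integrable_test_mult[OF test_function_box_bump f]])
      show "AE x in lebesgue. (\<lambda>j. box_bump j a b x *\<^sub>R f x) \<longlonglongrightarrow> complex_of_real (indicator (box a b) x) * f x"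
        unfolding scaleR_conv_of_real[symmetric]
        by (intro AE_I2 tendsto_scaleR tendsto_const box_bump_tendsto)
      have "norm (box_bump j a b x *\<^sub>R f x) \<le> norm (complex_of_real (indicator (cbox a b) x) * f x)" for j x
      proof (cases "box_bump j a b x = 0")
        case False
        then have "x \<in> cbox a b" by (force simp: box_bump_def bump_nonzero_iff mem_box)
        then show ?thesis
          using box_bump_bounds[of j a b x] by (auto simp: mult_left_le_one_le)
      qed auto
      then show "AE x in lebesgue. norm (box_bump j a b x *\<^sub>R f x) \<le>
          norm (complex_of_real (indicator (cbox a b) x) * f x)" for j by simp
    qed (intro borel_measurable_integrable I[where a = a and b = b], auto simp: box_subset_cbox)
    then show ?thesis
      using zero[OF test_function_box_bump] by (simp add: LIMSEQ_const_iff)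
  qed
  \<comment> \<open>\<open>p\<close> stands for \<open>Re\<close> or \<open>Im\<close>. The
    criterion on boxes is about Borel functions, so a Borel function \<open>h\<close> replaces the
    Lebesgue measurable \<open>p (f x)\<close>.\<close>
  have part: "AE x in lebesgue. p (f x) = 0"
    if p: "bounded_linear p" and pm: "\<And>c z. p (complex_of_real c * z) = c * p z"
    for p :: "complex \<Rightarrow> real"
  proof -
    have pf: "(\<lambda>x. p (f x)) \<in> borel_measurable lebesgue"
      using fm by (rule borel_measurable_continuous_on[OF linear_continuous_on[OF p], rotated])
    then obtain h where h: "h \<in> borel_measurable lborel" "AE x in lborel. p (f x) = h x"
      using completion_ex_borel_measurable_real by blast
    have [measurable]: "h \<in> borel_measurable borel" using h(1) by simp
    have h': "AE x in lebesgue. p (f x) = h x" using h(2) by (rule AE_completion)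
    have int: "integrable lebesgue (\<lambda>x. indicator (box a b) x * p (f x))" for a b
      using integrable_bounded_linear[OF p I[of "box a b" a b]] by (simp add: pm box_subset_cbox)
    have int0: "(LINT x|lebesgue. indicator (box a b) x * p (f x)) = 0" for a b
      using integral_bounded_linear[OF p I[of "box a b" a b]] box0[of a b]
      by (simp add: pm box_subset_cbox linear_simps[OF p])
    have hm: "(\<lambda>x. indicator (box a b) x * h x) \<in> borel_measurable lborel" for a b by measurable
    have eq: "AE x in lebesgue. indicator (box a b) x * p (f x) = indicator (box a b) x * h x" for a b
      using h' by eventually_elim simp
    have "AE x in lborel. h x = 0"
    proof (rule box_integrals_zero_imp_AE_zero)
      fix a b
      have "integrable lebesgue (\<lambda>x. indicator (box a b) x * h x)"
        using int[of a b] by (rule integrable_cong_AE_imp)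
          (use eq[of a b] in \<open>auto intro: measurable_completion[OF hm] elim: eventually_mono\<close>)
      then show "integrable lborel (\<lambda>x. indicator (box a b) x * h x)"
        using integrable_completion[OF hm] by blast
      have "(LINT x|lborel. indicator (box a b) x * h x) = (LINT x|lebesgue. indicator (box a b) x * h x)"
        by (rule integral_completion[OF hm, symmetric])
      also have "\<dots> = (LINT x|lebesgue. indicator (box a b) x * p (f x))"
        by (rule integral_cong_AE[OF measurable_completion[OF hm] borel_measurable_integrable[OF int]])
          (use eq[of a b] in \<open>auto elim: eventually_mono\<close>)
      finally show "(LINT x|lborel. indicator (box a b) x * h x) = 0" using int0 by simp
    qed measurable
    then have "AE x in lebesgue. h x = 0" by (rule AE_completion)
    with h' show ?thesis by eventually_elim simp
  qed
  have "AE x in lebesgue. Re (f x) = 0" by (rule part[OF bounded_linear_Re]) simp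
  moreover have "AE x in lebesgue. Im (f x) = 0" by (rule part[OF bounded_linear_Im]) simp
  ultimately show ?thesis by eventually_elim (simp add: complex_eq_iff)
qed

section \<open>Weak derivatives up to null sets\<close>

lemma locally_integrable_cong_AE:
  assumes "locally_integrable f" "AE x in lebesgue. f x = f' x" "f' \<in> borel_measurable lebesgue"
  shows "locally_integrable f'"
  unfolding locally_integrable_def set_integrable_def
proof (intro allI impI)
  fix K :: "'a set" assume "compact K"
  then have "integrable lebesgue (\<lambda>x. indicator K x *\<^sub>R f x)"
    using assms(1) by (auto simp: locally_integrable_def set_integrable_def)
  then show "integrable lebesgue (\<lambda>x. indicator K x *\<^sub>R f' x)"
  proof (rule integrable_cong_AE_imp)
    have "K \<in> sets lebesgue" using \<open>compact K\<close> by (simp add: fmeasurableD lmeasurable_compact)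
    then show "(\<lambda>x. indicator K x *\<^sub>R f' x) \<in> borel_measurable lebesgue"
      using assms(3) by measurable
    show "AE x in lebesgue. indicator K x *\<^sub>R f x = indicator K x *\<^sub>R f' x"
      using assms(2) by eventually_elim simp
  qed
qed

lemma locally_integrable_diff:
  "locally_integrable f \<Longrightarrow> locally_integrable g \<Longrightarrow> locally_integrable (\<lambda>x. f x - g x)"
  unfolding locally_integrable_def using set_integral_diff(1) by blast

lemma locally_integrable_add:
  "locally_integrable f \<Longrightarrow> locally_integrable g \<Longrightarrow> locally_integrable (\<lambda>x. f x + g x)"
  unfolding locally_integrable_def using set_integral_add(1) by blast

lemma test_integral_cong_AE:
  assumes "AE x in lebesgue. f x = f' x" "locally_integrable f" "locally_integrable f'"
    "test_function \<phi>"
  shows "(LINT x|lebesgue. \<phi> x *\<^sub>R f x) = (LINT x|lebesgue. \<phi> x *\<^sub>R f' x)"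
  using assms(1) integrable_test_mult[OF assms(4,2)] integrable_test_mult[OF assms(4,3)]
  by (intro integral_cong_AE borel_measurable_integrable) (auto elim: eventually_mono)

text \<open>Both sides of the defining identity are integrals against test functions and ignore null
  sets. A basis direction guarantees, by \<open>test_function_deriv\<close>, that the differentiated
  test function is itself a test function.\<close>

lemma has_weak_deriv_cong_AE:
  assumes "has_weak_deriv f b g" "b \<in> Basis"
    and "AE x in lebesgue. f x = f' x" "f' \<in> borel_measurable lebesgue"
    and "AE x in lebesgue. g x = g' x" "g' \<in> borel_measurable lebesgue"
  shows "has_weak_deriv f' b g'"
proof -
  have f: "locally_integrable f" and g: "locally_integrable g"
    using assms(1) by (auto simp: has_weak_deriv_def)
  have f': "locally_integrable f'" by (rule locally_integrable_cong_AE[OF f assms(3,4)])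
  have g': "locally_integrable g'" by (rule locally_integrable_cong_AE[OF g assms(5,6)])
  show ?thesis
    using assms(1) test_integral_cong_AE[OF assms(3) f f' test_function_deriv[OF _ assms(2)]]
      test_integral_cong_AE[OF assms(5) g g']
    unfolding has_weak_deriv_def by (auto simp: f' g')
qed

text \<open>The difference of two weak derivatives integrates to 0 against every test
  function.\<close>

lemma has_weak_deriv_unique:
  assumes "has_weak_deriv f b g" "has_weak_deriv f b h"
  shows "AE x in lebesgue. g x = h x"
proof -
  have g: "locally_integrable g" and h: "locally_integrable h"
    using assms by (auto simp: has_weak_deriv_def)
  have "AE x in lebesgue. g x - h x = 0"
  proof (rule fundamental_lemma[OF locally_integrable_diff[OF g h]])
    fix \<phi> :: "'a \<Rightarrow> real" assume \<phi>: "test_function \<phi>"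
    have "(LINT x|lebesgue. \<phi> x *\<^sub>R g x) = (LINT x|lebesgue. \<phi> x *\<^sub>R h x)"
      using assms \<phi> unfolding has_weak_deriv_def by (metis neg_equal_iff_equal)
    then show "(LINT x|lebesgue. \<phi> x *\<^sub>R (g x - h x)) = 0"
      using integrable_test_mult[OF \<phi> g] integrable_test_mult[OF \<phi> h]
      by (simp add: scaleR_diff_right)
  qed
  then show ?thesis by simp
qed

lemma weak_deriv_AE:
  assumes "has_weak_deriv f b g"
  shows "AE x in lebesgue. weak_deriv b f x = g x" "has_weak_deriv f b (weak_deriv b f)"
proof -
  show *: "has_weak_deriv f b (weak_deriv b f)"
    unfolding weak_deriv_def by (rule someI[where P = "has_weak_deriv f b"], rule assms)
  show "AE x in lebesgue. weak_deriv b f x = g x"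
    by (rule has_weak_deriv_unique[OF * assms])
qed

lemma has_weak_deriv_measurable:
  assumes "has_weak_deriv f b g"
  shows "f \<in> borel_measurable lebesgue" "g \<in> borel_measurable lebesgue"
  using assms locally_integrable_measurable by (auto simp: has_weak_deriv_def)

text \<open>\<open>weak_deriv\<close> is a choice, so the inner derivative equals \<open>g\<close>
  only almost everywhere; the outer derivative must be insensitive to that. This is what evaluates
  \<open>laplacian_dirs\<close>.\<close>

lemma weak_deriv_weak_deriv_AE:
  assumes "has_weak_deriv f b g" "has_weak_deriv g c h" "c \<in> Basis"
  shows "AE x in lebesgue. weak_deriv c (weak_deriv b f) x = h x"
proof (rule weak_deriv_AE(1), rule has_weak_deriv_cong_AE[OF assms(2,3)])
  show "AE x in lebesgue. g x = weak_deriv b f x"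
    using weak_deriv_AE(1)[OF assms(1)] by eventually_elim simp
qed (use has_weak_deriv_measurable[OF assms(2)] has_weak_deriv_measurable[OF weak_deriv_AE(2)[OF assms(1)]] in auto)

section \<open>Integration against test functions of time\<close>

lemma L2_fun_mult_integrable:
  assumes "L2_fun \<psi>" "L2_fun g"
  shows "integrable lborel (\<lambda>t. \<psi> t * g t)"
proof (rule Bochner_Integration.integrable_bound)
  show "integrable lborel (\<lambda>t. ((cmod (\<psi> t))\<^sup>2 + (cmod (g t))\<^sup>2) / 2)"
    using assms by (auto simp: L2_fun_def)
  have [measurable]: "g \<in> borel_measurable borel" "\<psi> \<in> borel_measurable borel"
    using assms by (auto simp: L2_fun_def)
  show "(\<lambda>t. \<psi> t * g t) \<in> borel_measurable lborel" by measurable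
qed (auto simp: norm_mult norm_mult_le_squares)

lemma L2_fun_Cauchy_Schwarz:
  assumes "L2_fun \<psi>" "L2_fun g"
  shows "(cmod (LINT t|lborel. \<psi> t * g t))\<^sup>2 \<le>
    (LINT t|lborel. (cmod (\<psi> t))\<^sup>2) * (LINT t|lborel. (cmod (g t))\<^sup>2)"
proof -
  let ?a = "LINT t|lborel. (cmod (\<psi> t))\<^sup>2" and ?c = "LINT t|lborel. (cmod (g t))\<^sup>2"
  let ?b = "cmod (LINT t|lborel. \<psi> t * g t)"
  have I: "integrable lborel (\<lambda>t. (cmod (\<psi> t))\<^sup>2)" "integrable lborel (\<lambda>t. (cmod (g t))\<^sup>2)"
    using assms by (auto simp: L2_fun_def)
  have J: "integrable lborel (\<lambda>t. cmod (\<psi> t) * cmod (g t))"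
    using integrable_norm[OF L2_fun_mult_integrable[OF assms]] by (simp add: norm_mult)
  have b: "?b \<le> (LINT t|lborel. cmod (\<psi> t) * cmod (g t))"
    by (rule order_trans[OF integral_norm_bound]) (simp add: norm_mult)
  have "0 \<le> ?a * x\<^sup>2 + ?c - 2 * x * ?b" if "x \<ge> 0" for x
  proof -
    have "0 \<le> (LINT t|lborel. (x * cmod (\<psi> t) - cmod (g t))\<^sup>2)" by simp
    also have "\<dots> = (LINT t|lborel. x\<^sup>2 * (cmod (\<psi> t))\<^sup>2 + (cmod (g t))\<^sup>2 - 2 * x * (cmod (\<psi> t) * cmod (g t)))"
      by (intro Bochner_Integration.integral_cong) (auto simp: power2_eq_square algebra_simps)
    also have "\<dots> = x\<^sup>2 * ?a + ?c - 2 * x * (LINT t|lborel. cmod (\<psi> t) * cmod (g t))"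
      using I J by simp
    also have "\<dots> \<le> x\<^sup>2 * ?a + ?c - 2 * x * ?b"
      using b that by (intro diff_left_mono mult_left_mono) auto
    finally show ?thesis by (simp add: mult.commute)
  qed
  note quad = this
  have a0: "0 \<le> ?a" by simp
  show ?thesis
  proof (cases "?a = 0")
    case True
    \<comment> \<open>For \<open>?a\<close> = 0 the quadratic form degenerates to c - 2 x b, which
      is negative at x = (c + 1) / b unless b vanishes.\<close>
    have "?b = 0"
    proof (rule ccontr)
      assume "?b \<noteq> 0"
      then have eq: "2 * ((?c + 1) / ?b) * ?b = 2 * (?c + 1)" by simp
      have "?c \<ge> 0" by simp
      then show False using quad[of "(?c + 1) / ?b"] \<open>?c \<ge> 0\<close> unfolding eq True
        by auto
    qed
    then show ?thesis by simp
  next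
    case False
    with a0 have "?a > 0" by linarith
    \<comment> \<open>The minimiser of the quadratic a x^2 - 2 b x + c is x = b / a.\<close>
    with quad[of "?b / ?a"] show ?thesis
      by (simp add: power2_eq_square field_simps)
  qed
qed

text \<open>\<open>test_function\<close> is real valued, while Fourier kernels are complex; each
  identity is tested with the real and the imaginary part and then reassembled.\<close>

definition complex_test :: "(real \<Rightarrow> complex) \<Rightarrow> bool" where
  "complex_test \<psi> \<longleftrightarrow> test_function (\<lambda>t. Re (\<psi> t)) \<and> test_function (\<lambda>t. Im (\<psi> t))"

lemma complex_test_measurable:
  assumes "complex_test \<psi>"
  shows "\<psi> \<in> borel_measurable borel"
proof -
  have [measurable]: "(\<lambda>t. Re (\<psi> t)) \<in> borel_measurable borel" "(\<lambda>t. Im (\<psi> t)) \<in> borel_measurable borel"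
    using assms by (auto simp: complex_test_def intro: test_function_measurable)
  have "(\<lambda>t. complex_of_real (Re (\<psi> t)) + \<i> * complex_of_real (Im (\<psi> t))) \<in> borel_measurable borel"
    by measurable
  then show ?thesis by (simp only: complex_eq[symmetric])
qed

lemma complex_test_dominated:
  assumes "complex_test \<psi>"
  obtains B K where "compact K" "B \<ge> 0" "\<And>t. cmod (\<psi> t) \<le> B * indicator K t"
proof -
  have R: "test_function (\<lambda>t. Re (\<psi> t))" and I: "test_function (\<lambda>t. Im (\<psi> t))"
    using assms by (auto simp: complex_test_def)
  obtain B where B: "B > 0" "\<And>t. \<bar>Re (\<psi> t)\<bar> \<le> B" by (rule test_function_bounded[OF R]) blast
  obtain C where C: "C > 0" "\<And>t. \<bar>Im (\<psi> t)\<bar> \<le> C" by (rule test_function_bounded[OF I]) blast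
  let ?K = "closure {t. Re (\<psi> t) \<noteq> 0} \<union> closure {t. Im (\<psi> t) \<noteq> 0}"
  have "cmod (\<psi> t) \<le> (B + C) * indicator ?K t" for t
  proof (cases "t \<in> ?K")
    case True
    then show ?thesis using cmod_le[of "\<psi> t"] B(2)[of t] C(2)[of t] by simp
  next
    case False
    then have "Re (\<psi> t) = 0" "Im (\<psi> t) = 0"
      using closure_subset[of "{t. Re (\<psi> t) \<noteq> 0}"] closure_subset[of "{t. Im (\<psi> t) \<noteq> 0}"] by auto
    then have "\<psi> t = 0" by (simp add: complex_eq_iff)
    then show ?thesis by (simp only: norm_zero) (use B C in simp)
  qed
  moreover have "compact ?K"
    by (intro compact_Un test_functionD(2)[OF R] test_functionD(2)[OF I])
  ultimately show ?thesis using B(1) C(1) that[of ?K "B + C"] by auto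
qed

lemma complex_test_L2_fun:
  assumes "complex_test \<psi>"
  shows "L2_fun \<psi>"
  unfolding L2_fun_def
proof
  note [measurable] = complex_test_measurable[OF assms]
  show "\<psi> \<in> borel_measurable borel" by measurable
  obtain B K where K: "compact K" "B \<ge> 0" and le: "\<And>t. cmod (\<psi> t) \<le> B * indicator K t"
    by (rule complex_test_dominated[OF assms]) blast
  show "integrable lborel (\<lambda>t. (cmod (\<psi> t))\<^sup>2)"
  proof (rule Bochner_Integration.integrable_bound)
    have "K \<in> sets lborel" "emeasure lborel K < \<infinity>"
      using K(1) emeasure_compact_finite by (auto simp: borel_compact)
    then show "integrable lborel (\<lambda>t. B\<^sup>2 * indicator K t :: real)" by simp
    have "(cmod (\<psi> t))\<^sup>2 \<le> B\<^sup>2 * indicator K t" for t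
      using power_mono[OF le[of t] norm_ge_zero, of 2] by (auto simp: indicator_def split: if_splits)
    then show "AE t in lborel. norm ((cmod (\<psi> t))\<^sup>2) \<le> norm (B\<^sup>2 * indicator K t :: real)" by simp
  qed measurable
qed

definition complex_deriv :: "(real \<Rightarrow> complex) \<Rightarrow> real \<Rightarrow> complex" where
  "complex_deriv \<psi> t = Complex (frechet_derivative (\<lambda>t. Re (\<psi> t)) (at t) 1)
     (frechet_derivative (\<lambda>t. Im (\<psi> t)) (at t) 1)"

lemma complex_test_deriv: "complex_test \<psi> \<Longrightarrow> complex_test (complex_deriv \<psi>)"
  by (auto simp: complex_test_def complex_deriv_def intro!: test_function_deriv)

text \<open>The pairing is bilinear, without conjugation: for \<psi>(t) = \<eta>(t) exp(-i \<tau> t)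
  it is the Fourier transform in time of \<eta> f at frequency \<tau>.\<close>

definition slice :: "(real \<Rightarrow> complex) \<Rightarrow> ('a::euclidean_space \<times> real \<Rightarrow> complex) \<Rightarrow> 'a \<Rightarrow> complex" where
  "slice \<psi> f x = (LINT t|lborel. \<psi> t * f (x, t))"

lemma borel_measurable_pair:
  fixes f :: "'a::euclidean_space \<times> real \<Rightarrow> 'b::topological_space"
  shows "f \<in> borel_measurable borel \<Longrightarrow> f \<in> borel_measurable (borel \<Otimes>\<^sub>M borel)"
  by (simp add: borel_prod)

lemma slice_measurable:
  assumes [measurable]: "\<psi> \<in> borel_measurable borel" and f: "f \<in> borel_measurable borel"
  shows "slice \<psi> f \<in> borel_measurable borel"
proof -
  note [measurable] = borel_measurable_pair[OF f]
  show ?thesis unfolding slice_def by measurable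
qed

lemma slice_integrable:
  assumes f: "f \<in> borel_measurable borel" "locally_integrable f"
    and \<psi>: "complex_test \<psi>"
    and c: "c \<in> borel_measurable borel" "compact K" "\<And>x. norm (c x) \<le> B * indicator K x"
  shows "integrable (lborel \<Otimes>\<^sub>M lborel) (\<lambda>(x, t). complex_of_real (c x) * (\<psi> t * f (x, t)))"
proof -
  obtain B' K' where K': "compact K'" "B' \<ge> 0" and le: "\<And>t. cmod (\<psi> t) \<le> B' * indicator K' t"
    by (rule complex_test_dominated[OF \<psi>]) blast
  note [measurable] = complex_test_measurable[OF \<psi>] c(1) borel_measurable_pair[OF f(1)]
  have m: "(\<lambda>y. complex_of_real (c (fst y)) * \<psi> (snd y)) \<in> borel_measurable borel"
    unfolding borel_prod[symmetric] by measurable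
  have "integrable lebesgue (\<lambda>y. (complex_of_real (c (fst y)) * \<psi> (snd y)) * f y)"
  proof (rule locally_integrable_bounded_mult[OF f(2)])
    show "compact (K \<times> K')" using c(2) K'(1) by (rule compact_Times)
    show "(\<lambda>y. complex_of_real (c (fst y)) * \<psi> (snd y)) \<in> borel_measurable lebesgue"
      using m by (simp add: measurable_completion)
    show "norm (complex_of_real (c (fst y)) * \<psi> (snd y)) \<le> (B * B') * indicator (K \<times> K') y" for y
    proof -
      have "norm (complex_of_real (c (fst y)) * \<psi> (snd y)) \<le>
          (B * indicator K (fst y)) * (B' * indicator K' (snd y))"
        unfolding norm_mult norm_of_real using c(3)[of "fst y"] le
        by (intro mult_mono) (auto intro: order_trans[OF abs_ge_zero])
      then show ?thesis
        by (cases "fst y \<in> K"; cases "snd y \<in> K'") (auto simp: mem_Times_iff)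
    qed
  qed
  moreover have "(\<lambda>y. (complex_of_real (c (fst y)) * \<psi> (snd y)) * f y) \<in> borel_measurable lborel"
    using m f(1) by measurable
  ultimately have "integrable lborel (\<lambda>y. (complex_of_real (c (fst y)) * \<psi> (snd y)) * f y)"
    using integrable_completion by blast
  then show ?thesis by (simp add: lborel_prod case_prod_beta' mult.assoc)
qed

lemma slice_locally_integrable:
  assumes f: "f \<in> borel_measurable borel" "locally_integrable f" and \<psi>: "complex_test \<psi>"
  shows "locally_integrable (slice \<psi> f)"
  unfolding locally_integrable_def set_integrable_def
proof (intro allI impI)
  fix K :: "'a set" assume K: "compact K"
  have KB[measurable]: "K \<in> sets borel" using K by (rule borel_compact)
  have "integrable lborel (\<lambda>x. LINT t|lborel. complex_of_real (indicator K x) * (\<psi> t * f (x, t)))"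
    using lborel_pair.integrable_fst[OF slice_integrable[OF f \<psi>, of "indicator K" K 1]] K
    by simp
  then have "integrable lborel (\<lambda>x. indicator K x *\<^sub>R slice \<psi> f x)"
    by (simp add: slice_def scaleR_conv_of_real)
  then show "integrable lebesgue (\<lambda>x. indicator K x *\<^sub>R slice \<psi> f x)"
    using integrable_completion[OF borel_measurable_integrable] by blast
qed

text \<open>Fubini rewrites a test integral of a slice over x as space-time integrals of
  \<open>f\<close> against product test functions. These are the integrals on which the definition
  of the weak derivative can be used.\<close>

lemma slice_test_integral:
  assumes f: "f \<in> borel_measurable borel" "locally_integrable f" and \<psi>: "complex_test \<psi>"
    and \<phi>: "test_function \<phi>"
  shows "(LINT x|lebesgue. \<phi> x *\<^sub>R slice \<psi> f x) =
    (LINT y|lebesgue. (case y of (x, t) \<Rightarrow> \<phi> x * Re (\<psi> t)) *\<^sub>R f y) +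
    \<i> * (LINT y|lebesgue. (case y of (x, t) \<Rightarrow> \<phi> x * Im (\<psi> t)) *\<^sub>R f y)"
proof -
  note [measurable] = complex_test_measurable[OF \<psi>] test_function_measurable[OF \<phi>]
    borel_measurable_pair[OF f(1)] slice_measurable[OF complex_test_measurable[OF \<psi>] f(1)]
  obtain B where B: "\<And>x. norm (\<phi> x) \<le> B * indicator (closure {x. \<phi> x \<noteq> 0}) x"
    by (rule test_function_dominated[OF \<phi>]) blast
  have I: "integrable (lborel \<Otimes>\<^sub>M lborel) (\<lambda>(x, t). complex_of_real (\<phi> x) * (\<psi> t * f (x, t)))"
    by (rule slice_integrable[OF f \<psi> _ test_functionD(2)[OF \<phi>] B]) measurable
  have T: "integrable lebesgue (\<lambda>y. (case y of (x, t) \<Rightarrow> \<phi> x * Re (\<psi> t)) *\<^sub>R f y)"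
    "integrable lebesgue (\<lambda>y. (case y of (x, t) \<Rightarrow> \<phi> x * Im (\<psi> t)) *\<^sub>R f y)"
    using \<psi> by (auto simp: complex_test_def intro!: integrable_test_mult test_function_tensor \<phi> f(2))
  have "(LINT x|lebesgue. \<phi> x *\<^sub>R slice \<psi> f x) = (LINT x|lborel. \<phi> x *\<^sub>R slice \<psi> f x)"
    by (rule integral_completion) measurable
  also have "\<dots> = (LINT x|lborel. LINT t|lborel. complex_of_real (\<phi> x) * (\<psi> t * f (x, t)))"
    by (simp add: slice_def scaleR_conv_of_real)
  also have "\<dots> = (LINT y|(lborel \<Otimes>\<^sub>M lborel). (case y of (x, t) \<Rightarrow> complex_of_real (\<phi> x) * (\<psi> t * f (x, t))))"
    by (rule lborel_pair.integral_fst[OF I])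
  also have "\<dots> = (LINT y|lborel. (case y of (x, t) \<Rightarrow> complex_of_real (\<phi> x) * (\<psi> t * f (x, t))))"
    by (simp only: lborel_prod)
  also have "\<dots> = (LINT y|lebesgue. (case y of (x, t) \<Rightarrow> complex_of_real (\<phi> x) * (\<psi> t * f (x, t))))"
    using borel_measurable_integrable[OF I] by (intro integral_completion[symmetric]) (simp add: lborel_prod)
  also have "\<dots> = (LINT y|lebesgue. (case y of (x, t) \<Rightarrow> \<phi> x * Re (\<psi> t)) *\<^sub>R f y +
      \<i> * ((case y of (x, t) \<Rightarrow> \<phi> x * Im (\<psi> t)) *\<^sub>R f y))"
    by (intro Bochner_Integration.integral_cong)
      (auto simp: complex_eq_iff algebra_simps)
  also have "\<dots> = (LINT y|lebesgue. (case y of (x, t) \<Rightarrow> \<phi> x * Re (\<psi> t)) *\<^sub>R f y) +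
    \<i> * (LINT y|lebesgue. (case y of (x, t) \<Rightarrow> \<phi> x * Im (\<psi> t)) *\<^sub>R f y)"
    using T(1) integrable_mult_right[OF T(2), of \<i>]
    by (simp only: Bochner_Integration.integral_add integral_mult_right_zero)
  finally show ?thesis .
qed

text \<open>In direction (b, 0) the derivative of a product test function falls on the factor in x
  alone, so the identity for \<open>f\<close> and \<open>g\<close> is the identity for their
  slices.\<close>

lemma slice_has_weak_deriv:
  assumes d: "has_weak_deriv f (b, 0) g" and b: "b \<in> Basis"
    and m: "f \<in> borel_measurable borel" "g \<in> borel_measurable borel" and \<psi>: "complex_test \<psi>"
  shows "has_weak_deriv (slice \<psi> f) b (slice \<psi> g)"
proof -
  have li: "locally_integrable f" "locally_integrable g"
    using d by (auto simp: has_weak_deriv_def)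
  have parts: "(LINT y|lebesgue. (case y of (x, t) \<Rightarrow> frechet_derivative \<phi> (at x) b * \<rho> t) *\<^sub>R f y) =
      - (LINT y|lebesgue. (case y of (x, t) \<Rightarrow> \<phi> x * \<rho> t) *\<^sub>R g y)"
    if "test_function \<phi>" "test_function \<rho>" for \<phi> \<rho>
  proof -
    have lin: "linear (frechet_derivative \<rho> (at t))" for t
      using test_functionD(4)[OF that(2)] has_derivative_linear by blast
    have eq: "frechet_derivative (\<lambda>(x, t). \<phi> x * \<rho> t) (at y) (b, 0) =
        (case y of (x, t) \<Rightarrow> frechet_derivative \<phi> (at x) b * \<rho> t)" for y
      using test_function_tensor_deriv[OF that, of "fst y" "snd y" b 0]
      by (simp add: linear_0[OF lin] case_prod_beta')
    have "(LINT y|lebesgue. frechet_derivative (\<lambda>(x, t). \<phi> x * \<rho> t) (at y) (b, 0) *\<^sub>R f y) =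
        - (LINT y|lebesgue. (case y of (x, t) \<Rightarrow> \<phi> x * \<rho> t) *\<^sub>R g y)"
      using d test_function_tensor[OF that] unfolding has_weak_deriv_def by blast
    then show ?thesis by (simp only: eq)
  qed
  show ?thesis
    unfolding has_weak_deriv_def
  proof (intro conjI allI impI slice_locally_integrable m li \<psi>)
    fix \<phi> :: "'a \<Rightarrow> real" assume \<phi>: "test_function \<phi>"
    show "(LINT x|lebesgue. frechet_derivative \<phi> (at x) b *\<^sub>R slice \<psi> f x) =
        - (LINT x|lebesgue. \<phi> x *\<^sub>R slice \<psi> g x)"
      using \<psi> parts[OF \<phi>]
      by (simp add: slice_test_integral[OF m(1) li(1) \<psi> test_function_deriv[OF \<phi> b]]
          slice_test_integral[OF m(2) li(2) \<psi> \<phi>] complex_test_def)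
  qed
qed

text \<open>Integration by parts in time. In direction (0, 1) the derivative falls on the factor in
  t; the resulting identity, tested with every function of x, yields the pointwise statement by the
  fundamental lemma.\<close>

lemma slice_time_deriv:
  assumes d: "has_weak_deriv f (0, 1) g"
    and m: "f \<in> borel_measurable borel" "g \<in> borel_measurable borel" and \<psi>: "complex_test \<psi>"
  shows "AE x in lebesgue. slice (complex_deriv \<psi>) f x + slice \<psi> g x = 0"
proof (rule fundamental_lemma)
  have li: "locally_integrable f" "locally_integrable g"
    using d by (auto simp: has_weak_deriv_def)
  note \<psi>' = complex_test_deriv[OF \<psi>]
  show "locally_integrable (\<lambda>x. slice (complex_deriv \<psi>) f x + slice \<psi> g x)"
    by (intro locally_integrable_add slice_locally_integrable m li \<psi> \<psi>')
  have parts: "(LINT y|lebesgue. (case y of (x, t) \<Rightarrow> \<phi> x * frechet_derivative \<rho> (at t) 1) *\<^sub>R f y) =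
      - (LINT y|lebesgue. (case y of (x, t) \<Rightarrow> \<phi> x * \<rho> t) *\<^sub>R g y)"
    if "test_function \<phi>" "test_function \<rho>" for \<phi> :: "'a \<Rightarrow> real" and \<rho>
  proof -
    have lin: "linear (frechet_derivative \<phi> (at x))" for x
      using test_functionD(4)[OF that(1)] has_derivative_linear by blast
    have eq: "frechet_derivative (\<lambda>(x, t). \<phi> x * \<rho> t) (at y) (0, 1) =
        (case y of (x, t) \<Rightarrow> \<phi> x * frechet_derivative \<rho> (at t) 1)" for y
      using test_function_tensor_deriv[OF that, of "fst y" "snd y" 0 1]
      by (simp add: linear_0[OF lin] case_prod_beta')
    have "(LINT y|lebesgue. frechet_derivative (\<lambda>(x, t). \<phi> x * \<rho> t) (at y) (0, 1) *\<^sub>R f y) =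
        - (LINT y|lebesgue. (case y of (x, t) \<Rightarrow> \<phi> x * \<rho> t) *\<^sub>R g y)"
      using d test_function_tensor[OF that] unfolding has_weak_deriv_def by blast
    then show ?thesis by (simp only: eq)
  qed
  fix \<phi> :: "'a \<Rightarrow> real" assume \<phi>: "test_function \<phi>"
  have "(LINT x|lebesgue. \<phi> x *\<^sub>R slice (complex_deriv \<psi>) f x) = - (LINT x|lebesgue. \<phi> x *\<^sub>R slice \<psi> g x)"
    using \<psi> parts[OF \<phi>]
    by (simp add: slice_test_integral[OF m(1) li(1) \<psi>' \<phi>]
        slice_test_integral[OF m(2) li(2) \<psi> \<phi>] complex_test_def complex_deriv_def)
  then show "(LINT x|lebesgue. \<phi> x *\<^sub>R (slice (complex_deriv \<psi>) f x + slice \<psi> g x)) = 0"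
    using integrable_test_mult[OF \<phi> slice_locally_integrable[OF m(1) li(1) \<psi>']]
      integrable_test_mult[OF \<phi> slice_locally_integrable[OF m(2) li(2) \<psi>]]
    by (simp add: scaleR_add_right)
qed

section \<open>Weighted mass and the Fourier transform in time\<close>

lemma L2_mass_lborel: "L2_mass w f = (\<integral>\<^sup>+x. ennreal ((cmod (f x))\<^sup>2) * w x \<partial>lborel)"
  by (simp add: L2_mass_def nn_integral_completion)

lemma L2_mass_cong_AE:
  assumes "AE x in lborel. f x = g x" "AE x in lborel. w x = w' x"
  shows "L2_mass w f = L2_mass w' g"
  unfolding L2_mass_lborel using assms by (intro nn_integral_cong_AE) (auto elim: eventually_elim2)

text \<open>Young's inequality with a free parameter: a small \<theta> keeps the factor of the main
  term near 1 at the price of a large factor on the term that will vanish in a limit.\<close>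

lemma norm_add_square_le:
  fixes a b :: "'a::real_normed_vector"
  assumes "\<theta> > 0"
  shows "(norm (a + b))\<^sup>2 \<le> (1 + \<theta>) * (norm a)\<^sup>2 + (1 + 1 / \<theta>) * (norm b)\<^sup>2"
proof -
  have "0 \<le> (\<theta> * norm a - norm b)\<^sup>2 / \<theta>" using assms by simp
  also have "\<dots> = \<theta> * (norm a)\<^sup>2 + (norm b)\<^sup>2 / \<theta> - 2 * norm a * norm b"
    using assms by (simp add: power2_eq_square field_simps)
  finally have "(norm a + norm b)\<^sup>2 \<le> (1 + \<theta>) * (norm a)\<^sup>2 + (1 + 1 / \<theta>) * (norm b)\<^sup>2"
    by (simp add: power2_eq_square algebra_simps)
  moreover have "(norm (a + b))\<^sup>2 \<le> (norm a + norm b)\<^sup>2"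
    by (intro power_mono norm_triangle_ineq) simp
  ultimately show ?thesis by linarith
qed

lemma L2_mass_add_le:
  assumes \<theta>: "\<theta> > 0" and [measurable]: "f \<in> borel_measurable lebesgue" "g \<in> borel_measurable lebesgue"
    "w \<in> borel_measurable lebesgue"
  shows "L2_mass w (\<lambda>x. f x + g x) \<le> ennreal (1 + \<theta>) * L2_mass w f + ennreal (1 + 1 / \<theta>) * L2_mass w g"
proof -
  have "L2_mass w (\<lambda>x. f x + g x) \<le> (\<integral>\<^sup>+x. ennreal (1 + \<theta>) * (ennreal ((cmod (f x))\<^sup>2) * w x) +
      ennreal (1 + 1 / \<theta>) * (ennreal ((cmod (g x))\<^sup>2) * w x) \<partial>lebesgue)"
    unfolding L2_mass_def
  proof (rule nn_integral_mono)
    fix x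
    have "ennreal ((cmod (f x + g x))\<^sup>2) \<le>
        ennreal ((1 + \<theta>) * (cmod (f x))\<^sup>2 + (1 + 1 / \<theta>) * (cmod (g x))\<^sup>2)"
      by (intro ennreal_leI norm_add_square_le \<theta>)
    also have "\<dots> = ennreal (1 + \<theta>) * ennreal ((cmod (f x))\<^sup>2) + ennreal (1 + 1 / \<theta>) * ennreal ((cmod (g x))\<^sup>2)"
      using \<theta> by (simp add: ennreal_mult)
    finally have "ennreal ((cmod (f x + g x))\<^sup>2) * w x \<le>
        (ennreal (1 + \<theta>) * ennreal ((cmod (f x))\<^sup>2) + ennreal (1 + 1 / \<theta>) * ennreal ((cmod (g x))\<^sup>2)) * w x"
      by (rule mult_right_mono) simp
    then show "ennreal ((cmod (f x + g x))\<^sup>2) * w x \<le> ennreal (1 + \<theta>) * (ennreal ((cmod (f x))\<^sup>2) * w x) +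
      ennreal (1 + 1 / \<theta>) * (ennreal ((cmod (g x))\<^sup>2) * w x)"
      by (simp add: distrib_right mult.assoc)
  qed
  also have "\<dots> = ennreal (1 + \<theta>) * L2_mass w f + ennreal (1 + 1 / \<theta>) * L2_mass w g"
    unfolding L2_mass_def by (simp add: nn_integral_add nn_integral_cmult)
  finally show ?thesis .
qed

lemma L2_mass_cmult:
  assumes [measurable]: "f \<in> borel_measurable lebesgue" "w \<in> borel_measurable lebesgue"
  shows "L2_mass w (\<lambda>x. c * f x) = ennreal ((cmod c)\<^sup>2) * L2_mass w f"
  unfolding L2_mass_def norm_mult power_mult_distrib
  by (subst nn_integral_cmult[symmetric]) (auto simp: ennreal_mult mult.assoc)

lemma L2_add:
  assumes "f \<in> L2 w" "g \<in> L2 w" "w \<in> borel_measurable lebesgue"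
  shows "(\<lambda>x. f x + g x) \<in> L2 w"
proof -
  have "L2_mass w (\<lambda>x. f x + g x) \<le> ennreal (1 + 1) * L2_mass w f + ennreal (1 + 1 / 1) * L2_mass w g"
    using assms by (intro L2_mass_add_le) (auto simp: L2_def)
  also have "\<dots> < \<infinity>" using assms by (auto simp: L2_def ennreal_mult_less_top)
  finally show ?thesis using assms by (auto simp: L2_def)
qed

lemma L2_cmult:
  assumes "f \<in> L2 w" "w \<in> borel_measurable lebesgue"
  shows "(\<lambda>x. c * f x) \<in> L2 w"
  using assms by (auto simp: L2_def L2_mass_cmult ennreal_mult_less_top)

lemma L2_sum:
  assumes "\<And>i. i \<in> I \<Longrightarrow> f i \<in> L2 w" "w \<in> borel_measurable lebesgue"
  shows "(\<lambda>x. \<Sum>i\<in>I. f i x) \<in> L2 w"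
  using assms(1)
  by (induction I rule: infinite_finite_induct)
    (auto intro: L2_add assms(2), auto simp: L2_def L2_mass_def)

lemma AE_lborel_fst:
  assumes "AE x in lborel. P x"
  shows "AE y in (lborel :: ('a::euclidean_space \<times> real) measure). P (fst y)"
proof -
  obtain N where N: "{x \<in> space lborel. \<not> P x} \<subseteq> N" "emeasure lborel N = 0" "N \<in> sets lborel"
    using assms by (rule AE_E)
  show ?thesis
  proof (rule AE_I)
    show "{y \<in> space lborel. \<not> P (fst y)} \<subseteq> N \<times> UNIV" using N(1) by auto
    show "emeasure lborel (N \<times> (UNIV :: real set)) = 0"
      using N by (simp add: lborel_prod[symmetric] lborel.emeasure_pair_measure_Times)
    have "N \<times> (UNIV :: real set) \<in> sets (lborel \<Otimes>\<^sub>M lborel)" using N(3) by auto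
    then show "N \<times> (UNIV :: real set) \<in> sets lborel" by (simp only: lborel_prod)
  qed
qed

lemma lebesgue_weight_representative:
  assumes "w \<in> borel_measurable lebesgue"
  obtains w' :: "'a::euclidean_space \<Rightarrow> ennreal" where "w' \<in> borel_measurable borel" "AE x in lborel. w x = w' x"
  using completion_ex_borel_measurable[OF assms] that by auto

lemma L2_mass_prod:
  fixes f :: "'a::euclidean_space \<times> real \<Rightarrow> complex"
  assumes f: "f \<in> borel_measurable borel" and [measurable]: "w \<in> borel_measurable borel"
  shows "L2_mass (\<lambda>(x, t). w x) f =
    (\<integral>\<^sup>+x. (\<integral>\<^sup>+t. ennreal ((cmod (f (x, t)))\<^sup>2) \<partial>lborel) * w x \<partial>lborel)"
proof -
  note [measurable] = borel_measurable_pair[OF f]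
  have "L2_mass (\<lambda>(x, t). w x) f =
      (\<integral>\<^sup>+y. (case y of (x, t) \<Rightarrow> ennreal ((cmod (f (x, t)))\<^sup>2) * w x) \<partial>(lborel \<Otimes>\<^sub>M lborel))"
    unfolding L2_mass_lborel lborel_prod by (intro nn_integral_cong) auto
  also have "\<dots> = (\<integral>\<^sup>+x. (\<integral>\<^sup>+t. ennreal ((cmod (f (x, t)))\<^sup>2) * w x \<partial>lborel) \<partial>lborel)"
    by (subst lborel.nn_integral_fst[symmetric]) auto
  also have "\<dots> = (\<integral>\<^sup>+x. (\<integral>\<^sup>+t. ennreal ((cmod (f (x, t)))\<^sup>2) \<partial>lborel) * w x \<partial>lborel)"
    by (intro nn_integral_cong nn_integral_multc) measurable
  finally show ?thesis .
qed

lemma L2_sections: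
  fixes f :: "'a::euclidean_space \<times> real \<Rightarrow> complex"
  assumes f: "f \<in> borel_measurable borel" and L2: "f \<in> L2 (\<lambda>_. 1)"
  shows "AE x in lborel. L2_fun (\<lambda>t. f (x, t))"
proof -
  note [measurable] = borel_measurable_pair[OF f]
  have "(\<integral>\<^sup>+x. (\<integral>\<^sup>+t. ennreal ((cmod (f (x, t)))\<^sup>2) \<partial>lborel) * 1 \<partial>lborel) < \<infinity>"
    using L2 L2_mass_prod[OF f, of "\<lambda>_. 1"] by (simp add: L2_def case_prod_beta')
  then have "AE x in lborel. (\<integral>\<^sup>+t. ennreal ((cmod (f (x, t)))\<^sup>2) \<partial>lborel) \<noteq> \<infinity>"
    by (intro nn_integral_noteq_infinite) auto
  then show ?thesis
  proof eventually_elim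
    case (elim x)
    have [measurable]: "(\<lambda>t. f (x, t)) \<in> borel_measurable borel" by measurable
    show ?case
      using elim unfolding L2_fun_def
      by (auto intro!: integrableI_bounded simp: less_top[symmetric])
  qed
qed

lemma nn_integral_L2_fun:
  "L2_fun g \<Longrightarrow> (\<integral>\<^sup>+t. ennreal ((cmod (g t))\<^sup>2) \<partial>lborel) = ennreal (LINT t|lborel. (cmod (g t))\<^sup>2)"
  by (intro nn_integral_eq_integral) (auto simp: L2_fun_def)

text \<open>Cauchy-Schwarz in t bounds the slice at almost every x by the time section of
  \<open>f\<close>; since the weight does not depend on t, integrating in x gives a multiple of the
  space-time mass.\<close>

lemma slice_L2_mass_finite:
  fixes f :: "'a::euclidean_space \<times> real \<Rightarrow> complex"
  assumes f: "f \<in> borel_measurable borel" "f \<in> L2 (\<lambda>_. 1)" and \<psi>: "L2_fun \<psi>"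
    and w: "w \<in> borel_measurable lebesgue" "L2_mass (\<lambda>(x, t). w x) f < \<infinity>"
  shows "L2_mass w (slice \<psi> f) < \<infinity>"
proof -
  note [measurable] = borel_measurable_pair[OF f(1)]
  obtain w' where w'[measurable]: "w' \<in> borel_measurable borel" and eq: "AE x in lborel. w x = w' x"
    by (rule lebesgue_weight_representative[OF w(1)]) blast
  let ?A = "ennreal (LINT t|lborel. (cmod (\<psi> t))\<^sup>2)"
  have eq2: "AE y in lborel. (case y of (x, t::real) \<Rightarrow> w x) = (case y of (x, t) \<Rightarrow> w' x)"
    using AE_lborel_fst[OF eq] by (simp add: case_prod_beta')
  have "L2_mass w (slice \<psi> f) = L2_mass w' (slice \<psi> f)"
    using eq by (intro L2_mass_cong_AE) auto
  also have "\<dots> \<le> (\<integral>\<^sup>+x. ?A * ((\<integral>\<^sup>+t. ennreal ((cmod (f (x, t)))\<^sup>2) \<partial>lborel) * w' x) \<partial>lborel)"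
    unfolding L2_mass_lborel
  proof (rule nn_integral_mono_AE, use L2_sections[OF f] in eventually_elim)
    case (elim x)
    have "ennreal ((cmod (slice \<psi> f x))\<^sup>2) \<le>
        ennreal ((LINT t|lborel. (cmod (\<psi> t))\<^sup>2) * (LINT t|lborel. (cmod (f (x, t)))\<^sup>2))"
      unfolding slice_def by (intro ennreal_leI L2_fun_Cauchy_Schwarz \<psi> elim)
    also have "\<dots> = ?A * (\<integral>\<^sup>+t. ennreal ((cmod (f (x, t)))\<^sup>2) \<partial>lborel)"
      unfolding nn_integral_L2_fun[OF elim] by (rule ennreal_mult) auto
    finally have "ennreal ((cmod (slice \<psi> f x))\<^sup>2) * w' x \<le>
        (?A * (\<integral>\<^sup>+t. ennreal ((cmod (f (x, t)))\<^sup>2) \<partial>lborel)) * w' x"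
      by (rule mult_right_mono) simp
    then show ?case by (simp add: mult.assoc)
  qed
  also have "\<dots> = ?A * L2_mass (\<lambda>(x, t). w' x) f"
    by (subst nn_integral_cmult) (auto simp: L2_mass_prod[OF f(1)])
  also have "L2_mass (\<lambda>(x, t). w' x) f = L2_mass (\<lambda>(x, t). w x) f"
    using eq2 by (intro L2_mass_cong_AE) (auto simp: eq_commute)
  also have "?A * \<dots> < \<infinity>" using w(2) by (auto simp: ennreal_mult_less_top)
  finally show ?thesis .
qed

lemma fourier_measurable:
  fixes U :: "'a::euclidean_space \<times> real \<Rightarrow> complex"
  assumes "U \<in> borel_measurable borel"
  shows "(\<lambda>(x, \<tau>). fourier (\<lambda>t. U (x, t)) \<tau>) \<in> borel_measurable (lborel \<Otimes>\<^sub>M borel)"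
proof -
  note [measurable] = borel_measurable_pair[OF assms]
  show ?thesis unfolding fourier_def by measurable
qed

text \<open>Tonelli puts the frequency outside, so that an estimate known at each fixed frequency
  can be inserted under the Gaussian integral.\<close>

lemma nn_integral_fourier_energy:
  fixes U :: "'a::euclidean_space \<times> real \<Rightarrow> complex"
  assumes U: "U \<in> borel_measurable borel" and [measurable]: "w \<in> borel_measurable borel"
  shows "(\<integral>\<^sup>+x. fourier_energy n (\<lambda>t. U (x, t)) * w x \<partial>lborel) =
    ennreal (real (Suc n) / sqrt (2 * pi)) *
      (\<integral>\<^sup>+\<theta>. L2_mass w (\<lambda>x. fourier (\<lambda>t. U (x, t)) (real (Suc n) * \<theta>)) \<partial>gauss)"
proof -
  note [measurable] = fourier_measurable[OF U]
  interpret P: pair_sigma_finite lborel gauss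
    by (intro pair_sigma_finite.intro sigma_finite_gauss sigma_finite_lborel)
  let ?k = "ennreal (real (Suc n) / sqrt (2 * pi))"
  let ?a = "\<lambda>x \<theta>. ennreal ((cmod (fourier (\<lambda>t. U (x, t)) (real (Suc n) * \<theta>)))\<^sup>2)"
  have m[measurable]: "(\<lambda>(x, \<theta>). ?a x \<theta>) \<in> borel_measurable (lborel \<Otimes>\<^sub>M gauss)"
  proof -
    have "(\<lambda>(x, \<theta>). (x, real (Suc n) * \<theta>)) \<in> lborel \<Otimes>\<^sub>M gauss \<rightarrow>\<^sub>M lborel \<Otimes>\<^sub>M borel" by measurable
    from measurable_compose[OF this fourier_measurable[OF U]]
    have "(\<lambda>(x, \<theta>). fourier (\<lambda>t. U (x, t)) (real (Suc n) * \<theta>)) \<in> borel_measurable (lborel \<Otimes>\<^sub>M gauss)"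
      by (simp add: case_prod_beta')
    then show ?thesis by measurable
  qed
  have "(\<integral>\<^sup>+x. fourier_energy n (\<lambda>t. U (x, t)) * w x \<partial>lborel) =
      (\<integral>\<^sup>+x. ?k * (\<integral>\<^sup>+\<theta>. ?a x \<theta> * w x \<partial>gauss) \<partial>lborel)"
    unfolding fourier_energy_def
    by (intro nn_integral_cong) (simp add: nn_integral_multc mult.assoc)
  also have "\<dots> = ?k * (\<integral>\<^sup>+x. (\<integral>\<^sup>+\<theta>. ?a x \<theta> * w x \<partial>gauss) \<partial>lborel)"
    by (rule nn_integral_cmult) measurable
  also have "(\<integral>\<^sup>+x. (\<integral>\<^sup>+\<theta>. ?a x \<theta> * w x \<partial>gauss) \<partial>lborel) = (\<integral>\<^sup>+\<theta>. (\<integral>\<^sup>+x. ?a x \<theta> * w x \<partial>lborel) \<partial>gauss)"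
    by (rule P.Fubini'[symmetric]) measurable
  finally show ?thesis by (simp add: L2_mass_lborel)
qed

text \<open>For U the energies converge to the mass at almost every x and Fatou moves the limit out
  of the weighted integral; for H they are at most the mass for every n. No convergence on the side
  of H is required. Finiteness of \<open>w\<close> keeps multiplication by the weight continuous in
  \<open>ennreal\<close>.\<close>

lemma fourier_transfer:
  fixes U H :: "'a::euclidean_space \<times> real \<Rightarrow> complex"
  assumes U: "U \<in> borel_measurable borel" and H: "H \<in> borel_measurable borel"
    and [measurable]: "w \<in> borel_measurable borel" "w' \<in> borel_measurable borel"
    and fin: "AE x in lborel. w x < \<infinity>"
    and secU: "AE x in lborel. L2_fun (\<lambda>t. U (x, t)) \<and> integrable lborel (\<lambda>t. U (x, t))"
    and secH: "AE x in lborel. L2_fun (\<lambda>t. H (x, t)) \<and> integrable lborel (\<lambda>t. H (x, t))"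
    and le: "\<And>\<tau>. L2_mass w (\<lambda>x. fourier (\<lambda>t. U (x, t)) \<tau>) \<le> c * L2_mass w' (\<lambda>x. fourier (\<lambda>t. H (x, t)) \<tau>)"
  shows "L2_mass (\<lambda>(x, t). w x) U \<le> c * L2_mass (\<lambda>(x, t). w' x) H"
proof -
  have Um: "(\<lambda>x. fourier_energy n (\<lambda>t. U (x, t)) * w x) \<in> borel_measurable lborel" for n
  proof -
    have "(\<lambda>(x, \<theta>). (x, real (Suc n) * \<theta>)) \<in> lborel \<Otimes>\<^sub>M gauss \<rightarrow>\<^sub>M lborel \<Otimes>\<^sub>M borel" by measurable
    from measurable_compose[OF this fourier_measurable[OF U]]
    have [measurable]: "(\<lambda>(x, \<theta>). fourier (\<lambda>t. U (x, t)) (real (Suc n) * \<theta>)) \<in> borel_measurable (lborel \<Otimes>\<^sub>M gauss)"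
      by (simp add: case_prod_beta')
    interpret sigma_finite_measure gauss by (rule sigma_finite_gauss)
    show ?thesis unfolding fourier_energy_def by measurable
  qed
  have Hm: "(\<lambda>\<theta>. L2_mass w' (\<lambda>x. fourier (\<lambda>t. H (x, t)) (real (Suc n) * \<theta>))) \<in> borel_measurable gauss" for n
  proof -
    have "(\<lambda>(\<theta>, x). (x, real (Suc n) * \<theta>)) \<in> gauss \<Otimes>\<^sub>M lborel \<rightarrow>\<^sub>M lborel \<Otimes>\<^sub>M borel" by measurable
    from measurable_compose[OF this fourier_measurable[OF H]]
    have [measurable]: "(\<lambda>(\<theta>, x). fourier (\<lambda>t. H (x, t)) (real (Suc n) * \<theta>)) \<in> borel_measurable (gauss \<Otimes>\<^sub>M lborel)"
      by (simp add: case_prod_beta')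
    show ?thesis unfolding L2_mass_lborel by measurable
  qed
  have "L2_mass (\<lambda>(x, t). w x) U =
      (\<integral>\<^sup>+x. liminf (\<lambda>n. fourier_energy n (\<lambda>t. U (x, t)) * w x) \<partial>lborel)"
    unfolding L2_mass_prod[OF U assms(3)]
  proof (rule nn_integral_cong_AE, use fin secU in eventually_elim)
    case (elim x)
    have "(\<lambda>n. fourier_energy n (\<lambda>t. U (x, t)) * w x) \<longlonglongrightarrow>
        (\<integral>\<^sup>+t. ennreal ((cmod (U (x, t)))\<^sup>2) \<partial>lborel) * w x"
      using elim ennreal_tendsto_cmult[OF _ fourier_energy_tendsto[of "\<lambda>t. U (x, t)"], of "w x"]
      by (simp add: mult.commute)
    from lim_imp_Liminf[OF _ this] show ?case by simp
  qed
  also have "\<dots> \<le> liminf (\<lambda>n. \<integral>\<^sup>+x. fourier_energy n (\<lambda>t. U (x, t)) * w x \<partial>lborel)"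
    by (intro nn_integral_liminf Um)
  also have "\<dots> \<le> limsup (\<lambda>n. \<integral>\<^sup>+x. fourier_energy n (\<lambda>t. U (x, t)) * w x \<partial>lborel)"
    by (rule Liminf_le_Limsup) simp
  also have "\<dots> \<le> c * L2_mass (\<lambda>(x, t). w' x) H"
  proof (rule Limsup_bounded, rule always_eventually, rule allI)
    fix n
    let ?k = "ennreal (real (Suc n) / sqrt (2 * pi))"
    have "(\<integral>\<^sup>+x. fourier_energy n (\<lambda>t. U (x, t)) * w x \<partial>lborel) \<le>
        ?k * (\<integral>\<^sup>+\<theta>. c * L2_mass w' (\<lambda>x. fourier (\<lambda>t. H (x, t)) (real (Suc n) * \<theta>)) \<partial>gauss)"
      unfolding nn_integral_fourier_energy[OF U assms(3)]
      by (intro mult_left_mono nn_integral_mono le) simp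
    also have "\<dots> = c * (\<integral>\<^sup>+x. fourier_energy n (\<lambda>t. H (x, t)) * w' x \<partial>lborel)"
      unfolding nn_integral_fourier_energy[OF H assms(4)]
      using Hm by (simp add: nn_integral_cmult mult.left_commute)
    also have "\<dots> \<le> c * L2_mass (\<lambda>(x, t). w' x) H"
      unfolding L2_mass_prod[OF H assms(4)]
    proof (rule mult_left_mono[OF nn_integral_mono_AE], use secH in eventually_elim)
      case (elim x)
      then show ?case by (intro mult_right_mono fourier_energy_le) auto
    qed simp
    finally show "(\<integral>\<^sup>+x. fourier_energy n (\<lambda>t. U (x, t)) * w x \<partial>lborel) \<le> c * L2_mass (\<lambda>(x, t). w' x) H" .
  qed
  finally show ?thesis .
qed

section \<open>The cutoff estimate\<close>

lemma absw_measurable: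
  assumes "V \<in> borel_measurable lebesgue"
  shows "absw V \<in> borel_measurable lebesgue" "(\<lambda>x. inverse (absw V x)) \<in> borel_measurable lebesgue"
proof -
  show [measurable]: "absw V \<in> borel_measurable lebesgue"
    using assms unfolding absw_def[abs_def] by measurable
  show "(\<lambda>x. inverse (absw V x)) \<in> borel_measurable lebesgue" by measurable
qed

text \<open>\<open>L2_norm\<close> passes through \<open>enn2real\<close>, which sends infinity to
  0. Membership of \<open>f\<close> and \<open>g\<close> in their weighted spaces makes the return
  to \<open>ennreal\<close> faithful.\<close>

lemma resolvent_estimate_mass:
  assumes est: "resolvent_estimate V q" and q: "0 \<le> q" and z: "z \<notin> \<real>"
    and f: "f \<in> L2 (\<lambda>_. 1) \<inter> L2 (\<lambda>x. inverse (absw V x))" and g: "is_resolvent z f g"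
  shows "L2_mass (absw V) g \<le> ennreal (q\<^sup>2) * L2_mass (\<lambda>x. inverse (absw V x)) f"
proof -
  let ?a = "enn2real (L2_mass (absw V) g)" and ?b = "enn2real (L2_mass (\<lambda>x. inverse (absw V x)) f)"
  have gV: "g \<in> L2 (absw V)" and le: "sqrt ?a \<le> q * sqrt ?b"
    using est z f g unfolding resolvent_estimate_def L2_norm_def by blast+
  have "?a = (sqrt ?a)\<^sup>2" by simp
  also have "\<dots> \<le> (q * sqrt ?b)\<^sup>2" using le by (intro power_mono) auto
  also have "\<dots> = q\<^sup>2 * ?b" by (simp add: power_mult_distrib)
  finally have "ennreal ?a \<le> ennreal (q\<^sup>2) * ennreal ?b"
    by (simp add: ennreal_mult[symmetric] ennreal_leI)
  then show ?thesis using gV f by (simp add: L2_def)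
qed

definition modulated :: "(real \<Rightarrow> real) \<Rightarrow> real \<Rightarrow> real \<Rightarrow> complex" where
  "modulated \<eta> \<tau> t = complex_of_real (\<eta> t) * cis (- (\<tau> * t))"

lemma complex_test_modulated:
  assumes "test_function \<eta>"
  shows "complex_test (modulated \<eta> \<tau>)"
proof -
  have "test_function (\<lambda>t. cos (\<tau> * t) * \<eta> t)" "test_function (\<lambda>t. - 1 * (sin (\<tau> * t) * \<eta> t))"
    by (intro test_function_mult assms Ck_cos Ck_sin Ck_const)+
  then show ?thesis by (simp add: complex_test_def modulated_def mult.commute)
qed

text \<open>The second term reproduces the kernel with the factor -i \<tau>; through it the time
  derivative becomes the spectral parameter. The first is the error caused by the cutoff.\<close>

lemma complex_deriv_modulated:
  assumes "test_function \<eta>"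
  shows "complex_deriv (modulated \<eta> \<tau>) t =
    modulated (\<lambda>t. frechet_derivative \<eta> (at t) 1) \<tau> t - \<i> * \<tau> * modulated \<eta> \<tau> t"
proof -
  note D = test_functionD(4)[OF assms, of t]
  have "((\<lambda>t. \<eta> t * cos (\<tau> * t)) has_derivative
      (\<lambda>h. \<eta> t * (- sin (\<tau> * t) * (\<tau> * h)) + frechet_derivative \<eta> (at t) h * cos (\<tau> * t))) (at t)"
    by (rule has_derivative_mult[OF D]) (auto intro!: derivative_eq_intros)
  note R = frechet_derivative_at[OF this, symmetric]
  have "((\<lambda>t. - (\<eta> t * sin (\<tau> * t))) has_derivative
      (\<lambda>h. - (\<eta> t * (cos (\<tau> * t) * (\<tau> * h)) + frechet_derivative \<eta> (at t) h * sin (\<tau> * t)))) (at t)"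
    by (rule has_derivative_minus, rule has_derivative_mult[OF D]) (auto intro!: derivative_eq_intros)
  note I = frechet_derivative_at[OF this, symmetric]
  show ?thesis
    by (simp add: complex_deriv_def modulated_def complex_eq_iff R I)
qed

lemma slice_modulated: "slice (modulated \<eta> \<tau>) f x = fourier (\<lambda>t. complex_of_real (\<eta> t) * f (x, t)) \<tau>"
  by (simp add: slice_def modulated_def fourier_def mult_ac)

text \<open>Fubini arguments on the product need a Borel weight, and V is only Lebesgue measurable.
  Changing |V| on a null set of x changes the space-time weight on a null cylinder.\<close>

lemma cal_L2_eq:
  assumes "V \<in> borel_measurable lebesgue"
  obtains w :: "'a::euclidean_space \<Rightarrow> ennreal"
    where "w \<in> borel_measurable borel" "AE x in lborel. absw V x = w x"
      "cal_L2 V = L2 (\<lambda>_. 1) \<inter> L2 (\<lambda>(x, t). inverse (w x))"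
proof -
  obtain w where w: "w \<in> borel_measurable borel" and eq: "AE x in lborel. absw V x = w x"
    by (rule lebesgue_weight_representative[OF absw_measurable(1)[OF assms]]) blast
  have "AE y in lborel. (case y of (x, t::real) \<Rightarrow> inverse (absw V x)) = (case y of (x, t) \<Rightarrow> inverse (w x))"
    using AE_lborel_fst[OF eq] by (simp add: case_prod_beta') (auto elim: eventually_mono)
  then have "L2_mass (\<lambda>(x, t). inverse (absw V x)) f = L2_mass (\<lambda>(x, t). inverse (w x)) f"
    for f :: "'a \<times> real \<Rightarrow> complex"
    by (rule L2_mass_cong_AE[OF AE_I2[OF refl]])
  then have "cal_L2 V = L2 (\<lambda>_. 1) \<inter> L2 (\<lambda>(x, t). inverse (w x))"
    by (simp add: cal_L2_def L2_def)
  with w eq show ?thesis by (rule that)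
qed

lemma borel_measurable_fst_lebesgue:
  fixes w :: "'a::euclidean_space \<Rightarrow> ennreal"
  assumes "w \<in> borel_measurable borel"
  shows "(\<lambda>(x, t::real). w x) \<in> borel_measurable lebesgue"
proof -
  have "(\<lambda>(x, t::real). w x) \<in> borel_measurable (borel \<Otimes>\<^sub>M borel)"
    using assms by measurable
  then show ?thesis by (simp add: borel_prod measurable_completion)
qed

lemma L2_fun_cmult: "L2_fun g \<Longrightarrow> L2_fun (\<lambda>t. c * g t)"
  by (auto simp: L2_fun_def norm_mult power_mult_distrib)

lemma L2_fun_add:
  assumes "L2_fun f" "L2_fun g"
  shows "L2_fun (\<lambda>t. f t + g t)"
proof -
  have [measurable]: "f \<in> borel_measurable borel" "g \<in> borel_measurable borel"
    using assms by (auto simp: L2_fun_def)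
  have "integrable lborel (\<lambda>t. (cmod (f t + g t))\<^sup>2)"
  proof (rule Bochner_Integration.integrable_bound)
    show "integrable lborel (\<lambda>t. (1 + 1) * (cmod (f t))\<^sup>2 + (1 + 1 / 1) * (cmod (g t))\<^sup>2)"
      using assms unfolding L2_fun_def
      by (intro Bochner_Integration.integrable_add integrable_mult_right) auto
    show "AE t in lborel. norm ((cmod (f t + g t))\<^sup>2) \<le>
        norm ((1 + 1) * (cmod (f t))\<^sup>2 + (1 + 1 / 1) * (cmod (g t))\<^sup>2)"
      using norm_add_square_le[of 1] by auto
  qed measurable
  then show ?thesis by (simp add: L2_fun_def)
qed

lemma L2_fun_test_mult:
  assumes \<eta>: "test_function \<eta>" and g: "L2_fun g"
  shows "L2_fun (\<lambda>t. complex_of_real (\<eta> t) * g t)" "integrable lborel (\<lambda>t. complex_of_real (\<eta> t) * g t)"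
proof -
  have [measurable]: "g \<in> borel_measurable borel" "\<eta> \<in> borel_measurable borel"
    using g test_function_measurable[OF \<eta>] by (auto simp: L2_fun_def)
  have "L2_fun (\<lambda>t. complex_of_real (\<eta> t))"
    using complex_test_L2_fun[OF complex_test_modulated[OF \<eta>, of 0]] by (simp add: modulated_def[abs_def])
  then show "integrable lborel (\<lambda>t. complex_of_real (\<eta> t) * g t)"
    using g by (rule L2_fun_mult_integrable)
  obtain B where B: "\<And>t. \<bar>\<eta> t\<bar> \<le> B" by (rule test_function_bounded[OF \<eta>]) blast
  have "integrable lborel (\<lambda>t. (cmod (complex_of_real (\<eta> t) * g t))\<^sup>2)"
  proof (rule Bochner_Integration.integrable_bound)
    show "integrable lborel (\<lambda>t. B\<^sup>2 * (cmod (g t))\<^sup>2)" using g by (simp add: L2_fun_def)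
    have "(\<eta> t)\<^sup>2 \<le> B\<^sup>2" for t using power_mono[OF B[of t] abs_ge_zero, of 2] by simp
    then show "AE t in lborel. norm ((cmod (complex_of_real (\<eta> t) * g t))\<^sup>2) \<le> norm (B\<^sup>2 * (cmod (g t))\<^sup>2)"
      by (auto simp: norm_mult power_mult_distrib intro!: mult_right_mono)
  qed measurable
  then show "L2_fun (\<lambda>t. complex_of_real (\<eta> t) * g t)" by (simp add: L2_fun_def)
qed

text \<open>Borel representatives of u and its derivatives, so that sections in t are measurable and
  Fubini applies to \<open>lborel\<close>. Mixed second derivatives \<open>uxx b c\<close> are
  carried because the domain of the resolvent, \<open>sobolev 2 Basis\<close>, asks for
  them.\<close>

locale solution_data =
  fixes V :: "'a::euclidean_space \<Rightarrow> complex" and q :: real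
    and u ut :: "'a \<times> real \<Rightarrow> complex" and ux :: "'a \<Rightarrow> 'a \<times> real \<Rightarrow> complex"
    and uxx :: "'a \<Rightarrow> 'a \<Rightarrow> 'a \<times> real \<Rightarrow> complex"
  assumes V: "V \<in> borel_measurable lebesgue" and est: "resolvent_estimate V q" and q: "0 \<le> q"
    and borel: "u \<in> borel_measurable borel" "ut \<in> borel_measurable borel"
      "\<And>b. b \<in> Basis \<Longrightarrow> ux b \<in> borel_measurable borel"
      "\<And>b c. b \<in> Basis \<Longrightarrow> c \<in> Basis \<Longrightarrow> uxx b c \<in> borel_measurable borel"
    and cal: "u \<in> cal_L2 V" "ut \<in> cal_L2 V" "\<And>b. b \<in> Basis \<Longrightarrow> ux b \<in> cal_L2 V"
      "\<And>b c. b \<in> Basis \<Longrightarrow> c \<in> Basis \<Longrightarrow> uxx b c \<in> cal_L2 V"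
    and deriv: "has_weak_deriv u (0, 1) ut"
      "\<And>b. b \<in> Basis \<Longrightarrow> has_weak_deriv u (b, 0) (ux b)"
      "\<And>b c. b \<in> Basis \<Longrightarrow> c \<in> Basis \<Longrightarrow> has_weak_deriv (ux b) (c, 0) (uxx b c)"
begin

definition F :: "'a \<times> real \<Rightarrow> complex" where
  "F y = \<i> * ut y + (\<Sum>b\<in>Basis. uxx b b y)"

lemma F_borel: "F \<in> borel_measurable borel"
proof -
  note [measurable] = borel(2) borel(4)
  show ?thesis unfolding F_def by measurable
qed

lemma F_cal: "F \<in> cal_L2 V"
proof (rule cal_L2_eq[OF V])
  fix w :: "'a \<Rightarrow> ennreal"
  assume w[measurable]: "w \<in> borel_measurable borel"
    and eq: "cal_L2 V = L2 (\<lambda>_. 1) \<inter> L2 (\<lambda>(x, t). inverse (w x))"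
  have m: "(\<lambda>(x, t::real). inverse (w x)) \<in> borel_measurable lebesgue"
    by (rule borel_measurable_fst_lebesgue) measurable
  show ?thesis
    using cal m unfolding eq F_def[abs_def] by (auto intro!: L2_add L2_cmult L2_sum)
qed

lemma slice_L2:
  assumes "f \<in> borel_measurable borel" "f \<in> cal_L2 V" "complex_test \<psi>"
  shows "slice \<psi> f \<in> L2 (\<lambda>_. 1) \<inter> L2 (\<lambda>x. inverse (absw V x))"
proof -
  have "slice \<psi> f \<in> borel_measurable lebesgue"
    using slice_measurable[OF complex_test_measurable[OF assms(3)] assms(1)]
    by (simp add: measurable_completion)
  moreover have "f \<in> L2 (\<lambda>_. 1)" using assms(2) by (simp add: cal_L2_def)
  moreover have "L2_mass (\<lambda>_. 1) (slice \<psi> f) < \<infinity>"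
    using assms(2) by (intro slice_L2_mass_finite assms complex_test_L2_fun)
      (auto simp: cal_L2_def L2_def case_prod_beta')
  moreover have "L2_mass (\<lambda>x. inverse (absw V x)) (slice \<psi> f) < \<infinity>"
    using assms(2) absw_measurable[OF V]
    by (intro slice_L2_mass_finite assms complex_test_L2_fun) (auto simp: cal_L2_def L2_def)
  ultimately show ?thesis by (simp add: L2_def)
qed

lemma sections:
  "AE x in lborel. L2_fun (\<lambda>t. u (x, t)) \<and> L2_fun (\<lambda>t. ut (x, t)) \<and>
    (\<forall>b\<in>Basis. L2_fun (\<lambda>t. uxx b b (x, t)))"
proof -
  have "AE x in lborel. \<forall>b\<in>Basis. L2_fun (\<lambda>t. uxx b b (x, t))"
    using borel(4) cal(4) by (intro AE_finite_allI L2_sections) (auto simp: cal_L2_def)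
  moreover have "AE x in lborel. L2_fun (\<lambda>t. u (x, t))"
    using borel(1) cal(1) by (intro L2_sections) (auto simp: cal_L2_def)
  moreover have "AE x in lborel. L2_fun (\<lambda>t. ut (x, t))"
    using borel(2) cal(2) by (intro L2_sections) (auto simp: cal_L2_def)
  ultimately show ?thesis by eventually_elim simp
qed

text \<open>The Fourier transform in time, at frequency \<tau>, of \<eta> F + i \<eta>' u.\<close>

definition source :: "(real \<Rightarrow> real) \<Rightarrow> real \<Rightarrow> 'a \<Rightarrow> complex" where
  "source \<eta> \<tau> x = slice (modulated \<eta> \<tau>) F x +
     \<i> * slice (modulated (\<lambda>t. frechet_derivative \<eta> (at t) 1) \<tau>) u x"

lemma slice_F:
  assumes "L2_fun \<psi>"
  shows "AE x in lborel. slice \<psi> F x = \<i> * slice \<psi> ut x + (\<Sum>b\<in>Basis. slice \<psi> (uxx b b) x)"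
  using sections
proof eventually_elim
  case (elim x)
  have I: "integrable lborel (\<lambda>t. \<psi> t * ut (x, t))"
    "\<And>b. b \<in> Basis \<Longrightarrow> integrable lborel (\<lambda>t. \<psi> t * uxx b b (x, t))"
    using elim assms by (auto intro: L2_fun_mult_integrable)
  have "slice \<psi> F x = (LINT t|lborel. \<i> * (\<psi> t * ut (x, t)) + (\<Sum>b\<in>Basis. \<psi> t * uxx b b (x, t)))"
    unfolding slice_def F_def
    by (intro Bochner_Integration.integral_cong) (auto simp: algebra_simps sum_distrib_left)
  also have "\<dots> = (LINT t|lborel. \<i> * (\<psi> t * ut (x, t))) + (LINT t|lborel. (\<Sum>b\<in>Basis. \<psi> t * uxx b b (x, t)))"
    using I by (intro Bochner_Integration.integral_add integrable_mult_right Bochner_Integration.integrable_sum) auto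
  also have "(LINT t|lborel. (\<Sum>b\<in>Basis. \<psi> t * uxx b b (x, t))) = (\<Sum>b\<in>Basis. slice \<psi> (uxx b b) x)"
    unfolding slice_def using I by (intro Bochner_Integration.integral_sum) auto
  finally show ?case by (simp add: slice_def)
qed

lemma source_L2:
  assumes \<eta>: "test_function \<eta>"
  shows "source \<eta> \<tau> \<in> L2 (\<lambda>_. 1) \<inter> L2 (\<lambda>x. inverse (absw V x))"
proof -
  have \<eta>': "test_function (\<lambda>t. frechet_derivative \<eta> (at t) 1)"
    using \<eta> by (intro test_function_deriv) auto
  note ct = complex_test_modulated[OF \<eta>, of \<tau>] complex_test_modulated[OF \<eta>', of \<tau>]
  show ?thesis
    unfolding source_def[abs_def]
    using slice_L2[OF F_borel F_cal ct(1)] slice_L2[OF borel(1) cal(1) ct(2)] absw_measurable[OF V]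
    by (auto intro!: L2_add L2_cmult)
qed

lemma slice_is_resolvent:
  assumes \<eta>: "test_function \<eta>"
  shows "is_resolvent (Complex (- \<tau>) \<delta>) (\<lambda>x. - (source \<eta> \<tau> x + \<i> * \<delta> * slice (modulated \<eta> \<tau>) u x))
    (slice (modulated \<eta> \<tau>) u)"
proof -
  let ?\<psi> = "modulated \<eta> \<tau>" and ?\<eta>' = "\<lambda>t. frechet_derivative \<eta> (at t) 1"
  let ?g = "slice ?\<psi> u"
  have \<eta>': "test_function ?\<eta>'" using \<eta> by (intro test_function_deriv) auto
  note ct = complex_test_modulated[OF \<eta>, of \<tau>] complex_test_modulated[OF \<eta>', of \<tau>]
  have d1: "has_weak_deriv ?g b (slice ?\<psi> (ux b))" if "b \<in> Basis" for b
    using that by (intro slice_has_weak_deriv deriv borel ct)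
  have d2: "has_weak_deriv (slice ?\<psi> (ux b)) c (slice ?\<psi> (uxx b c))" if "b \<in> Basis" "c \<in> Basis" for b c
    using that by (intro slice_has_weak_deriv deriv borel ct)
  have in_L2: "?g \<in> L2 (\<lambda>_. 1)" "\<And>b. b \<in> Basis \<Longrightarrow> slice ?\<psi> (ux b) \<in> L2 (\<lambda>_. 1)"
    "\<And>b c. b \<in> Basis \<Longrightarrow> c \<in> Basis \<Longrightarrow> slice ?\<psi> (uxx b c) \<in> L2 (\<lambda>_. 1)"
    using slice_L2[OF borel(1) cal(1) ct(1)] slice_L2[OF borel(3) cal(3) ct(1)]
      slice_L2[OF borel(4) cal(4) ct(1)] by auto
  have sob: "?g \<in> sobolev 2 Basis (L2 (\<lambda>_. 1))"
    unfolding numeral_2_eq_2 sobolev.simps using in_L2 d1 d2 by blast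
  have "AE x in lebesgue. \<forall>b\<in>Basis. weak_deriv b (weak_deriv b ?g) x = slice ?\<psi> (uxx b b) x"
    by (intro AE_finite_allI finite_Basis weak_deriv_weak_deriv_AE[OF d1 d2])
  moreover have "AE x in lebesgue. slice (complex_deriv ?\<psi>) u x + slice ?\<psi> ut x = 0"
    by (intro slice_time_deriv deriv borel ct)
  moreover have "AE x in lebesgue. slice (complex_deriv ?\<psi>) u x =
      slice (modulated ?\<eta>' \<tau>) u x - \<i> * \<tau> * slice ?\<psi> u x"
  proof (rule AE_completion, use sections in eventually_elim)
    case (elim x)
    then have "integrable lborel (\<lambda>t. modulated ?\<eta>' \<tau> t * u (x, t))"
      "integrable lborel (\<lambda>t. ?\<psi> t * u (x, t))"
      using ct[THEN complex_test_L2_fun] by (auto intro: L2_fun_mult_integrable)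
    then have "(LINT t|lborel. modulated ?\<eta>' \<tau> t * u (x, t) - \<i> * \<tau> * (?\<psi> t * u (x, t))) =
        slice (modulated ?\<eta>' \<tau>) u x - \<i> * \<tau> * slice ?\<psi> u x"
      unfolding slice_def by (subst Bochner_Integration.integral_diff) auto
    moreover have "slice (complex_deriv ?\<psi>) u x =
        (LINT t|lborel. modulated ?\<eta>' \<tau> t * u (x, t) - \<i> * \<tau> * (?\<psi> t * u (x, t)))"
      unfolding slice_def complex_deriv_modulated[OF \<eta>]
      by (intro Bochner_Integration.integral_cong) (auto simp: algebra_simps)
    ultimately show ?case by simp
  qed
  moreover have "AE x in lebesgue. slice ?\<psi> F x = \<i> * slice ?\<psi> ut x + (\<Sum>b\<in>Basis. slice ?\<psi> (uxx b b) x)"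
    by (intro AE_completion slice_F complex_test_L2_fun ct)
  ultimately have "AE x in lebesgue. - laplacian_dirs Basis ?g x - Complex (- \<tau>) \<delta> * ?g x =
      - (source \<eta> \<tau> x + \<i> * \<delta> * ?g x)"
  proof eventually_elim
    case (elim x)
    have lap: "laplacian_dirs Basis ?g x = (\<Sum>b\<in>Basis. slice ?\<psi> (uxx b b) x)"
      unfolding laplacian_dirs_def using elim(1) by simp
    have ut: "slice ?\<psi> ut x = - (slice (modulated ?\<eta>' \<tau>) u x - \<i> * \<tau> * ?g x)"
      using elim(2,3) by (simp add: add_eq_0_iff)
    have F: "slice ?\<psi> F x = \<i> * slice ?\<psi> ut x + laplacian_dirs Basis ?g x"
      using elim(4) lap by simp
    have z: "Complex (- \<tau>) \<delta> = - \<tau> + \<i> * \<delta>" by (simp add: complex_eq_iff)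
    have ii: "\<i> * (\<i> * y) = - y" for y :: complex by (simp flip: mult.assoc)
    show ?case unfolding source_def F ut z by (simp add: algebra_simps ii)
  qed
  with sob show ?thesis unfolding is_resolvent_def by blast
qed

text \<open>Neither the slice nor the constant depends on \<delta>, so \<delta> may tend to 0 in the
  bound for a fixed \<theta>.\<close>

lemma slice_estimate:
  assumes \<eta>: "test_function \<eta>" and \<theta>: "\<theta> > 0"
  shows "L2_mass (absw V) (slice (modulated \<eta> \<tau>) u) \<le>
    ennreal (q\<^sup>2 * (1 + \<theta>)) * L2_mass (\<lambda>x. inverse (absw V x)) (source \<eta> \<tau>)"
proof -
  let ?g = "slice (modulated \<eta> \<tau>) u" and ?iw = "\<lambda>x. inverse (absw V x)"
  have g: "?g \<in> L2 (\<lambda>_. 1) \<inter> L2 ?iw"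
    by (intro slice_L2 borel cal complex_test_modulated \<eta>)
  note s = source_L2[OF \<eta>, of \<tau>]
  have meas: "source \<eta> \<tau> \<in> borel_measurable lebesgue" "?g \<in> borel_measurable lebesgue"
    using g s by (auto simp: L2_def)
  let ?R = "\<lambda>d. ennreal (q\<^sup>2 * (1 + \<theta>)) * L2_mass ?iw (source \<eta> \<tau>) +
      (ennreal (q\<^sup>2 * (1 + 1 / \<theta>)) * L2_mass ?iw ?g) * ennreal (d\<^sup>2)"
  have bound: "L2_mass (absw V) ?g \<le> ?R \<delta>" if "\<delta> > 0" for \<delta>
  proof -
    let ?h = "\<lambda>x. source \<eta> \<tau> x + \<i> * \<delta> * ?g x"
    have h: "?h \<in> L2 (\<lambda>_. 1) \<inter> L2 ?iw"
      using g s absw_measurable[OF V] by (auto intro!: L2_add L2_cmult)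
    have h': "(\<lambda>x. - ?h x) \<in> L2 (\<lambda>_. 1) \<inter> L2 ?iw"
      using h L2_cmult[of ?h "\<lambda>_. 1" "- 1"] L2_cmult[of ?h ?iw "- 1"] absw_measurable[OF V] by auto
    have "Complex (- \<tau>) \<delta> \<notin> \<real>" using that by (simp add: complex_is_Real_iff)
    from resolvent_estimate_mass[OF est q this h' slice_is_resolvent[OF \<eta>]]
    have "L2_mass (absw V) ?g \<le> ennreal (q\<^sup>2) * L2_mass ?iw (\<lambda>x. - ?h x)" .
    also have "L2_mass ?iw (\<lambda>x. - ?h x) = L2_mass ?iw ?h"
      unfolding L2_mass_def norm_minus_cancel ..
    also have "\<dots> \<le> ennreal (1 + \<theta>) * L2_mass ?iw (source \<eta> \<tau>) +
        ennreal (1 + 1 / \<theta>) * L2_mass ?iw (\<lambda>x. \<i> * \<delta> * ?g x)"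
      using meas absw_measurable[OF V] by (intro L2_mass_add_le \<theta>) auto
    also have "L2_mass ?iw (\<lambda>x. \<i> * \<delta> * ?g x) = ennreal (\<delta>\<^sup>2) * L2_mass ?iw ?g"
      using meas absw_measurable[OF V] by (subst L2_mass_cmult) (auto simp: norm_mult)
    finally have "L2_mass (absw V) ?g \<le> ennreal (q\<^sup>2) * (ennreal (1 + \<theta>) * L2_mass ?iw (source \<eta> \<tau>) +
        ennreal (1 + 1 / \<theta>) * (ennreal (\<delta>\<^sup>2) * L2_mass ?iw ?g))"
      by (simp add: mult_left_mono)
    also have "\<dots> = ?R \<delta>"
      using \<theta> by (simp add: ennreal_mult distrib_left mult_ac del: ennreal_plus)
    finally show ?thesis .
  qed
  \<comment> \<open>The coefficient of \<delta>^2 is finite because the slice of u lies in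
    L^2(1/|V|); in \<open>ennreal\<close> an infinite coefficient would prevent passage to the
    limit.\<close>
  have "(\<lambda>n. ?R (inverse (real (Suc n)))) \<longlonglongrightarrow> ?R 0"
  proof (intro tendsto_add tendsto_const ennreal_tendsto_cmult tendsto_ennrealI tendsto_power
      LIMSEQ_inverse_real_of_nat)
    show "ennreal (q\<^sup>2 * (1 + 1 / \<theta>)) * L2_mass ?iw ?g < top"
      using g by (auto simp: L2_def ennreal_mult_less_top)
  qed
  then have "L2_mass (absw V) ?g \<le> ?R 0"
    by (rule LIMSEQ_le_const) (use bound in auto)
  then show ?thesis by simp
qed


lemma sections_F: "AE x in lborel. L2_fun (\<lambda>t. F (x, t))"
  using F_cal by (intro L2_sections F_borel) (auto simp: cal_L2_def)

text \<open>\<open>slice_estimate\<close> has the same constant at every frequency, which is the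
  input that \<open>fourier_transfer\<close> requires. The cutoff makes almost every time section
  integrable as well as square integrable.\<close>

lemma cutoff_estimate:
  assumes \<eta>: "test_function \<eta>" and \<theta>: "\<theta> > 0"
    and w[measurable]: "w \<in> borel_measurable borel" and eq: "AE x in lborel. absw V x = w x"
  shows "L2_mass (\<lambda>(x, t). w x) (\<lambda>(x, t). \<eta> t * u (x, t)) \<le> ennreal (q\<^sup>2 * (1 + \<theta>)) *
    L2_mass (\<lambda>(x, t). inverse (w x))
      (\<lambda>(x, t). \<eta> t * F (x, t) + \<i> * (complex_of_real (frechet_derivative \<eta> (at t) 1) * u (x, t)))"
proof -
  let ?\<eta>' = "\<lambda>t. frechet_derivative \<eta> (at t) 1"
  have \<eta>': "test_function ?\<eta>'" using \<eta> by (intro test_function_deriv) auto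
  note [measurable] = borel_measurable_pair[OF borel(1)] borel_measurable_pair[OF F_borel]
    test_function_measurable[OF \<eta>] test_function_measurable[OF \<eta>']
  have U: "(\<lambda>(x, t). \<eta> t * u (x, t)) \<in> borel_measurable borel"
    and H: "(\<lambda>(x, t). \<eta> t * F (x, t) + \<i> * (?\<eta>' t * u (x, t))) \<in> borel_measurable borel"
    unfolding borel_prod[symmetric] by measurable
  have secs: "AE x in lborel. L2_fun (\<lambda>t. u (x, t)) \<and> L2_fun (\<lambda>t. F (x, t))"
    using sections sections_F by eventually_elim simp
  show ?thesis
  proof (rule fourier_transfer[OF U H w])
    show "(\<lambda>x. inverse (w x)) \<in> borel_measurable borel" by measurable
    show "AE x in lborel. w x < \<infinity>" using eq by eventually_elim (metis absw_def ennreal_less_top infinity_ennreal_def)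
    show "AE x in lborel. L2_fun (\<lambda>t. case (x, t) of (x, t) \<Rightarrow> \<eta> t * u (x, t)) \<and>
        integrable lborel (\<lambda>t. case (x, t) of (x, t) \<Rightarrow> \<eta> t * u (x, t))"
      using secs by eventually_elim (simp add: L2_fun_test_mult \<eta>)
    show "AE x in lborel.
        L2_fun (\<lambda>t. case (x, t) of (x, t) \<Rightarrow> \<eta> t * F (x, t) + \<i> * (?\<eta>' t * u (x, t))) \<and>
        integrable lborel (\<lambda>t. case (x, t) of (x, t) \<Rightarrow> \<eta> t * F (x, t) + \<i> * (?\<eta>' t * u (x, t)))"
      using secs by eventually_elim (auto intro!: L2_fun_add L2_fun_cmult L2_fun_test_mult \<eta> \<eta>')
    fix \<tau>
    have "AE x in lborel. fourier (\<lambda>t. \<eta> t * F (x, t) + \<i> * (?\<eta>' t * u (x, t))) \<tau> = source \<eta> \<tau> x"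
      using secs
    proof eventually_elim
      case (elim x)
      have ct: "L2_fun (modulated \<eta> \<tau>)" "L2_fun (modulated ?\<eta>' \<tau>)"
        by (intro complex_test_L2_fun complex_test_modulated \<eta> \<eta>')+
      have I: "integrable lborel (\<lambda>t. modulated \<eta> \<tau> t * F (x, t))"
        "integrable lborel (\<lambda>t. modulated ?\<eta>' \<tau> t * u (x, t))"
        using elim by (auto intro: L2_fun_mult_integrable ct)
      have "fourier (\<lambda>t. \<eta> t * F (x, t) + \<i> * (?\<eta>' t * u (x, t))) \<tau> =
          (LINT t|lborel. modulated \<eta> \<tau> t * F (x, t) + \<i> * (modulated ?\<eta>' \<tau> t * u (x, t)))"
        unfolding fourier_def modulated_def
        by (intro Bochner_Integration.integral_cong) (auto simp: algebra_simps)
      also have "\<dots> = source \<eta> \<tau> x"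
        unfolding source_def slice_def using I by simp
      finally show ?case .
    qed
    then have "L2_mass (\<lambda>x. inverse (w x))
        (\<lambda>x. fourier (\<lambda>t. \<eta> t * F (x, t) + \<i> * (?\<eta>' t * u (x, t))) \<tau>) =
        L2_mass (\<lambda>x. inverse (absw V x)) (source \<eta> \<tau>)"
      using eq by (intro L2_mass_cong_AE) (auto elim: eventually_mono)
    moreover have "L2_mass w (\<lambda>x. fourier (\<lambda>t. \<eta> t * u (x, t)) \<tau>) = L2_mass (absw V) (slice (modulated \<eta> \<tau>) u)"
      using eq unfolding slice_modulated by (intro L2_mass_cong_AE) (auto elim: eventually_mono)
    ultimately show "L2_mass w (\<lambda>x. fourier (\<lambda>t. case (x, t) of (x, t) \<Rightarrow> \<eta> t * u (x, t)) \<tau>) \<le>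
        ennreal (q\<^sup>2 * (1 + \<theta>)) * L2_mass (\<lambda>x. inverse (w x))
          (\<lambda>x. fourier (\<lambda>t. case (x, t) of (x, t) \<Rightarrow> \<eta> t * F (x, t) + \<i> * (?\<eta>' t * u (x, t))) \<tau>)"
      using slice_estimate[OF \<eta> \<theta>, of \<tau>] by simp
  qed
qed

end

section \<open>Vanishing of solutions\<close>

lemma test_function_scale:
  fixes \<eta> :: "real \<Rightarrow> real"
  assumes "test_function \<eta>" "c \<noteq> 0"
  shows "test_function (\<lambda>t. \<eta> (c * t))"
proof (rule test_functionI)
  have "Ck k (\<lambda>t. \<eta> (c * t + 0))" for k
    by (intro Ck_affine test_functionD(1)[OF assms(1)] bounded_linear_mult_right)
  then show "Ck k (\<lambda>t. \<eta> (c * t))" for k by simp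
  show "compact ((\<lambda>s. s / c) ` closure {t. \<eta> t \<noteq> 0})"
    using assms(2) by (intro compact_continuous_image test_functionD(2)[OF assms(1)] continuous_intros) auto
  show "t \<in> (\<lambda>s. s / c) ` closure {t. \<eta> t \<noteq> 0}" if "\<eta> (c * t) \<noteq> 0" for t
    using that assms(2) closure_subset[of "{t. \<eta> t \<noteq> 0}"] by (intro image_eqI[of _ _ "c * t"]) auto
qed

lemma test_function_scale_deriv:
  fixes \<eta> :: "real \<Rightarrow> real"
  assumes "test_function \<eta>"
  shows "frechet_derivative (\<lambda>t. \<eta> (c * t)) (at t) 1 = c * frechet_derivative \<eta> (at (c * t)) 1"
proof -
  note D = test_functionD(4)[OF assms, of "c * t"]
  have "((\<lambda>t. \<eta> (c * t)) has_derivative (\<lambda>h. frechet_derivative \<eta> (at (c * t)) (c * h))) (at t)"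
    by (rule has_derivative_compose[where f = "\<lambda>t. c * t" and g = \<eta>, OF _ D])
      (auto intro!: derivative_eq_intros)
  from frechet_derivative_at[OF this, symmetric]
  have "frechet_derivative (\<lambda>t. \<eta> (c * t)) (at t) 1 = frechet_derivative \<eta> (at (c * t)) (c *\<^sub>R 1)"
    by simp
  also have "\<dots> = c * frechet_derivative \<eta> (at (c * t)) 1"
    using linear_cmul[OF has_derivative_linear[OF D], of c 1] by simp
  finally show ?thesis .
qed

lemma L2_mass_mono_AE:
  assumes "AE x in lborel. ennreal ((cmod (f x))\<^sup>2) * w x \<le> c * (ennreal ((cmod (g x))\<^sup>2) * w' x)"
    and "g \<in> borel_measurable lebesgue" "w' \<in> borel_measurable lebesgue"
  shows "L2_mass w f \<le> c * L2_mass w' g"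
proof -
  have "L2_mass w f \<le> (\<integral>\<^sup>+x. c * (ennreal ((cmod (g x))\<^sup>2) * w' x) \<partial>lebesgue)"
    unfolding L2_mass_def using assms(1) by (intro nn_integral_mono_AE AE_completion)
  also have "\<dots> = c * L2_mass w' g"
    unfolding L2_mass_def using assms(2,3) by (intro nn_integral_cmult) measurable
  finally show ?thesis .
qed

context solution_data
begin

lemma vanishes:
  assumes q1: "q < 1" and nonzero: "AE x in lborel. absw V x \<noteq> 0"
    and ineq: "AE y in lborel. cmod (F y) \<le> cmod (V (fst y)) * cmod (u y)"
  shows "AE y in lborel. u y = 0"
proof (rule cal_L2_eq[OF V])
  fix w :: "'a \<Rightarrow> ennreal"
  assume w[measurable]: "w \<in> borel_measurable borel" and eq: "AE x in lborel. absw V x = w x"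
    and cal_eq: "cal_L2 V = L2 (\<lambda>_. 1) \<inter> L2 (\<lambda>(x, t). inverse (w x))"
  let ?w = "\<lambda>(x, t::real). w x" and ?iw = "\<lambda>(x, t::real). inverse (w x)"
  have [measurable]: "?w \<in> borel_measurable lebesgue" "?iw \<in> borel_measurable lebesgue"
    by (auto intro!: borel_measurable_fst_lebesgue)
  have [measurable]: "u \<in> borel_measurable lebesgue" "F \<in> borel_measurable lebesgue"
    using borel(1) F_borel by (simp_all add: measurable_completion)
  have wV: "AE y in lborel. ?w y = ennreal (cmod (V (fst y)))" and w0: "AE y in lborel. ?w y \<noteq> 0"
    using AE_lborel_fst[OF eq] AE_lborel_fst[OF nonzero]
    by (auto simp: absw_def case_prod_beta' elim: eventually_elim2 eventually_mono)
  \<comment> \<open>With this choice 1 - q (1 + \<theta>) = (1 - q) (2 - q) / 2 > 0. Of the two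
    factors 1 + \<theta> in \<open>\<kappa>\<close>, one stems from splitting off i \<delta> g in
    \<open>slice_estimate\<close>, the other from separating \<eta> F and \<eta>' u below.\<close>
  define \<theta> where "\<theta> = (1 - q) / 2"
  define \<kappa> where "\<kappa> = q\<^sup>2 * (1 + \<theta>) * (1 + \<theta>)"
  have \<theta>: "\<theta> > 0" using q1 by (simp add: \<theta>_def)
  have "\<kappa> = (q * (1 + \<theta>))\<^sup>2" by (simp add: \<kappa>_def power2_eq_square)
  moreover have "q * (1 + \<theta>) < 1"
  proof -
    have "0 < (1 - q) * (2 - q)" using q1 by simp
    then show ?thesis by (simp add: \<theta>_def field_simps)
  qed
  moreover have "0 \<le> q * (1 + \<theta>)" using q \<theta> by simp
  ultimately have \<kappa>: "0 \<le> \<kappa>" "\<kappa> < 1" by (simp_all add: power_less_one_iff)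
  define \<eta> where "\<eta> = bump 0 (- 1) 1"
  have \<eta>: "test_function \<eta>" unfolding \<eta>_def by (rule test_function_bump)
  have \<eta>': "test_function (\<lambda>t. frechet_derivative \<eta> (at t) 1)"
    using \<eta> by (intro test_function_deriv) auto
  obtain B where B: "B > 0" "\<And>t. \<bar>frechet_derivative \<eta> (at t) 1\<bar> \<le> B"
    by (rule test_function_bounded[OF \<eta>']) blast
  \<comment> \<open>Dilation by m + 1 keeps the cutoff bounded by 1 and divides its derivative by m
    + 1.\<close>
  define \<eta>m where "\<eta>m = (\<lambda>m t. \<eta> (inverse (real (Suc m)) * t))"
  have \<eta>m: "test_function (\<eta>m m)" for m
    unfolding \<eta>m_def by (intro test_function_scale \<eta>) simp
  let ?dm = "\<lambda>m t. frechet_derivative (\<eta>m m) (at t) 1"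
  have dm_test: "test_function (?dm m)" for m
    using \<eta>m by (intro test_function_deriv) auto
  have dm: "\<bar>?dm m t\<bar> \<le> inverse (real (Suc m)) * B" for m t
    unfolding \<eta>m_def test_function_scale_deriv[OF \<eta>] abs_mult using B(2) by (simp add: mult_left_mono)
  have \<eta>m1: "\<bar>\<eta>m m t\<bar> \<le> 1" for m t
    using bump_bounds by (simp add: \<eta>m_def \<eta>_def)
  define Um where "Um = (\<lambda>m (x, t). complex_of_real (\<eta>m m t) * u (x, t))"
  define Fm where "Fm = (\<lambda>m (x, t). complex_of_real (\<eta>m m t) * F (x, t))"
  define Rm where "Rm = (\<lambda>m (x, t). \<i> * (complex_of_real (?dm m t) * u (x, t)))"
  have [measurable]: "Um m \<in> borel_measurable lebesgue" "Fm m \<in> borel_measurable lebesgue"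
    "Rm m \<in> borel_measurable lebesgue" for m
  proof -
    note [measurable] = borel_measurable_pair[OF borel(1)] borel_measurable_pair[OF F_borel]
      test_function_measurable[OF \<eta>m] test_function_measurable[OF dm_test]
    have "Um m \<in> borel_measurable borel" "Fm m \<in> borel_measurable borel" "Rm m \<in> borel_measurable borel"
      unfolding Um_def Fm_def Rm_def borel_prod[symmetric] by measurable
    then show "Um m \<in> borel_measurable lebesgue" "Fm m \<in> borel_measurable lebesgue"
      "Rm m \<in> borel_measurable lebesgue" by (simp_all add: measurable_completion)
  qed
  let ?A = "\<lambda>m. L2_mass ?w (Um m)" and ?B = "L2_mass ?iw u"
  have Bfin: "?B < \<infinity>" using cal(1) by (simp add: cal_eq L2_def)
  \<comment> \<open>The remainder is O(m^-2) times the mass of u in L^2(1/|V|), which is finite by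
    the choice of the solution space.\<close>
  have R_le: "L2_mass ?iw (Rm m) \<le> ennreal ((inverse (real (Suc m)) * B)\<^sup>2) * ?B" for m
  proof (rule L2_mass_mono_AE[OF AE_I2])
    fix y :: "'a \<times> real"
    have "(cmod (Rm m y))\<^sup>2 \<le> (inverse (real (Suc m)) * B)\<^sup>2 * (cmod (u y))\<^sup>2"
      using power_mono[OF dm[of m "snd y"] abs_ge_zero, of 2]
      by (auto simp: Rm_def norm_mult power_mult_distrib case_prod_beta' intro!: mult_right_mono)
    then have "ennreal ((cmod (Rm m y))\<^sup>2) \<le> ennreal ((inverse (real (Suc m)) * B)\<^sup>2) * ennreal ((cmod (u y))\<^sup>2)"
      by (simp add: ennreal_mult[symmetric] ennreal_leI)
    then show "ennreal ((cmod (Rm m y))\<^sup>2) * ?iw y \<le>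
        ennreal ((inverse (real (Suc m)) * B)\<^sup>2) * (ennreal ((cmod (u y))\<^sup>2) * ?iw y)"
      by (simp only: mult.assoc[symmetric]) (rule mult_right_mono, auto)
  qed measurable
  \<comment> \<open>Two bounds for the same mass: this one only yields finiteness, the next one,
    \<open>F_A\<close>, is the bound by \<open>?A m\<close> that gets absorbed.\<close>
  have F_le: "L2_mass ?iw (Fm m) \<le> 1 * L2_mass ?iw F" for m
  proof (rule L2_mass_mono_AE[OF AE_I2])
    fix y :: "'a \<times> real"
    have "cmod (Fm m y) \<le> 1 * cmod (F y)"
      using \<eta>m1[of m "snd y"] unfolding Fm_def case_prod_beta' norm_mult norm_of_real prod.collapse
      by (intro mult_right_mono) auto
    then have "ennreal ((cmod (Fm m y))\<^sup>2) \<le> ennreal ((cmod (F y))\<^sup>2)"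
      by (intro ennreal_leI power_mono) auto
    then show "ennreal ((cmod (Fm m y))\<^sup>2) * ?iw y \<le> 1 * (ennreal ((cmod (F y))\<^sup>2) * ?iw y)"
      unfolding mult_1 by (rule mult_right_mono) auto
  qed measurable
  have F_A: "L2_mass ?iw (Fm m) \<le> 1 * ?A m" for m
  proof (rule L2_mass_mono_AE, use wV w0 ineq in eventually_elim)
    case (elim y)
    let ?v = "cmod (V (fst y))"
    have v: "?v > 0" using elim(1,2) by auto
    have "cmod (Fm m y) \<le> ?v * cmod (Um m y)"
      using mult_left_mono[OF elim(3), of "\<bar>\<eta>m m (snd y)\<bar>"]
      by (simp add: Fm_def Um_def case_prod_beta' norm_mult mult_ac)
    \<comment> \<open>Dividing |V Um|^2 by |V| leaves |Um|^2 with weight |V|, as |V| > 0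
      here.\<close>
    then have "(cmod (Fm m y))\<^sup>2 * inverse ?v \<le> (?v * cmod (Um m y))\<^sup>2 * inverse ?v"
      by (intro mult_right_mono power_mono) auto
    also have "\<dots> = (cmod (Um m y))\<^sup>2 * ?v" using v by (simp add: power2_eq_square)
    finally have "ennreal ((cmod (Fm m y))\<^sup>2) * inverse (ennreal ?v) \<le> ennreal ((cmod (Um m y))\<^sup>2) * ennreal ?v"
      using v by (simp add: inverse_ennreal ennreal_mult[symmetric] ennreal_leI)
    then show ?case using elim(1) by (simp add: case_prod_beta')
  qed measurable
  have est0: "?A m \<le> ennreal (q\<^sup>2 * (1 + \<theta>)) *
      (ennreal (1 + \<theta>) * L2_mass ?iw (Fm m) + ennreal (1 + 1 / \<theta>) * L2_mass ?iw (Rm m))" for m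
  proof -
    have "?A m \<le> ennreal (q\<^sup>2 * (1 + \<theta>)) * L2_mass ?iw (\<lambda>y. Fm m y + Rm m y)"
      using cutoff_estimate[OF \<eta>m \<theta> w eq, of m] by (simp add: Um_def Fm_def Rm_def case_prod_beta')
    also have "\<dots> \<le> ennreal (q\<^sup>2 * (1 + \<theta>)) *
      (ennreal (1 + \<theta>) * L2_mass ?iw (Fm m) + ennreal (1 + 1 / \<theta>) * L2_mass ?iw (Rm m))"
      by (intro mult_left_mono L2_mass_add_le \<theta>) auto
    finally show ?thesis .
  qed
  have Rfin: "L2_mass ?iw (Rm m) < \<infinity>" for m
    using Bfin by (intro le_less_trans[OF R_le]) (auto simp: ennreal_mult_less_top)
  have Ffin: "L2_mass ?iw (Fm m) < \<infinity>" for m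
    using F_cal by (intro le_less_trans[OF F_le]) (auto simp: cal_eq L2_def)
  \<comment> \<open>Obtained from the estimate itself together with \<open>F_le\<close>. Absorbing
    \<kappa> times \<open>?A m\<close> into the left-hand side is a subtraction and needs finite
    numbers.\<close>
  have Afin: "?A m < \<infinity>" for m
    using Rfin[of m] Ffin[of m] by (intro le_less_trans[OF est0]) (auto simp: ennreal_mult_less_top)
  define a where "a = (\<lambda>m. enn2real (?A m))"
  define b where "b = enn2real ?B"
  have A: "?A m = ennreal (a m)" for m using Afin[of m] by (simp add: a_def)
  have B': "?B = ennreal b" using Bfin by (simp add: b_def)
  have a0: "0 \<le> a m" and b0: "0 \<le> b" for m by (simp_all add: a_def b_def)
  define c where "c = q\<^sup>2 * (1 + \<theta>) * (1 + 1 / \<theta>) * B\<^sup>2 * b"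
  \<comment> \<open>Now \<open>F_A\<close> replaces \<open>F_le\<close>; the factor 1 - \<kappa> > 0
    remains on the left and the right-hand side is O(m^-2).\<close>
  have est1: "(1 - \<kappa>) * a m \<le> c * (inverse (real (Suc m)))\<^sup>2" for m
  proof -
    have "?A m \<le> ennreal (q\<^sup>2 * (1 + \<theta>)) *
      (ennreal (1 + \<theta>) * ennreal (a m) + ennreal (1 + 1 / \<theta>) * (ennreal ((inverse (real (Suc m)) * B)\<^sup>2) * ennreal b))"
      using F_A[of m] R_le[of m] unfolding A B' mult_1
      by (intro order_trans[OF est0[unfolded A]] mult_left_mono add_mono) auto
    also have "\<dots> = ennreal (q\<^sup>2 * (1 + \<theta>) *
      ((1 + \<theta>) * a m + (1 + 1 / \<theta>) * ((inverse (real (Suc m)) * B)\<^sup>2 * b)))"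
      using \<theta> a0[of m] b0 by (simp only: ennreal_mult[symmetric] ennreal_plus[symmetric]
          mult_nonneg_nonneg add_nonneg_nonneg zero_le_power2 zero_le_one less_imp_le zero_le_divide_1_iff)
    finally have "a m \<le> q\<^sup>2 * (1 + \<theta>) * ((1 + \<theta>) * a m + (1 + 1 / \<theta>) * ((inverse (real (Suc m)) * B)\<^sup>2 * b))"
      using \<theta> a0[of m] b0 unfolding A by (subst (asm) ennreal_le_iff) auto
    moreover have "(1 - k * k') * x \<le> k * e * B\<^sup>2 * b * d\<^sup>2" if "x \<le> k * (k' * x + e * ((d * B)\<^sup>2 * b))"
      for k k' x e d :: real
      using that by (simp add: power_mult_distrib algebra_simps)
    ultimately show ?thesis unfolding \<kappa>_def c_def by blast
  qed
  have "a \<longlonglongrightarrow> 0"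
  proof (rule tendsto_sandwich[OF _ _ tendsto_const])
    have "(\<lambda>m. c / (1 - \<kappa>) * (inverse (real (Suc m)))\<^sup>2) \<longlonglongrightarrow> c / (1 - \<kappa>) * 0\<^sup>2"
      by (intro tendsto_intros LIMSEQ_inverse_real_of_nat)
    then show "(\<lambda>m. c / (1 - \<kappa>) * (inverse (real (Suc m)))\<^sup>2) \<longlonglongrightarrow> 0" by simp
    show "\<forall>\<^sub>F m in sequentially. a m \<le> c / (1 - \<kappa>) * (inverse (real (Suc m)))\<^sup>2"
      using est1 \<kappa>(2) by (intro always_eventually allI) (simp add: field_simps)
  qed (use a0 in auto)
  then have "?A \<longlonglongrightarrow> ennreal 0" unfolding A by (rule tendsto_ennrealI)
  then have lim: "liminf ?A = 0" by (simp add: lim_imp_Liminf)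
  \<comment> \<open>Pointwise the dilated cutoffs tend to the constant \<open>\<eta> 0\<close>,
    which is nonzero. By Fatou the weighted mass of \<open>\<eta> 0\<close> times u is at most the
    lower limit of \<open>?A\<close>, that is 0; almost everywhere positivity of the weight then
    forces u = 0.\<close>
  have "(\<integral>\<^sup>+y. ennreal ((cmod (complex_of_real (\<eta> 0) * u y))\<^sup>2) * ?w y \<partial>lebesgue) =
      (\<integral>\<^sup>+y. liminf (\<lambda>m. ennreal ((cmod (Um m y))\<^sup>2) * ?w y) \<partial>lebesgue)"
  proof (rule nn_integral_cong_AE, rule AE_completion, use wV in eventually_elim)
    case (elim y)
    have "(\<lambda>m. \<eta> (inverse (real (Suc m)) * snd y)) \<longlonglongrightarrow> \<eta> (0 * snd y)"
      using test_functionD(3)[OF \<eta>, of UNIV]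
      by (intro isCont_tendsto_compose[of _ \<eta>] tendsto_intros LIMSEQ_inverse_real_of_nat)
        (auto simp: continuous_on_eq_continuous_at)
    then have "(\<lambda>m. \<eta>m m (snd y)) \<longlonglongrightarrow> \<eta> 0" by (simp add: \<eta>m_def)
    then have "(\<lambda>m. (cmod (complex_of_real (\<eta>m m (snd y)) * u y))\<^sup>2 * cmod (V (fst y))) \<longlonglongrightarrow>
        (cmod (complex_of_real (\<eta> 0) * u y))\<^sup>2 * cmod (V (fst y))"
      by (intro tendsto_intros)
    from tendsto_ennrealI[OF this]
    have "(\<lambda>m. ennreal ((cmod (Um m y))\<^sup>2) * ?w y) \<longlonglongrightarrow> ennreal ((cmod (complex_of_real (\<eta> 0) * u y))\<^sup>2) * ?w y"
      unfolding elim by (simp add: Um_def case_prod_beta' ennreal_mult)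
    from lim_imp_Liminf[OF _ this] show ?case by simp
  qed
  also have "\<dots> \<le> liminf ?A"
    unfolding L2_mass_def by (intro nn_integral_liminf) measurable
  finally have "(\<integral>\<^sup>+y. ennreal ((cmod (complex_of_real (\<eta> 0) * u y))\<^sup>2) * ?w y \<partial>lebesgue) = 0"
    using lim by simp
  then have "AE y in lebesgue. ennreal ((cmod (complex_of_real (\<eta> 0) * u y))\<^sup>2) * ?w y = 0"
    by (subst (asm) nn_integral_0_iff_AE) auto
  then have "AE y in lborel. ennreal ((cmod (complex_of_real (\<eta> 0) * u y))\<^sup>2) * ?w y = 0"
    by (simp add: AE_completion_iff)
  then show ?thesis
    using w0
  proof eventually_elim
    case (elim y)
    have "\<eta> 0 \<noteq> 0" by (simp add: \<eta>_def bump_nonzero_iff)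
    then show ?case using elim by auto
  qed
qed

end

lemma L2_cong_AE:
  assumes "f \<in> L2 w" "AE x in lborel. f x = g x" "g \<in> borel_measurable lebesgue"
  shows "g \<in> L2 w"
  using assms L2_mass_cong_AE[OF assms(2) AE_I2[OF refl], of w] by (simp add: L2_def)

lemma cal_L2_borel_representative:
  assumes "f \<in> cal_L2 V"
  obtains g where "g \<in> borel_measurable borel" "g \<in> cal_L2 V" "AE y in lborel. f y = g y"
proof -
  have "f \<in> borel_measurable lebesgue" using assms by (simp add: cal_L2_def L2_def)
  then obtain g where g: "g \<in> borel_measurable borel" "AE y in lborel. f y = g y"
    by (rule lebesgue_borel_representative) blast
  have "g \<in> borel_measurable lebesgue" using g(1) by (simp add: measurable_completion)
  then have "g \<in> cal_L2 V"
    using assms g(2) unfolding cal_L2_def by (auto intro: L2_cong_AE)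
  with g show ?thesis using that by blast
qed

text \<open>Reduction to Borel representatives: u, its derivatives and the choices made by
  \<open>weak_deriv\<close> are changed on null sets only, so the inequality for
  \<open>schroedinger_op u\<close> becomes one for the function \<open>F\<close> of the
  locale.\<close>

lemma schroedinger_vanishes:
  fixes V :: "'a::euclidean_space \<Rightarrow> complex"
  assumes V: "V \<in> borel_measurable lebesgue" and est: "resolvent_estimate V q" "0 \<le> q" "q < 1"
    and nonzero: "AE x in lebesgue. absw V x \<noteq> 0"
    and u: "u \<in> solution_space V" and ineq: "schroedinger_inequality V u"
  shows "AE y in lebesgue. u y = 0"
proof -
  have ucal: "u \<in> cal_L2 V" using u by (simp add: solution_space_def numeral_2_eq_2)
  obtain ut where ut: "ut \<in> cal_L2 V" "has_weak_deriv u (0, 1) ut"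
    using u by (auto simp: solution_space_def t_dirs_def)
  have "\<exists>g. g \<in> cal_L2 V \<and> has_weak_deriv u (b, 0) g \<and>
      (\<exists>h. \<forall>c\<in>Basis. h c \<in> cal_L2 V \<and> has_weak_deriv g (c, 0) (h c))" if "b \<in> Basis" for b
  proof -
    obtain g where g: "g \<in> sobolev 1 x_dirs (cal_L2 V)" "has_weak_deriv u (b, 0) g"
    proof -
      have "u \<in> sobolev (Suc 1) x_dirs (cal_L2 V)" "(b, 0) \<in> x_dirs"
        using u \<open>b \<in> Basis\<close> by (auto simp: solution_space_def numeral_2_eq_2 x_dirs_def)
      then show ?thesis using that unfolding sobolev.simps by blast
    qed
    then have "\<forall>c\<in>Basis. \<exists>h. h \<in> cal_L2 V \<and> has_weak_deriv g (c, 0) h"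
      by (auto simp: x_dirs_def)
    from bchoice[OF this] show ?thesis using g by auto
  qed
  then obtain ux uxx where ux: "\<And>b. b \<in> Basis \<Longrightarrow> ux b \<in> cal_L2 V"
      "\<And>b. b \<in> Basis \<Longrightarrow> has_weak_deriv u (b, 0) (ux b)"
    and uxx: "\<And>b c. b \<in> Basis \<Longrightarrow> c \<in> Basis \<Longrightarrow> uxx b c \<in> cal_L2 V"
      "\<And>b c. b \<in> Basis \<Longrightarrow> c \<in> Basis \<Longrightarrow> has_weak_deriv (ux b) (c, 0) (uxx b c)"
    by metis
  \<comment> \<open>One function \<open>rep\<close> serves all members of the space, so that u and
    its derivatives are replaced consistently and \<open>rep_deriv\<close> links their
    representatives.\<close>
  obtain rep where rep: "\<And>f. f \<in> cal_L2 V \<Longrightarrow> rep f \<in> borel_measurable borel"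
    "\<And>f. f \<in> cal_L2 V \<Longrightarrow> rep f \<in> cal_L2 V" "\<And>f. f \<in> cal_L2 V \<Longrightarrow> AE y in lborel. f y = rep f y"
  proof -
    have "\<exists>g. f \<in> cal_L2 V \<longrightarrow> g \<in> borel_measurable borel \<and> g \<in> cal_L2 V \<and> (AE y in lborel. f y = g y)"
      for f :: "'a \<times> real \<Rightarrow> complex"
      by (cases "f \<in> cal_L2 V") (auto elim: cal_L2_borel_representative)
    then show ?thesis using that by metis
  qed
  have rep_deriv: "has_weak_deriv (rep f) b (rep g)"
    if "f \<in> cal_L2 V" "g \<in> cal_L2 V" "has_weak_deriv f b g" "b \<in> Basis" for f g b
    using that rep by (intro has_weak_deriv_cong_AE[OF that(3,4)] AE_completion) (auto simp: measurable_completion)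
  interpret solution_data V q "rep u" "rep ut" "\<lambda>b. rep (ux b)" "\<lambda>b c. rep (uxx b c)"
  proof
    show "has_weak_deriv (rep u) (0, 1) (rep ut)"
      by (intro rep_deriv ucal ut) (simp add: Basis_prod_def)
    show "has_weak_deriv (rep u) (b, 0) (rep (ux b))" if "b \<in> Basis" for b
      using that by (intro rep_deriv ucal ux) (auto simp: Basis_prod_def)
    show "has_weak_deriv (rep (ux b)) (c, 0) (rep (uxx b c))" if "b \<in> Basis" "c \<in> Basis" for b c
      using that by (intro rep_deriv ux uxx) (auto simp: Basis_prod_def)
  qed (use V est rep ucal ut ux uxx in auto)
  have "AE y in lborel. schroedinger_op u y = F y"
  proof -
    have "AE y in lebesgue. weak_deriv (0, 1) u y = ut y" by (rule weak_deriv_AE(1)[OF ut(2)])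
    moreover have "AE y in lebesgue. \<forall>b\<in>Basis. weak_deriv (b, 0) (weak_deriv (b, 0) u) y = uxx b b y"
      using ux uxx by (intro AE_finite_allI finite_Basis weak_deriv_weak_deriv_AE) (auto simp: Basis_prod_def)
    moreover have "AE y in lebesgue. ut y = rep ut y" by (intro AE_completion rep ut)
    moreover have "AE y in lebesgue. \<forall>b\<in>Basis. uxx b b y = rep (uxx b b) y"
      by (intro AE_finite_allI finite_Basis AE_completion rep uxx)
    ultimately have "AE y in lebesgue. schroedinger_op u y = F y"
    proof eventually_elim
      case (elim y)
      have "laplacian_dirs x_dirs u y = (\<Sum>b\<in>Basis. weak_deriv (b, 0) (weak_deriv (b, 0) u) y)"
        unfolding laplacian_dirs_def x_dirs_def by (subst sum.reindex) (auto simp: inj_on_def)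
      then show ?case using elim by (simp add: schroedinger_op_def F_def)
    qed
    then show ?thesis by (simp add: AE_completion_iff)
  qed
  moreover have "AE y in lborel. cmod (schroedinger_op u y) \<le> cmod (V (fst y) * u y)"
    using ineq unfolding schroedinger_inequality_def by (simp add: AE_completion_iff case_prod_beta')
  ultimately have "AE y in lborel. cmod (F y) \<le> cmod (V (fst y)) * cmod (rep u y)"
    using rep(3)[OF ucal] by eventually_elim (simp add: norm_mult)
  moreover have "AE x in lborel. absw V x \<noteq> 0" using nonzero by (simp add: AE_completion_iff)
  ultimately have "AE y in lborel. rep u y = 0" by (intro vanishes assms(4))
  then have "AE y in lborel. u y = 0" using rep(3)[OF ucal] by eventually_elim simp
  then show ?thesis by (rule AE_completion)
qed

theorem theorem1p4:
  fixes R :: "(real ^ 'n \<Rightarrow> complex) set"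
    and br :: "(real ^ 'n \<Rightarrow> complex) \<Rightarrow> real"
  assumes "CARD('n) \<ge> 2"
    and "resolvent_type R br"
  shows "\<forall>C::real. \<exists>\<epsilon>>0. \<forall>(\<nu> :: (real ^ 'n) \<times> real) V u.
           norm \<nu> = 1 \<longrightarrow>
           V \<in> R \<longrightarrow>
           u \<in> solution_space V \<longrightarrow>
           schroedinger_inequality V u \<longrightarrow>
           (\<exists>c. AE y in lebesgue. y \<in> half_space \<nu> c \<longrightarrow> u y = 0) \<longrightarrow>
           A2_dir C (fst \<nu>) (absw V) \<longrightarrow>
           br V < \<epsilon> \<longrightarrow>
           (AE y in lebesgue. u y = 0)"
proof (intro allI exI[of _ "1::real"] conjI impI)
  fix C :: real and \<nu> :: "(real ^ 'n) \<times> real" and V u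
  assume VR: "V \<in> R" and u: "u \<in> solution_space V" "schroedinger_inequality V u"
    and A2: "A2_dir C (fst \<nu>) (absw V)" and small: "br V < 1"
  \<comment> \<open>Being a weight is part of \<open>A2_dir\<close>, and a weight vanishes only on a
    null set; this gives the positivity by which |V| is divided out.\<close>
  have "AE x in lebesgue. absw V x \<noteq> 0"
    using A2 unfolding A2_dir_def weight_def by (auto elim: eventually_mono)
  moreover have "V \<in> borel_measurable lebesgue" "resolvent_estimate V (br V)" "0 \<le> br V"
    using assms(2) VR by (auto simp: resolvent_type_def)
  ultimately show "AE y in lebesgue. u y = 0"
    using small u by (intro schroedinger_vanishes[of V "br V"])
qed simp

end
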